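(* Let $T>0$ and let $U\in C^1\big([0,T);(H_0^1(\Omega))^N\big)$ be a solution of $$\frac{\mathrm{d}U}{\mathrm{d}t}=\mathcal{G}U-U\langle \mathcal{G}U,U\rangle,\qquad U(0)=U_0,$$ with initial data $U_0\in\mathcal{M}^N_{\geqslant}$. Then $$\frac{\mathrm{d}}{\mathrm{d}t}E(U(t))\leqslant 0\quad\text{for all } t\in[0,T).$$
   Context: $\Omega\subset\mathbb{R}^d$ is a bounded domain, and $(\cdot,\cdot)$, $\|\cdot\|$ denote the $L^2(\Omega)$ inner product and norm. $\mathcal{V}:\Omega\to\mathbb{R}$ is a potential such that the bilinear form $a(u,v)=\int_\Omega(\nabla u\cdot\nabla v+\mathcal{V}uv)\,dx$ on $H_0^1(\Omega)$ is symmetric, bounded and coercive, i.e. there are constants $c_1,c_2>0$ with $c_1\|\nabla u\|^2\leqslant a(u,u)\leqslant c_2\|\nabla u\|^2$ for all $u\in H_0^1(\Omega)$. $\mathcal{G}=(-\Delta+\mathcal{V})^{-1}$: for $f\in H^{-1}(\Omega)$, $\mathcal{G}f\in H_0^1(\Omega)$ is the unique element with $a(\mathcal{G}f,v)=\langle f,v\rangle$ for all $v\in H_0^1(\Omega)$. For $N$-tuples $U=(u_1,\dots,u_N)$ and $V=(v_1,\dots,v_N)$: - $\mathcal{G}U=(\mathcal{G}u_1,\dots,\mathcal{G}u_N)$; - for a matrix $A\in\mathbb{R}^{N\times N}$, $UA$ is the tuple with $j$-th entry $\sum_i u_iA_{ij}$; - $\langle U,V\rangle=((u_i,v_j))_{i,j=1}^N$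 and $\langle U,V\rangle_a=(a(u_i,v_j))_{i,j=1}^N$; - $(U,V)_a=\operatorname{tr}\langle U,V\rangle_a$. The energy is $E(U)=\frac12(U,U)_a$. For symmetric matrices, $A\leqslant B$ means $B-A$ is positive semidefinite. The quasi-Stiefel set is $\mathcal{M}^N_{\geqslant}=\{U\in(H_0^1(\Omega))^N:\langle U,U\rangle\geqslant I_N\}$. *)

theory Defs
  imports "HOL-Analysis.Analysis"
begin

coinductive smooth_fun :: "('a::euclidean_space \<Rightarrow> real) \<Rightarrow> bool" where
  "(\<forall>x. f differentiable (at x)) \<Longrightarrow>
   (\<forall>b\<in>Basis. smooth_fun (\<lambda>x. frechet_derivative f (at x) b)) \<Longrightarrow> smooth_fun f"

definition test_fun :: "'a::euclidean_space set \<Rightarrow> ('a \<Rightarrow> real) \<Rightarrow> bool" where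
  "test_fun \<Omega> \<phi> \<longleftrightarrow> smooth_fun \<phi> \<and> compact (closure {x. \<phi> x \<noteq> 0})
      \<and> closure {x. \<phi> x \<noteq> 0} \<subseteq> \<Omega>"

definition L2 :: "'a::euclidean_space set \<Rightarrow> ('a \<Rightarrow> real) set" where
  "L2 \<Omega> = {u. u \<in> borel_measurable (lebesgue_on \<Omega>) \<and> integrable (lebesgue_on \<Omega>) (\<lambda>x. (u x)\<^sup>2)}"

definition l2_inner :: "'a::euclidean_space set \<Rightarrow> ('a \<Rightarrow> real) \<Rightarrow> ('a \<Rightarrow> real) \<Rightarrow> real" where
  "l2_inner \<Omega> u v = (\<integral>x. u x * v x \<partial>lebesgue_on \<Omega>)"

definition is_weak_grad :: "'a::euclidean_space set \<Rightarrow> ('a \<Rightarrow> real) \<Rightarrow> ('a \<Rightarrow> 'a) \<Rightarrow> bool" where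
  "is_weak_grad \<Omega> u g \<longleftrightarrow>
     g \<in> borel_measurable (lebesgue_on \<Omega>) \<and>
     integrable (lebesgue_on \<Omega>) (\<lambda>x. (norm (g x))\<^sup>2) \<and>
     (\<forall>\<phi>. test_fun \<Omega> \<phi> \<longrightarrow> (\<forall>b\<in>Basis.
        (\<integral>x. u x * frechet_derivative \<phi> (at x) b \<partial>lebesgue_on \<Omega>)
          = - (\<integral>x. (g x \<bullet> b) * \<phi> x \<partial>lebesgue_on \<Omega>)))"

text \<open>The weak gradient (unique up to null sets; any representative).\<close>
definition wgrad :: "'a::euclidean_space set \<Rightarrow> ('a \<Rightarrow> real) \<Rightarrow> 'a \<Rightarrow> 'a" where
  "wgrad \<Omega> u = (SOME g. is_weak_grad \<Omega> u g)"

definition H1 :: "'a::euclidean_space set \<Rightarrow> ('a \<Rightarrow> real) set" where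
  "H1 \<Omega> = {u \<in> L2 \<Omega>. \<exists>g. is_weak_grad \<Omega> u g}"

definition h1_norm :: "'a::euclidean_space set \<Rightarrow> ('a \<Rightarrow> real) \<Rightarrow> real" where
  "h1_norm \<Omega> u = sqrt ((\<integral>x. (u x)\<^sup>2 \<partial>lebesgue_on \<Omega>)
                      + (\<integral>x. (norm (wgrad \<Omega> u x))\<^sup>2 \<partial>lebesgue_on \<Omega>))"

definition H01 :: "'a::euclidean_space set \<Rightarrow> ('a \<Rightarrow> real) set" where
  "H01 \<Omega> = {u \<in> H1 \<Omega>. \<exists>\<phi>::nat \<Rightarrow> 'a \<Rightarrow> real. (\<forall>n. test_fun \<Omega> (\<phi> n)) \<and>
               (\<lambda>n. h1_norm \<Omega> (\<lambda>x. \<phi> n x - u x)) \<longlonglongrightarrow> 0}"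

definition grad_sq :: "'a::euclidean_space set \<Rightarrow> ('a \<Rightarrow> real) \<Rightarrow> real" where
  "grad_sq \<Omega> u = (\<integral>x. (norm (wgrad \<Omega> u x))\<^sup>2 \<partial>lebesgue_on \<Omega>)"

definition aform :: "'a::euclidean_space set \<Rightarrow> ('a \<Rightarrow> real) \<Rightarrow> ('a \<Rightarrow> real) \<Rightarrow> ('a \<Rightarrow> real) \<Rightarrow> real" where
  "aform \<Omega> V u v = (\<integral>x. wgrad \<Omega> u x \<bullet> wgrad \<Omega> v x + V x * u x * v x \<partial>lebesgue_on \<Omega>)"

text \<open>G = (-Laplacian + V)^(-1), applied to L2 data f (acting on v by (f,v)).\<close>
definition Gop :: "'a::euclidean_space set \<Rightarrow> ('a \<Rightarrow> real) \<Rightarrow> ('a \<Rightarrow> real) \<Rightarrow> ('a \<Rightarrow> real)" where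
  "Gop \<Omega> V f = (SOME g. g \<in> H01 \<Omega> \<and> (\<forall>v\<in>H01 \<Omega>. aform \<Omega> V g v = l2_inner \<Omega> f v))"

definition gram :: "'a::euclidean_space set \<Rightarrow> ('n::finite \<Rightarrow> 'a \<Rightarrow> real) \<Rightarrow> ('n \<Rightarrow> 'a \<Rightarrow> real) \<Rightarrow> real^'n^'n" where
  "gram \<Omega> U W = (\<chi> i j. l2_inner \<Omega> (U i) (W j))"

definition tuple_mult :: "('n::finite \<Rightarrow> 'a \<Rightarrow> real) \<Rightarrow> real^'n^'n \<Rightarrow> ('n \<Rightarrow> 'a \<Rightarrow> real)" where
  "tuple_mult U A = (\<lambda>j x. \<Sum>i\<in>UNIV. U i x * A $ i $ j)"

definition Gtuple :: "'a::euclidean_space set \<Rightarrow> ('a \<Rightarrow> real) \<Rightarrow> ('n::finite \<Rightarrow> 'a \<Rightarrow> real) \<Rightarrow> ('n \<Rightarrow> 'a \<Rightarrow> real)" where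
  "Gtuple \<Omega> V U = (\<lambda>i. Gop \<Omega> V (U i))"

definition energy :: "'a::euclidean_space set \<Rightarrow> ('a \<Rightarrow> real) \<Rightarrow> ('n::finite \<Rightarrow> 'a \<Rightarrow> real) \<Rightarrow> real" where
  "energy \<Omega> V U = (1/2) * (\<Sum>i\<in>UNIV. aform \<Omega> V (U i) (U i))"

definition mat_le :: "real^'n::finite^'n \<Rightarrow> real^'n^'n \<Rightarrow> bool" where
  "mat_le A B \<longleftrightarrow> (\<forall>x. 0 \<le> x \<bullet> ((B - A) *v x))"

definition quasi_stiefel :: "'a::euclidean_space set \<Rightarrow> ('n::finite \<Rightarrow> 'a \<Rightarrow> real) set" where
  "quasi_stiefel \<Omega> = {U. (\<forall>i. U i \<in> H01 \<Omega>) \<and> mat_le (mat 1) (gram \<Omega> U U)}"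

definition flow_rhs :: "'a::euclidean_space set \<Rightarrow> ('a \<Rightarrow> real) \<Rightarrow> ('n::finite \<Rightarrow> 'a \<Rightarrow> real) \<Rightarrow> ('n \<Rightarrow> 'a \<Rightarrow> real)" where
  "flow_rhs \<Omega> V U = (\<lambda>i x. Gtuple \<Omega> V U i x - tuple_mult U (gram \<Omega> (Gtuple \<Omega> V U) U) i x)"

end

theory Submission
  imports Defs
begin

text \<open>
  Write \<open>M = \<langle>U, U\<rangle>\<close>, \<open>K = \<langle>\<G>U, U\<rangle> = \<langle>\<G>U, \<G>U\<rangle>\<^sub>a\<close> and \<open>A = \<langle>U, U\<rangle>\<^sub>a\<close>. Along the flow
  \<open>P = M - I\<close> satisfies \<open>P' = - (K P + P K)\<close> with \<open>K \<ge> 0\<close>, which keeps \<open>P\<close> positive semidefinite, so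
  \<open>M \<ge> I\<close> for all times and \<open>K\<close> is invertible. The energy has derivative \<open>tr M - tr (K A)\<close>. Since
  \<open>\<langle>\<G>U, U\<rangle>\<^sub>a = M\<close>, the Gram matrix of \<open>W = U - \<G>U K\<^sup>-\<^sup>1\<close> is
  \<open>\<langle>W, W\<rangle>\<^sub>a = A - M K\<^sup>-\<^sup>1 - K\<^sup>-\<^sup>1 M + K\<^sup>-\<^sup>1\<close>, and
  \<open>0 \<le> tr (K \<langle>W, W\<rangle>\<^sub>a) = tr (K A) - 2 tr M + N\<close> gives \<open>tr M - tr (K A) \<le> N - tr M \<le> 0\<close>.

  The operator \<open>\<G>\<close> is a Hilbert choice, so its defining property rests on existence: this is the
  Riesz representation theorem on \<open>H\<^sub>0\<^sup>1\<close>, which needs completeness of \<open>H\<^sub>0\<^sup>1\<close>, the Poincare inequality,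
  and uniqueness of weak gradients (so that the chosen gradient depends linearly on the function).
\<close>

section \<open>Semi-inner products on function spaces\<close>

text \<open>The matrix \<open>W\<close> is the velocity in disguise: with
  \<open>F = \<G>U - U K\<close> one has \<open>W = - F K^-1\<close>, and weighting by
  \<open>K\<close> gives the dissipation identity
  \<open>dE/dt = (N - tr M) - tr (K^-1 <F,F>_a)\<close>. Only \<open>N - tr M\<close> could have the
  wrong sign, which is why the one-sided constraint has to be propagated in time. For this the
  matrix equation is not solved: a first-time argument on the unit sphere uses only pointwise
  properties of \<open>K\<close>, with an \<epsilon> margin because \<open>P\<close> may be singular
  at the start. Functions are never identified up to null sets. The forms are therefore only
  semidefinite, gradients and solutions are chosen representatives, and the chosen gradient is
  linear only almost everywhere. Hence everything runs in spaces of functions with a semi-inner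
  product, limits are limits in its seminorm, and \<open>\<G>\<close> enters the flow argument only
  through \<open>a(\<G>f, v) = (f, v)\<close>, never through linearity. Uniqueness of weak gradients
  in turn requires a concrete supply of test functions, built from
  \<open>exp (- 1/x)\<close>.\<close>

locale semi_inner =
  fixes S :: "('x \<Rightarrow> real) set" and B :: "('x \<Rightarrow> real) \<Rightarrow> ('x \<Rightarrow> real) \<Rightarrow> real"
  assumes zero_mem: "(\<lambda>x. 0) \<in> S"
    and lincomb_mem: "\<And>u v c d. u \<in> S \<Longrightarrow> v \<in> S \<Longrightarrow> (\<lambda>x. c * u x + d * v x) \<in> S"
    and lincomb_left: "\<And>u v w c d. u \<in> S \<Longrightarrow> v \<in> S \<Longrightarrow> w \<in> S \<Longrightarrow>
        B (\<lambda>x. c * u x + d * v x) w = c * B u w + d * B v w"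
    and sym: "\<And>u v. u \<in> S \<Longrightarrow> v \<in> S \<Longrightarrow> B u v = B v u"
    and nonneg: "\<And>u. u \<in> S \<Longrightarrow> 0 \<le> B u u"
begin

definition nrm :: "('x \<Rightarrow> real) \<Rightarrow> real" where "nrm u = sqrt (B u u)"

lemma nrm_nonneg: "u \<in> S \<Longrightarrow> 0 \<le> nrm u"
  by (simp add: nrm_def nonneg)

lemma nrm_sq: "u \<in> S \<Longrightarrow> (nrm u)\<^sup>2 = B u u"
  by (simp add: nrm_def nonneg)

lemma lincomb_right:
  assumes "u \<in> S" "v \<in> S" "w \<in> S"
  shows "B w (\<lambda>x. c * u x + d * v x) = c * B w u + d * B w v"
  using assms by (simp add: sym[of w] lincomb_mem lincomb_left)

lemma add_mem: "u \<in> S \<Longrightarrow> v \<in> S \<Longrightarrow> (\<lambda>x. u x + v x) \<in> S"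
  using lincomb_mem[of u v 1 1] by simp

lemma diff_mem: "u \<in> S \<Longrightarrow> v \<in> S \<Longrightarrow> (\<lambda>x. u x - v x) \<in> S"
  using lincomb_mem[of u v 1 "-1"] by simp

lemma scale_mem: "u \<in> S \<Longrightarrow> (\<lambda>x. c * u x) \<in> S"
  using lincomb_mem[of u u c 0] by simp

lemma scale_left: "u \<in> S \<Longrightarrow> w \<in> S \<Longrightarrow> B (\<lambda>x. c * u x) w = c * B u w"
  using lincomb_left[of u u w c 0] by simp

lemma zero_left: "w \<in> S \<Longrightarrow> B (\<lambda>x. 0) w = 0"
  using scale_left[OF zero_mem, of w 0] by simp

lemma add_left: "u \<in> S \<Longrightarrow> v \<in> S \<Longrightarrow> w \<in> S \<Longrightarrow> B (\<lambda>x. u x + v x) w = B u w + B v w"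
  using lincomb_left[of u v w 1 1] by simp

lemma diff_left: "u \<in> S \<Longrightarrow> v \<in> S \<Longrightarrow> w \<in> S \<Longrightarrow> B (\<lambda>x. u x - v x) w = B u w - B v w"
  using lincomb_left[of u v w 1 "-1"] by simp

lemma diff_right: "u \<in> S \<Longrightarrow> v \<in> S \<Longrightarrow> w \<in> S \<Longrightarrow> B w (\<lambda>x. u x - v x) = B w u - B w v"
  using lincomb_right[of u v w 1 "-1"] by simp

lemma sum_mem:
  assumes "finite I" "\<And>i. i \<in> I \<Longrightarrow> u i \<in> S"
  shows "(\<lambda>x. \<Sum>i\<in>I. c i * u i x) \<in> S"
  using assms by (induction I rule: finite_induct) (simp_all add: zero_mem add_mem scale_mem)

lemma sum_left:
  assumes "finite I" "\<And>i. i \<in> I \<Longrightarrow> u i \<in> S" "w \<in> S"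
  shows "B (\<lambda>x. \<Sum>i\<in>I. c i * u i x) w = (\<Sum>i\<in>I. c i * B (u i) w)"
  using assms
  by (induction I rule: finite_induct) (simp_all add: zero_left add_left sum_mem scale_mem scale_left)

lemma sum_right:
  assumes "finite I" "\<And>i. i \<in> I \<Longrightarrow> u i \<in> S" "w \<in> S"
  shows "B w (\<lambda>x. \<Sum>i\<in>I. c i * u i x) = (\<Sum>i\<in>I. c i * B w (u i))"
  using assms by (simp add: sym[of w] sum_mem sum_left)

text \<open>Nonnegativity of \<open>B\<close> at \<open>u + c v\<close> for every real
  \<open>c\<close>. As \<open>B\<close> is only semidefinite, \<open>B v v = 0\<close> is a case of
  its own: the bound is then affine in \<open>c\<close> and forces \<open>B u v = 0\<close>.\<close>

lemma Cauchy_Schwarz: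
  assumes u: "u \<in> S" and v: "v \<in> S"
  shows "\<bar>B u v\<bar> \<le> nrm u * nrm v"
proof -
  have q: "0 \<le> B u u + 2 * c * B u v + c\<^sup>2 * B v v" for c
  proof -
    have "B (\<lambda>x. 1 * u x + c * v x) (\<lambda>x. 1 * u x + c * v x) = B u u + 2 * c * B u v + c\<^sup>2 * B v v"
      using u v lincomb_left[OF u v lincomb_mem[OF u v, of 1 c], of 1 c]
        lincomb_right[OF u v u, of 1 c] lincomb_right[OF u v v, of 1 c] sym[OF u v]
      by (simp add: algebra_simps power2_eq_square)
    then show ?thesis using nonneg[OF lincomb_mem[OF u v, of 1 c]] by simp
  qed
  have "(B u v)\<^sup>2 \<le> B u u * B v v"
  proof (cases "B v v = 0")
    case True
    have "B u v = 0"
    proof (rule ccontr)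
      assume "B u v \<noteq> 0"
      \<comment> \<open>The chosen \<open>c\<close> gives the affine expression the value
        -1.\<close>
      then show False
        using q[of "- (B u u + 1) / (2 * B u v)"] True by (simp add: field_simps)
    qed
    then show ?thesis using True by simp
  next
    case False
    then have pos: "B v v > 0" using nonneg[OF v] by simp
    have "0 \<le> B v v * (B u u + 2 * (- B u v / B v v) * B u v + (- B u v / B v v)\<^sup>2 * B v v)"
      using q[of "- B u v / B v v"] pos by (intro mult_nonneg_nonneg) auto
    also have "\<dots> = B u u * B v v - (B u v)\<^sup>2"
      using pos by (simp add: field_simps power2_eq_square)
    finally show ?thesis by simp
  qed
  then have "\<bar>B u v\<bar> \<le> sqrt (B u u * B v v)" by (intro real_le_rsqrt) simp
  then show ?thesis by (simp add: nrm_def real_sqrt_mult)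
qed

lemma nrm_triangle:
  assumes u: "u \<in> S" and v: "v \<in> S"
  shows "nrm (\<lambda>x. u x + v x) \<le> nrm u + nrm v"
proof -
  have "(nrm (\<lambda>x. u x + v x))\<^sup>2 = B u u + 2 * B u v + B v v"
    using u v by (simp add: nrm_sq add_mem add_left sym[of _ "\<lambda>x. u x + v x"] sym[of v u])
  also have "\<dots> \<le> B u u + 2 * (nrm u * nrm v) + B v v"
    using Cauchy_Schwarz[OF u v] by simp
  also have "\<dots> = (nrm u + nrm v)\<^sup>2"
    using u v by (simp add: power2_sum nrm_sq)
  finally show ?thesis
    using nrm_nonneg[OF u] nrm_nonneg[OF v] by (meson add_nonneg_nonneg power2_le_imp_le)
qed

lemma nrm_scale: "u \<in> S \<Longrightarrow> nrm (\<lambda>x. c * u x) = \<bar>c\<bar> * nrm u"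
  by (simp add: nrm_def scale_left scale_mem sym[of u "\<lambda>x. c * u x"] real_sqrt_mult flip: mult.assoc)

lemma nrm_minus_commute:
  assumes "u \<in> S" "v \<in> S"
  shows "nrm (\<lambda>x. u x - v x) = nrm (\<lambda>x. v x - u x)"
  using nrm_scale[OF diff_mem[OF assms], of "-1"] by simp

lemma nrm_triangle_diff:
  assumes "u \<in> S" "v \<in> S" "w \<in> S"
  shows "nrm (\<lambda>x. u x - w x) \<le> nrm (\<lambda>x. u x - v x) + nrm (\<lambda>x. v x - w x)"
  using nrm_triangle[OF diff_mem[OF assms(1,2)] diff_mem[OF assms(2,3)]] by simp

lemma parallelogram:
  assumes u: "u \<in> S" and v: "v \<in> S"
  shows "B (\<lambda>x. u x - v x) (\<lambda>x. u x - v x) = 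
    2 * B u u + 2 * B v v - 4 * B (\<lambda>x. 1/2 * u x + 1/2 * v x) (\<lambda>x. 1/2 * u x + 1/2 * v x)"
  using u v lincomb_left[OF u v lincomb_mem[OF u v, of "1/2" "1/2"], of "1/2" "1/2"]
        lincomb_right[OF u v u, of "1/2" "1/2"] lincomb_right[OF u v v, of "1/2" "1/2"] sym[OF u v]
        diff_left[OF u v diff_mem[OF u v]] diff_right[OF u v u] diff_right[OF u v v]
  by (simp add: add_divide_distrib)

lemma tendsto_left_0:
  assumes "\<And>s. s \<in> I \<Longrightarrow> r s \<in> S" "w \<in> S" "((\<lambda>s. nrm (r s)) \<longlongrightarrow> 0) (at t within I)"
  shows "((\<lambda>s. B (r s) w) \<longlongrightarrow> 0) (at t within I)"
proof (rule tendsto_0_le[of "\<lambda>s. nrm (r s)" _ _ "nrm w"])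
  show "\<forall>\<^sub>F s in at t within I. norm (B (r s) w) \<le> norm (nrm (r s)) * nrm w"
    using Cauchy_Schwarz[of _ w] assms(1,2) nrm_nonneg
    by (auto simp: eventually_at_filter intro!: always_eventually)
qed fact

text \<open>With the difference quotients written as \<open>F + r s\<close> and
  \<open>H + q s\<close>, the increment is an exact polynomial in \<open>s - t\<close>, and
  Cauchy-Schwarz makes every term containing \<open>r\<close> or \<open>q\<close> vanish in the
  limit. Differentiability is measured in the seminorm of \<open>B\<close> itself, so the lemma
  serves the L2 form and the energy form alike.\<close>

lemma has_derivative_form:
  assumes u: "\<And>s. s \<in> I \<Longrightarrow> u s \<in> S" and w: "\<And>s. s \<in> I \<Longrightarrow> w s \<in> S"
    and F: "F \<in> S" and H: "H \<in> S" and t: "t \<in> I"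
    and du: "((\<lambda>s. nrm (\<lambda>x. (u s x - u t x) / (s - t) - F x)) \<longlongrightarrow> 0) (at t within I)"
    and dw: "((\<lambda>s. nrm (\<lambda>x. (w s x - w t x) / (s - t) - H x)) \<longlongrightarrow> 0) (at t within I)"
  shows "((\<lambda>s. B (u s) (w s)) has_real_derivative B F (w t) + B (u t) H) (at t within I)"
proof -
  define r where "r s = (\<lambda>x. (u s x - u t x) / (s - t) - F x)" for s
  define q where "q s = (\<lambda>x. (w s x - w t x) / (s - t) - H x)" for s
  have r: "r s \<in> S" if "s \<in> I" for s
    using diff_mem[OF scale_mem[OF diff_mem[OF u[OF that] u[OF t]], of "1 / (s - t)"] F] by (simp add: r_def)
  have q: "q s \<in> S" if "s \<in> I" for s
    using diff_mem[OF scale_mem[OF diff_mem[OF w[OF that] w[OF t]], of "1 / (s - t)"] H] by (simp add: q_def)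
  have du': "((\<lambda>s. nrm (r s)) \<longlongrightarrow> 0) (at t within I)" using du by (simp add: r_def)
  have dw': "((\<lambda>s. nrm (q s)) \<longlongrightarrow> 0) (at t within I)" using dw by (simp add: q_def)
  \<comment> \<open>Both arguments vary with \<open>s\<close> here, so the bound is a product of two
    vanishing seminorms.\<close>
  have qr: "((\<lambda>s. B (r s) (q s)) \<longlongrightarrow> 0) (at t within I)"
  proof (rule Lim_null_comparison)
    show "\<forall>\<^sub>F s in at t within I. norm (B (r s) (q s)) \<le> nrm (r s) * nrm (q s)"
      using Cauchy_Schwarz[OF r q] by (auto simp: eventually_at_filter intro!: always_eventually)
    show "((\<lambda>s. nrm (r s) * nrm (q s)) \<longlongrightarrow> 0) (at t within I)"
      using tendsto_mult[OF du' dw'] by simp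
  qed
  have uw: "B (u s) (w s) - B (u t) (w t) = (s - t) * (B F (w t) + B (r s) (w t) + B H (u t) + B (q s) (u t)
       + (s - t) * (B F H + B (r s) H + B (q s) F + B (r s) (q s)))" if s: "s \<in> I" "s \<noteq> t" for s
  proof -
    define h where "h = s - t"
    define f where "f = (\<lambda>x. 1 * F x + 1 * r s x)"
    define g where "g = (\<lambda>x. 1 * H x + 1 * q s x)"
    have us: "u s = (\<lambda>x. 1 * u t x + h * f x)"
      using s(2) by (intro ext) (simp add: r_def h_def f_def)
    have ws: "w s = (\<lambda>x. 1 * w t x + h * g x)"
      using s(2) by (intro ext) (simp add: q_def h_def g_def)
    have fS: "f \<in> S" unfolding f_def by (intro lincomb_mem F r s)
    have gS: "g \<in> S" unfolding g_def by (intro lincomb_mem H q s)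
    have f_left: "B f v = B F v + B (r s) v" if "v \<in> S" for v
      unfolding f_def using lincomb_left[OF F r[OF s(1)] that, of 1 1] by simp
    have g_right: "B v g = B H v + B (q s) v" if "v \<in> S" for v
      unfolding g_def using lincomb_right[OF H q[OF s(1)] that, of 1 1] sym[OF that] H q[OF s(1)] by simp
    have "B (u s) (w s) = B (u t) (w t) + h * B f (w t) + h * (B (u t) g + h * B f g)"
      unfolding us ws
      using lincomb_left[OF u[OF t] fS lincomb_mem[OF w[OF t] gS], of 1 h 1 h]
        lincomb_right[OF w[OF t] gS u[OF t], of 1 h] lincomb_right[OF w[OF t] gS fS, of 1 h]
      by (simp add: algebra_simps)
    moreover have "B f g = B F H + B (r s) H + B (q s) F + B (r s) (q s)"
      using f_left[OF gS] g_right[OF F] g_right[OF r[OF s(1)]] sym H F q r s by simp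
    ultimately show ?thesis using f_left[OF w[OF t]] g_right[OF u[OF t]]
      by (simp add: algebra_simps h_def)
  qed
  have "((\<lambda>s. (B F (w t) + B (r s) (w t) + B H (u t) + B (q s) (u t)
       + (s - t) * (B F H + B (r s) H + B (q s) F + B (r s) (q s))))
       \<longlongrightarrow> (B F (w t) + 0 + B H (u t) + 0 + (t - t) * (B F H + 0 + 0 + 0))) (at t within I)"
    using tendsto_left_0[OF r] tendsto_left_0[OF q] du' dw' qr u[OF t] w[OF t] F H
    by (intro tendsto_intros) auto
  then have "((\<lambda>s. (B (u s) (w s) - B (u t) (w t)) / (s - t)) \<longlongrightarrow> B F (w t) + B (u t) H) (at t within I)"
    by (rule Lim_transform_within[where d=1, OF tendsto_eq_rhs])
       (use uw in \<open>auto simp: sym[OF H u[OF t]]\<close>)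
  then show ?thesis by (simp add: has_field_derivative_iff)
qed

end

section \<open>Riesz representation by minimising a quadratic functional\<close>

context semi_inner
begin

text \<open>Minimise \<open>J v = B v v - 2 f v\<close>, which is bounded below by completing the
  square. The parallelogram law makes a minimising sequence Cauchy, and its limit represents
  \<open>f\<close>. Completeness is a sequential hypothesis in the seminorm, and the representative
  is not claimed to be unique.\<close>

lemma Riesz_representation:
  assumes complete: "\<And>u. (\<And>n. u n \<in> S) \<Longrightarrow>
      (\<And>e. e > 0 \<Longrightarrow> \<exists>N::nat. \<forall>m\<ge>N. \<forall>n\<ge>N. nrm (\<lambda>x. u m x - u n x) < e) \<Longrightarrow>
      \<exists>v\<in>S. (\<lambda>n. nrm (\<lambda>x. u n x - v x)) \<longlonglongrightarrow> 0"
    and lin: "\<And>u v c d. u \<in> S \<Longrightarrow> v \<in> S \<Longrightarrow> f (\<lambda>x. c * u x + d * v x) = c * f u + d * f v"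
    and bound: "\<And>u. u \<in> S \<Longrightarrow> \<bar>f u\<bar> \<le> C * nrm u"
  obtains g where "g \<in> S" "\<And>v. v \<in> S \<Longrightarrow> B g v = f v"
proof -
  define J where "J v = B v v - 2 * f v" for v
  have J_lower: "- (C\<^sup>2) \<le> J v" if v: "v \<in> S" for v
  proof -
    have "J v \<ge> (nrm v)\<^sup>2 - 2 * (C * nrm v)"
      using bound[OF v] by (simp add: J_def nrm_sq[OF v])
    moreover have "(nrm v)\<^sup>2 - 2 * (C * nrm v) + C\<^sup>2 = (nrm v - C)\<^sup>2" by (simp add: power2_diff)
    ultimately show ?thesis using zero_le_power2[of "nrm v - C"] by linarith
  qed
  define m where "m = Inf (J ` S)"
  have bdd: "bdd_below (J ` S)" using J_lower by (auto simp: bdd_below_def)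
  have m_le: "m \<le> J v" if "v \<in> S" for v unfolding m_def using that bdd by (simp add: cInf_lower)
  have ex: "\<exists>v\<in>S. J v < m + e" if "e > 0" for e
    using cInf_lessD[of "J ` S" "m + e"] zero_mem that by (auto simp: m_def)
  define e where "e n = inverse (real (Suc n))" for n
  have e_pos: "e n > 0" for n by (simp add: e_def)
  obtain u where u: "\<And>n. u n \<in> S" and Ju: "\<And>n. J (u n) < m + e n"
    using ex[OF e_pos] by metis
  have e_lim: "e \<longlonglongrightarrow> 0" unfolding e_def by (rule LIMSEQ_inverse_real_of_nat)
  have cauchy: "B (\<lambda>x. u j x - u k x) (\<lambda>x. u j x - u k x) \<le> 2 * e j + 2 * e k" for j k
  proof -
    define w where "w = (\<lambda>x. 1/2 * u j x + 1/2 * u k x)"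
    have w: "w \<in> S" unfolding w_def by (rule lincomb_mem[OF u u])
    have "f w = 1/2 * f (u j) + 1/2 * f (u k)" unfolding w_def by (rule lin[OF u u])
    then have "B (\<lambda>x. u j x - u k x) (\<lambda>x. u j x - u k x) = 2 * J (u j) + 2 * J (u k) - 4 * J w"
      using parallelogram[OF u[of j] u[of k], folded w_def] by (simp add: J_def)
    then show ?thesis using Ju[of j] Ju[of k] m_le[OF w] by linarith
  qed
  have "\<exists>N. \<forall>j\<ge>N. \<forall>k\<ge>N. nrm (\<lambda>x. u j x - u k x) < d" if d: "d > 0" for d
  proof -
    have "d\<^sup>2 / 4 > 0" using d by simp
    then obtain N where N: "\<And>n. n \<ge> N \<Longrightarrow> e n < d\<^sup>2 / 4"
      using order_tendstoD(2)[OF e_lim, of "d\<^sup>2 / 4"] unfolding eventually_sequentially by blast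
    have "nrm (\<lambda>x. u j x - u k x) < d" if "j \<ge> N" "k \<ge> N" for j k
    proof -
      have "B (\<lambda>x. u j x - u k x) (\<lambda>x. u j x - u k x) < d\<^sup>2"
        using cauchy[of j k] N[OF that(1)] N[OF that(2)] by linarith
      then show ?thesis unfolding nrm_def using d by (intro real_less_lsqrt) auto
    qed
    then show ?thesis by blast
  qed
  from complete[OF u this] obtain g where g: "g \<in> S" and lim: "(\<lambda>n. nrm (\<lambda>x. u n x - g x)) \<longlonglongrightarrow> 0"
    by blast
  have "B g v = f v" if v: "v \<in> S" for v
  proof -
    have Bu: "(\<lambda>n. B (u n) v) \<longlonglongrightarrow> B g v"
    proof (rule LIM_zero_cancel, rule Lim_null_comparison)
      show "\<forall>\<^sub>F n in sequentially. norm (B (u n) v - B g v) \<le> nrm (\<lambda>x. u n x - g x) * nrm v"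
        using Cauchy_Schwarz[OF diff_mem[OF u g] v] by (simp add: diff_left u g v)
      show "(\<lambda>n. nrm (\<lambda>x. u n x - g x) * nrm v) \<longlonglongrightarrow> 0"
        using tendsto_mult_right[OF lim, of "nrm v"] by simp
    qed
    \<comment> \<open>The Euler-Lagrange inequality is derived along the sequence, from
      \<open>m \<le> J (u n + c v)\<close> and \<open>J (u n) < m + e n\<close>, and only then
      passed to the limit; continuity of \<open>J\<close> does not enter.\<close>
    have quad: "0 \<le> 2 * c * (B g v - f v) + c\<^sup>2 * B v v" for c
    proof (rule tendsto_lowerbound)
      show "(\<lambda>n. 2 * c * (B (u n) v - f v) + c\<^sup>2 * B v v + e n) \<longlonglongrightarrow> 2 * c * (B g v - f v) + c\<^sup>2 * B v v"
      proof -
        have "(\<lambda>n. 2 * c * (B (u n) v - f v) + c\<^sup>2 * B v v + e n) \<longlonglongrightarrow> 2 * c * (B g v - f v) + c\<^sup>2 * B v v + 0"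
          by (intro tendsto_intros Bu e_lim)
        then show ?thesis by simp
      qed
      show "\<forall>\<^sub>F n in sequentially. 0 \<le> 2 * c * (B (u n) v - f v) + c\<^sup>2 * B v v + e n"
      proof (rule always_eventually, rule allI)
        fix n
        define w where "w = (\<lambda>x. 1 * u n x + c * v x)"
        have w: "w \<in> S" unfolding w_def by (rule lincomb_mem[OF u v])
        have "f w = f (u n) + c * f v" unfolding w_def using lin[OF u[of n] v, of 1 c] by simp
        moreover have "B w w = B (u n) (u n) + 2 * c * B (u n) v + c\<^sup>2 * B v v"
        proof -
          have "B w w = B (u n) w + c * B v w"
            using lincomb_left[OF u[of n] v w, of 1 c, folded w_def] by simp
          moreover have "B (u n) w = B (u n) (u n) + c * B (u n) v"
            using lincomb_right[OF u[of n] v u[of n], of 1 c] by (simp add: w_def)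
          moreover have "B v w = B v (u n) + c * B v v"
            using lincomb_right[OF u[of n] v v, of 1 c] by (simp add: w_def)
          ultimately show ?thesis using sym[OF u v, of n] by (simp add: algebra_simps power2_eq_square)
        qed
        ultimately have "J w = J (u n) + 2 * c * (B (u n) v - f v) + c\<^sup>2 * B v v"
          by (simp add: J_def algebra_simps)
        then show "0 \<le> 2 * c * (B (u n) v - f v) + c\<^sup>2 * B v v + e n"
          using m_le[OF w] Ju[of n] by linarith
      qed
    qed simp
    define t where "t = B g v - f v"
    define \<beta> where "\<beta> = B v v"
    have \<beta>: "\<beta> \<ge> 0" using nonneg[OF v] by (simp add: \<beta>_def)
    \<comment> \<open>The value \<open>c = - t / (\<beta> + 1)\<close> makes the quadratic negative
      unless \<open>t = 0\<close>. The added 1 covers null vectors \<open>v\<close>, for which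
      \<open>\<beta> = 0\<close>.\<close>
    have "0 \<le> (2 * (- t / (\<beta> + 1)) * t + (- t / (\<beta> + 1))\<^sup>2 * \<beta>) * (\<beta> + 1)\<^sup>2"
      using quad[of "- t / (\<beta> + 1)"] unfolding t_def[symmetric] \<beta>_def[symmetric] by (intro mult_nonneg_nonneg) auto
    also have "\<dots> = - (t\<^sup>2 * (\<beta> + 2))"
    proof -
      have "2 * (- t / (\<beta> + 1)) * t * (\<beta> + 1)\<^sup>2 = - 2 * t\<^sup>2 * (\<beta> + 1)"
        using \<beta> by (simp add: field_simps power2_eq_square)
      moreover have "(- t / (\<beta> + 1))\<^sup>2 * \<beta> * (\<beta> + 1)\<^sup>2 = t\<^sup>2 * \<beta>"
        using \<beta> by (simp add: power_divide)
      ultimately show ?thesis by (simp only: distrib_right) (simp add: algebra_simps)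
    qed
    finally have "t\<^sup>2 * (\<beta> + 2) \<le> 0" by simp
    then have "t = 0" using \<beta> by (simp add: mult_le_0_iff)
    then show ?thesis by (simp add: t_def)
  qed
  then show thesis using that g by blast
qed

end

lemma semi_inner_subset:
  assumes "semi_inner S B" "S' \<subseteq> S" "(\<lambda>x. 0) \<in> S'"
    "\<And>u v c d. u \<in> S' \<Longrightarrow> v \<in> S' \<Longrightarrow> (\<lambda>x. c * u x + d * v x) \<in> S'"
  shows "semi_inner S' B"
proof -
  interpret semi_inner S B by fact
  show ?thesis using assms(2-4) by unfold_locales (auto simp: lincomb_left sym nonneg subset_iff)
qed

section \<open>Positive semidefinite matrices and the abstract flow\<close>

text \<open>Cauchy-Schwarz for the form of \<open>K\<close>: a vector of zero seminorm pairs to zero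
  with each unit vector, and these pairings are the entries of \<open>K x\<close>.\<close>

lemma psd_form_zero_imp_kernel:
  fixes K :: "'n::finite \<Rightarrow> 'n \<Rightarrow> real"
  assumes sym: "\<And>i j. K i j = K j i" and psd: "\<And>x. 0 \<le> (\<Sum>i\<in>UNIV. \<Sum>j\<in>UNIV. x i * K i j * x j)"
    and 0: "(\<Sum>i\<in>UNIV. \<Sum>j\<in>UNIV. x i * K i j * x j) = 0"
  shows "(\<Sum>j\<in>UNIV. K i j * x j) = 0"
proof -
  define B where "B y z = (\<Sum>i\<in>UNIV. \<Sum>j\<in>UNIV. y i * K i j * z j)" for y z
  interpret semi_inner UNIV B
  proof
    show "B (\<lambda>x. c * u x + d * v x) w = c * B u w + d * B v w" for u v w c d
      by (simp add: B_def algebra_simps sum.distrib sum_distrib_left)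
    show "B u v = B v u" for u v
      unfolding B_def by (subst sum.swap) (simp add: sym algebra_simps)
    show "0 \<le> B u u" for u using psd by (simp add: B_def)
  qed auto
  define e where "e k = (if k = i then 1 else 0::real)" for k
  have "B e x = (\<Sum>j\<in>UNIV. K i j * x j)"
    by (simp add: B_def e_def if_distrib[of "\<lambda>c. c * _"] sum.delta cong: if_cong
        flip: sum_distrib_left) (subst sum.swap, simp add: sum.delta)
  moreover have "\<bar>B e x\<bar> \<le> nrm e * nrm x" by (rule Cauchy_Schwarz) auto
  moreover have "nrm x = 0" using 0 by (simp add: nrm_def B_def)
  ultimately show ?thesis by simp
qed

text \<open>Elimination of one index at a time. The index type stays fixed and \<open>I\<close>
  records the rows that may be nonzero. A zero pivot forces the whole column to vanish; a positive
  pivot splits off a rank-one matrix and leaves the Schur complement. The vectors \<open>v m\<close>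
  take the place of a matrix square root.\<close>

lemma psd_Cholesky_on:
  fixes K :: "'n::finite \<Rightarrow> 'n \<Rightarrow> real"
  assumes "finite I" and "\<And>i j. K i j = K j i" and "\<And>x. 0 \<le> (\<Sum>i\<in>UNIV. \<Sum>j\<in>UNIV. x i * K i j * x j)"
    and "\<And>i j. i \<notin> I \<Longrightarrow> K i j = 0"
  shows "\<exists>v. \<forall>i j. K i j = (\<Sum>m\<in>I. v m i * v m j)"
  using assms
proof (induction I arbitrary: K rule: finite_induct)
  case empty
  then show ?case by auto
next
  case (insert k I)
  note Ksym = insert.prems(1) and psd = insert.prems(2) and supp = insert.prems(3)
  define e where "e i = (if i = k then 1 else 0::real)" for i
  have col: "(\<Sum>j\<in>UNIV. K i j * e j) = K i k" for i
    by (simp add: e_def if_distrib[of "\<lambda>c. _ * c"] sum.delta cong: if_cong)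
  have e_form: "(\<Sum>i\<in>UNIV. \<Sum>j\<in>UNIV. e i * K i j * e j) = K k k"
    by (simp add: mult.assoc col flip: sum_distrib_left)
       (simp add: e_def if_distrib[of "\<lambda>c. c * _"] sum.delta cong: if_cong)
  show ?case
  proof (cases "K k k = 0")
    case True
    have "K i k = 0" for i
      using psd_form_zero_imp_kernel[of K e i, OF Ksym psd] e_form col True by simp
    then have "K i j = 0" if "i \<notin> I" for i j
      using that supp[of i j] Ksym by (cases "i = k") auto
    then obtain v where "\<forall>i j. K i j = (\<Sum>m\<in>I. v m i * v m j)"
      using insert.IH[of K] Ksym psd by blast
    then show ?thesis using insert.hyps by (intro exI[of _ "v(k := \<lambda>_. 0)"]) (auto intro!: sum.cong)
  next
    case False
    then have pos: "K k k > 0" using psd[of e] e_form by simp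
    define K' where "K' i j = K i j - K i k * K j k / K k k" for i j
    have sym': "K' i j = K' j i" for i j by (simp add: K'_def Ksym[of i j])
    have supp': "K' i j = 0" if "i \<notin> I" for i j
      using that supp[of i] Ksym[of k j] pos by (cases "i = k") (auto simp: K'_def)
    have psd': "0 \<le> (\<Sum>i\<in>UNIV. \<Sum>j\<in>UNIV. x i * K' i j * x j)" for x
    proof -
      define s where "s = (\<Sum>i\<in>UNIV. K i k * x i)"
      \<comment> \<open>Moving \<open>x\<close> along \<open>e\<close> to the minimiser of the form
        of \<open>K\<close> makes \<open>K y\<close> vanish at index \<open>k\<close>; the value at
        \<open>y\<close> is then the Schur complement form at \<open>x\<close>, hence
        nonnegative.\<close>
      define y where "y i = x i - s / K k k * e i" for i
      have 1: "(\<Sum>j\<in>UNIV. K i j * y j) = (\<Sum>j\<in>UNIV. K i j * x j) - s / K k k * K i k" for i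
      proof -
        have "K i j * y j = K i j * x j - s / K k k * (K i j * e j)" for j
          by (simp only: y_def right_diff_distrib mult.left_commute)
        then show ?thesis by (simp only: sum_subtractf col flip: sum_distrib_left)
      qed
      have "(\<Sum>i\<in>UNIV. \<Sum>j\<in>UNIV. y i * K i j * y j) =
         (\<Sum>i\<in>UNIV. y i * ((\<Sum>j\<in>UNIV. K i j * x j) - s / K k k * K i k))"
        by (simp add: mult.assoc 1 flip: sum_distrib_left)
      also have "\<dots> = (\<Sum>i\<in>UNIV. x i * ((\<Sum>j\<in>UNIV. K i j * x j) - s / K k k * K i k))
          - s / K k k * (\<Sum>i\<in>UNIV. e i * ((\<Sum>j\<in>UNIV. K i j * x j) - s / K k k * K i k))"
        unfolding y_def by (simp add: left_diff_distrib sum_subtractf sum_distrib_left mult.assoc)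
      also have "(\<Sum>i\<in>UNIV. e i * ((\<Sum>j\<in>UNIV. K i j * x j) - s / K k k * K i k)) = 0"
      proof -
        have "s = (\<Sum>j\<in>UNIV. K k j * x j)" unfolding s_def using Ksym by (intro sum.cong) auto
        then show ?thesis
          using pos by (simp add: e_def if_distrib[of "\<lambda>c. c * _"] sum.delta cong: if_cong)
      qed
      also have "(\<Sum>i\<in>UNIV. x i * ((\<Sum>j\<in>UNIV. K i j * x j) - s / K k k * K i k)) =
          (\<Sum>i\<in>UNIV. \<Sum>j\<in>UNIV. x i * K' i j * x j)"
      proof (rule sum.cong[OF refl])
        fix i
        have "x i * K' i j * x j = x i * (K i j * x j - K i k / K k k * (K j k * x j))" for j
          by (simp add: K'_def algebra_simps)
        then have "(\<Sum>j\<in>UNIV. x i * K' i j * x j) = x i * ((\<Sum>j\<in>UNIV. K i j * x j) - K i k / K k k * s)"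
          by (simp only: sum_subtractf s_def flip: sum_distrib_left)
        then show "x i * ((\<Sum>j\<in>UNIV. K i j * x j) - s / K k k * K i k) = (\<Sum>j\<in>UNIV. x i * K' i j * x j)"
          by (simp add: mult.commute)
      qed
      finally show ?thesis using psd[of y] by simp
    qed
    obtain v where v: "\<forall>i j. K' i j = (\<Sum>m\<in>I. v m i * v m j)"
      using insert.IH[of K'] sym' psd' supp' by blast
    define v' where "v' = v(k := \<lambda>i. K i k / sqrt (K k k))"
    have "K i j = (\<Sum>m\<in>insert k I. v' m i * v' m j)" for i j
    proof -
      have "(\<Sum>m\<in>I. v' m i * v' m j) = (\<Sum>m\<in>I. v m i * v m j)"
        using insert.hyps by (intro sum.cong) (auto simp: v'_def)
      then show ?thesis using insert.hyps v[rule_format, of i j] pos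
        by (simp add: v'_def K'_def)
    qed
    then show ?thesis by blast
  qed
qed

lemma psd_Cholesky:
  fixes K :: "'n::finite \<Rightarrow> 'n \<Rightarrow> real"
  assumes "\<And>i j. K i j = K j i" and "\<And>x. 0 \<le> (\<Sum>i\<in>UNIV. \<Sum>j\<in>UNIV. x i * K i j * x j)"
  obtains v where "\<And>i j. K i j = (\<Sum>m\<in>(UNIV::'n set). v m i * v m j)"
  using psd_Cholesky_on[of UNIV K] assms by auto

section \<open>Propagation of positivity under a matrix flow\<close>

text \<open>First-time argument. Compactness of time interval times sphere yields an earliest point
  with \<open>q \<le> 0\<close>. Continuity gives \<open>0 \<le> q\<close> on the whole sphere at
  that time, so the point is a zero and a minimum, which is the situation in which
  \<open>deriv\<close> supplies a positive slope; but then \<open>q\<close> was negative slightly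
  earlier.\<close>

lemma sphere_positivity_propagates:
  fixes q :: "real \<Rightarrow> real^'n::finite \<Rightarrow> real"
  assumes t0: "0 \<le> t0"
    and cont: "continuous_on ({0..t0} \<times> sphere 0 1) (\<lambda>p. q (fst p) (snd p))"
    and init: "\<And>x. norm x = 1 \<Longrightarrow> 0 < q 0 x"
    and deriv: "\<And>t x. 0 < t \<Longrightarrow> t \<le> t0 \<Longrightarrow> norm x = 1 \<Longrightarrow> q t x = 0 \<Longrightarrow>
        (\<And>y. norm y = 1 \<Longrightarrow> 0 \<le> q t y) \<Longrightarrow>
        \<exists>D>0. ((\<lambda>s. q s x) has_real_derivative D) (at t within {0..t0})"
    and x: "norm x = 1"
  shows "0 < q t0 x"
proof (rule ccontr)
  assume "\<not> 0 < q t0 x"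
  define Z where "Z = {p \<in> {0..t0} \<times> sphere 0 1. q (fst p) (snd p) \<in> {..0}}"
  have comp: "compact ({0..t0} \<times> sphere (0::real^'n) 1)" by (intro compact_Times) auto
  have "closedin (top_of_set ({0..t0} \<times> sphere 0 1)) Z"
  proof -
    have "Z = ({0..t0} \<times> sphere 0 1) \<inter> (\<lambda>p. q (fst p) (snd p)) -` {..0}" by (auto simp: Z_def)
    then show ?thesis using continuous_closedin_preimage[OF cont, of "{..0}"] by simp
  qed
  then have "compact Z" using comp closedin_compact by blast
  moreover have "(t0, x) \<in> Z" using \<open>\<not> 0 < q t0 x\<close> t0 x by (simp add: Z_def)
  ultimately obtain z where z: "z \<in> Z" "\<And>p. p \<in> Z \<Longrightarrow> fst z \<le> fst p"
    using continuous_attains_inf[of Z fst] by (force intro: continuous_intros)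
  obtain t y where ty: "z = (t, y)" by force
  have t: "0 \<le> t" "t \<le> t0" and y: "norm y = 1" and qy: "q t y \<le> 0"
    using z(1) by (auto simp: Z_def ty)
  have "t \<noteq> 0" using init[OF y] qy by auto
  then have t_pos: "0 < t" using t by simp
  have before: "0 < q s w" if "0 \<le> s" "s < t" "norm w = 1" for s w
    using z(2)[of "(s, w)"] that t by (force simp: Z_def ty)
  \<comment> \<open>Left limit of the positive values before \<open>t\<close>; this is the premise
    that lets \<open>deriv\<close> treat a zero as a minimum over the sphere.\<close>
  have at: "0 \<le> q t w" if w: "norm w = 1" for w
  proof -
    have "continuous_on {0..t0} (\<lambda>s. q s w)"
      using continuous_on_compose2[OF cont, of "{0..t0}" "\<lambda>s. (s, w)"] w
      by (force intro: continuous_intros)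
    then have "continuous_on {0..t} (\<lambda>s. q s w)" using t by (auto intro: continuous_on_subset)
    then have "((\<lambda>s. q s w) \<longlongrightarrow> q t w) (at t within {0..<t})"
      using t by (intro tendsto_within_subset[of _ _ t "{0..t}" "{0..<t}"]) (auto simp: continuous_on_def)
    moreover have "at t within {0..<t} \<noteq> bot"
      using t_pos by (simp add: at_within_eq_bot_iff)
    moreover have "\<forall>\<^sub>F s in at t within {0..<t}. 0 \<le> q s w"
      using before[OF _ _ w] by (auto simp: eventually_at_filter intro!: always_eventually less_imp_le)
    ultimately show ?thesis by (intro tendsto_lowerbound)
  qed
  then have q0: "q t y = 0" using qy y by force
  obtain D where D: "D > 0" "((\<lambda>s. q s y) has_real_derivative D) (at t within {0..t0})"
    using deriv[OF t_pos t(2) y q0 at] by blast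
  obtain d where d: "d > 0" "\<And>h. h > 0 \<Longrightarrow> t - h \<in> {0..t0} \<Longrightarrow> h < d \<Longrightarrow> q (t - h) y < q t y"
    using has_real_derivative_pos_inc_left[OF D(2,1)] by blast
  \<comment> \<open>Half of the minimum keeps \<open>t - h\<close> positive and inside the range
    \<open>d\<close> on which the slope decides the sign.\<close>
  define h where "h = min t d / 2"
  have "q (t - h) y < q t y" using d(1) t_pos t by (intro d(2)) (auto simp: h_def min_def)
  moreover have "0 < q (t - h) y" using d(1) t_pos y by (intro before) (auto simp: h_def min_def)
  ultimately show False using q0 by simp
qed

text \<open>
  At a first time where \<open>Q = P + \<epsilon> (1 + t) I\<close> has a kernel vector \<open>y\<close>, the terms \<open>K Q + Q K\<close>
  do not contribute to \<open>y \<bullet> Q' y\<close>, which is therefore at least \<open>\<epsilon> \<bar>y\<bar>\<^sup>2 > 0\<close>.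
\<close>
lemma psd_preserved:
  fixes P K :: "real \<Rightarrow> 'n::finite \<Rightarrow> 'n \<Rightarrow> real"
  assumes t0: "0 \<le> t0"
    and Psym: "\<And>t i j. P t i j = P t j i"
    and Ksym: "\<And>t i j. t \<in> {0..t0} \<Longrightarrow> K t i j = K t j i"
    and Kpsd: "\<And>t x. t \<in> {0..t0} \<Longrightarrow> 0 \<le> (\<Sum>i\<in>UNIV. \<Sum>j\<in>UNIV. x i * K t i j * x j)"
    and dP: "\<And>t i j. t \<in> {0..t0} \<Longrightarrow> ((\<lambda>s. P s i j) has_real_derivative
        - (\<Sum>k\<in>UNIV. K t i k * P t k j + P t i k * K t k j)) (at t within {0..t0})"
    and init: "\<And>x. 0 \<le> (\<Sum>i\<in>UNIV. \<Sum>j\<in>UNIV. x i * P 0 i j * x j)"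
  shows "0 \<le> (\<Sum>i\<in>UNIV. \<Sum>j\<in>UNIV. x i * P t0 i j * x j)"
proof -
  define f where "f A x = (\<Sum>i\<in>UNIV. \<Sum>j\<in>UNIV. x i * A i j * x j)" for A :: "'n \<Rightarrow> 'n \<Rightarrow> real" and x
  have Pcont: "continuous_on {0..t0} (\<lambda>s. P s i j)" for i j
    by (rule DERIV_continuous_on) (rule dP)
  have main: "0 < f (P t0) (($) x) + e * (1 + t0) * (norm x)\<^sup>2" if e: "e > 0" and x: "norm x = 1" for e and x :: "real^'n"
  proof (rule sphere_positivity_propagates[where q="\<lambda>t x. f (P t) (($) x) + e * (1 + t) * (norm x)\<^sup>2", OF t0 _ _ _ x])
    show "continuous_on ({0..t0} \<times> sphere 0 1) (\<lambda>p. f (P (fst p)) (($) (snd p)) + e * (1 + fst p) * (norm (snd p))\<^sup>2)"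
      unfolding f_def
      by (intro continuous_intros continuous_on_compose2[OF Pcont continuous_on_fst[OF continuous_on_id]]) auto
    show "0 < f (P 0) (($) y) + e * (1 + 0) * (norm y)\<^sup>2" if "norm y = 1" for y :: "real^'n"
      using init[of "($) y"] that e by (simp add: f_def)
  next
    fix t and y :: "real^'n"
    assume t: "0 < t" "t \<le> t0" and y: "norm y = 1"
      and q0: "f (P t) (($) y) + e * (1 + t) * (norm y)\<^sup>2 = 0"
      and qn: "\<And>y :: real^'n. norm y = 1 \<Longrightarrow> 0 \<le> f (P t) (($) y) + e * (1 + t) * (norm y)\<^sup>2"
    have tI: "t \<in> {0..t0}" using t by simp
    define Q where "Q i j = P t i j + (if i = j then e * (1 + t) else 0)" for i j
    have Qsym: "Q i j = Q j i" for i j by (simp add: Q_def Psym[of t i j])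
    have nsq: "(norm z)\<^sup>2 = (\<Sum>i\<in>UNIV. (z $ i)\<^sup>2)" for z :: "real^'n"
      unfolding power2_norm_eq_inner by (simp add: inner_vec_def power2_eq_square)
    have fQ: "f Q z = f (P t) z + e * (1 + t) * (\<Sum>i\<in>UNIV. (z i)\<^sup>2)" for z
      by (simp add: f_def Q_def ring_distribs sum.distrib if_distrib[of "\<lambda>c. _ * c"] if_distrib[of "\<lambda>c. c * _"]
        sum.delta power2_eq_square sum_distrib_left mult_ac cong: if_cong)
    \<comment> \<open>The barrier argument speaks of unit vectors only; homogeneity of degree two
      extends it to all vectors, so that kernel vectors can be recognised.\<close>
    have Qpsd: "0 \<le> f Q z" for z
    proof -
      define w :: "real^'n" where "w = (\<chi> i. z i)"
      show ?thesis
      proof (cases "w = 0")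
        case True
        then have "z = (\<lambda>i. 0)" by (auto simp: w_def vec_eq_iff)
        then show ?thesis by (simp add: f_def)
      next
        case False
        have "f Q (($) (w /\<^sub>R norm w)) = (inverse (norm w))\<^sup>2 * f Q (($) w)"
          by (simp add: f_def sum_distrib_left power2_eq_square mult_ac)
        moreover have "0 \<le> f Q (($) (w /\<^sub>R norm w))"
          using qn[of "w /\<^sub>R norm w"] False unfolding fQ nsq[symmetric] by simp
        moreover have "($) w = z" by (auto simp: w_def)
        ultimately show ?thesis using False by (simp add: zero_le_mult_iff)
      qed
    qed
    have "f Q (($) y) = 0" using q0 by (simp add: fQ nsq)
    then have Qy: "(\<Sum>j\<in>UNIV. Q i j * y $ j) = 0" for i
      using psd_form_zero_imp_kernel[of Q "($) y" i, OF Qsym] Qpsd by (simp add: f_def)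
    have Py: "(\<Sum>j\<in>UNIV. P t i j * y $ j) = - (e * (1 + t)) * y $ i" for i
      using Qy[of i] by (simp add: Q_def ring_distribs sum.distrib if_distrib[of "\<lambda>c. c * _"] sum.delta cong: if_cong)
    define D where "D = (\<Sum>i\<in>UNIV. \<Sum>j\<in>UNIV. y $ i * (- (\<Sum>k\<in>UNIV. K t i k * P t k j + P t i k * K t k j)) * y $ j)
        + e * (norm y)\<^sup>2"
    have "((\<lambda>s. f (P s) (($) y) + e * (1 + s) * (norm y)\<^sup>2) has_real_derivative D) (at t within {0..t0})"
      unfolding D_def f_def
    proof (rule DERIV_add)
      show "((\<lambda>s. e * (1 + s) * (norm y)\<^sup>2) has_real_derivative e * (norm y)\<^sup>2) (at t within {0..t0})"
        by (auto intro!: derivative_eq_intros)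
    qed (intro DERIV_sum DERIV_cmult DERIV_cmult_right dP tI)
    \<comment> \<open>On the kernel vector, \<open>P y = - e (1 + t) y\<close>, so each of
      \<open>- K P\<close> and \<open>- P K\<close> contributes \<open>e (1 + t)\<close> times the
      form of \<open>K\<close> at \<open>y\<close>.\<close>
    moreover have D: "D = 2 * e * (1 + t) * f (K t) (($) y) + e * (norm y)\<^sup>2"
    proof -
      have KP: "(\<Sum>i\<in>UNIV. \<Sum>j\<in>UNIV. y $ i * (\<Sum>k\<in>UNIV. K t i k * P t k j) * y $ j) = - (e * (1 + t)) * f (K t) (($) y)"
      proof -
        have "(\<Sum>j\<in>UNIV. y $ i * (\<Sum>k\<in>UNIV. K t i k * P t k j) * y $ j)
            = (\<Sum>k\<in>UNIV. y $ i * K t i k * (\<Sum>j\<in>UNIV. P t k j * y $ j))" for i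
          unfolding sum_distrib_left sum_distrib_right by (subst sum.swap) (simp add: mult_ac)
        then have "(\<Sum>i\<in>UNIV. \<Sum>j\<in>UNIV. y $ i * (\<Sum>k\<in>UNIV. K t i k * P t k j) * y $ j)
            = (\<Sum>i\<in>UNIV. \<Sum>k\<in>UNIV. y $ i * K t i k * (- (e * (1 + t)) * y $ k))"
          by (simp only: Py)
        also have "\<dots> = - (e * (1 + t)) * f (K t) (($) y)"
          unfolding f_def sum_distrib_left by (intro sum.cong) auto
        finally show ?thesis .
      qed
      have "(\<Sum>i\<in>UNIV. \<Sum>j\<in>UNIV. y $ i * (\<Sum>k\<in>UNIV. P t i k * K t k j) * y $ j)
          = (\<Sum>j\<in>UNIV. \<Sum>i\<in>UNIV. y $ j * (\<Sum>k\<in>UNIV. K t j k * P t k i) * y $ i)"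
      proof -
        have "(\<Sum>k\<in>UNIV. P t i k * K t k j) = (\<Sum>k\<in>UNIV. K t j k * P t k i)" for i j
          using Psym[of t i] Ksym[OF tI, of _ j] by (intro sum.cong) auto
        then show ?thesis by (subst sum.swap) (simp only: mult.commute mult.left_commute)
      qed
      then have PK: "(\<Sum>i\<in>UNIV. \<Sum>j\<in>UNIV. y $ i * (\<Sum>k\<in>UNIV. P t i k * K t k j) * y $ j) = - (e * (1 + t)) * f (K t) (($) y)"
        using KP by simp
      have "D = - (\<Sum>i\<in>UNIV. \<Sum>j\<in>UNIV. y $ i * (\<Sum>k\<in>UNIV. K t i k * P t k j) * y $ j)
         - (\<Sum>i\<in>UNIV. \<Sum>j\<in>UNIV. y $ i * (\<Sum>k\<in>UNIV. P t i k * K t k j) * y $ j) + e * (norm y)\<^sup>2"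
        unfolding D_def by (simp add: sum.distrib ring_distribs sum_negf sum_subtractf)
      then show ?thesis unfolding KP PK by simp
    qed
    moreover have "D > 0"
    proof -
      have "0 \<le> f (K t) (($) y)" using Kpsd[OF tI, of "($) y"] by (simp add: f_def)
      then have "0 \<le> 2 * e * (1 + t) * f (K t) (($) y)" using e t by simp
      then show ?thesis unfolding D using e y by simp
    qed
    ultimately show "\<exists>D>0. ((\<lambda>s. f (P s) (($) y) + e * (1 + s) * (norm y)\<^sup>2) has_real_derivative D) (at t within {0..t0})"
      by blast
  qed
  have unit: "0 \<le> f (P t0) (($) y)" if y: "norm y = 1" for y :: "real^'n"
  proof (rule field_le_epsilon)
    fix e :: real assume "e > 0"
    \<comment> \<open>With \<open>e / (1 + t0)\<close> as the perturbation parameter the margin at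
      time \<open>t0\<close> is exactly \<open>e\<close>.\<close>
    then show "0 \<le> f (P t0) (($) y) + e" using main[OF _ y, of "e / (1 + t0)"] t0 y by simp
  qed
  define w :: "real^'n" where "w = (\<chi> i. x i)"
  have w: "($) w = x" by (auto simp: w_def)
  have "0 \<le> f (P t0) x"
  proof (cases "w = 0")
    case True
    then have "x = (\<lambda>i. 0)" by (auto simp: w_def vec_eq_iff)
    then show ?thesis by (simp add: f_def)
  next
    case False
    have "f (P t0) (($) (w /\<^sub>R norm w)) = (inverse (norm w))\<^sup>2 * f (P t0) (($) w)"
      by (simp add: f_def sum_distrib_left power2_eq_square mult_ac)
    moreover have "0 \<le> f (P t0) (($) (w /\<^sub>R norm w))" using False by (intro unit) simp
    ultimately show ?thesis using False by (simp add: zero_le_mult_iff w)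
  qed
  then show ?thesis by (simp add: f_def)
qed

lemma sum_delta_mult:
  fixes f :: "'n::finite \<Rightarrow> real"
  shows "(\<Sum>j\<in>UNIV. (if i = j then 1 else 0) * f j) = f i"
    "(\<Sum>j\<in>UNIV. (if j = i then 1 else 0) * f j) = f i"
    "(\<Sum>j\<in>UNIV. f j * (if j = i then 1 else 0)) = f i"
    "(\<Sum>j\<in>UNIV. f j * (if i = j then 1 else 0)) = f i"
  by (simp_all add: if_distrib[of "\<lambda>c. c * _"] if_distrib[of "\<lambda>c. _ * c"] sum.delta sum.delta' cong: if_cong)

section \<open>Gram matrices and the sign of the energy derivative\<close>

context semi_inner
begin

lemma sum_form:
  fixes u v :: "'n::finite \<Rightarrow> _"
  assumes "\<And>i. u i \<in> S" "\<And>i. v i \<in> S"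
  shows "B (\<lambda>x. \<Sum>i\<in>UNIV. c i * u i x) (\<lambda>x. \<Sum>j\<in>UNIV. d j * v j x)
    = (\<Sum>i\<in>UNIV. \<Sum>j\<in>UNIV. c i * B (u i) (v j) * d j)"
  using assms by (simp add: sum_left sum_right sum_mem sum_distrib_left mult_ac)

lemma gram_psd:
  fixes u :: "'n::finite \<Rightarrow> _"
  assumes "\<And>i. u i \<in> S"
  shows "0 \<le> (\<Sum>i\<in>UNIV. \<Sum>j\<in>UNIV. c i * B (u i) (u j) * c j)"
  using nonneg[OF sum_mem[of UNIV u c]] assms by (simp add: sum_form)

end

text \<open>
  The sum of the squared \<open>a\<close>-norms of \<open>U v\<^sub>m - \<G>U K\<^sup>-\<^sup>1 v\<^sub>m\<close>, where \<open>K = \<Sum>\<^sub>m v\<^sub>m v\<^sub>m\<^sup>T\<close>, is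
  \<open>tr (K A) - 2 tr M + N\<close>.
\<close>
lemma trace_gram_inequality:
  fixes u :: "'n::finite \<Rightarrow> 'x \<Rightarrow> real"
  assumes l: "semi_inner S l" and a: "semi_inner S a"
    and G: "\<And>f. f \<in> S \<Longrightarrow> G f \<in> S" and Ga: "\<And>f v. f \<in> S \<Longrightarrow> v \<in> S \<Longrightarrow> a (G f) v = l f v"
    and u: "\<And>i. u i \<in> S"
    and pd: "\<And>x. (\<Sum>i\<in>UNIV. (x i)\<^sup>2) \<le> (\<Sum>i\<in>UNIV. \<Sum>j\<in>UNIV. x i * l (u i) (u j) * x j)"
  shows "(\<Sum>i\<in>UNIV. l (u i) (u i)) \<le> (\<Sum>i\<in>UNIV. \<Sum>j\<in>UNIV. l (G (u i)) (u j) * a (u i) (u j))"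
proof -
  interpret l: semi_inner S l by fact
  interpret a: semi_inner S a by fact
  define g where "g i = G (u i)" for i
  define K where "K i j = l (g i) (u j)" for i j
  have g: "g i \<in> S" for i by (simp add: g_def G u)
  have K_a: "K i j = a (g i) (g j)" for i j
    using Ga[OF u[of j] g[of i]] by (simp add: K_def a.sym g l.sym u flip: g_def)
  have M_a: "l (u i) (u j) = a (g i) (u j)" for i j by (simp add: g_def Ga u)
  have K_sym: "K i j = K j i" for i j by (simp add: K_a a.sym g)
  have K_psd: "0 \<le> (\<Sum>i\<in>UNIV. \<Sum>j\<in>UNIV. x i * K i j * x j)" for x
    unfolding K_a by (rule a.gram_psd) (rule g)
  obtain v where v: "\<And>i j. K i j = (\<Sum>m\<in>(UNIV::'n set). v m i * v m j)"
    using psd_Cholesky[OF K_sym K_psd] by blast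
  define Km where "Km = (\<chi> i j. K i j)"
  \<comment> \<open>For a kernel vector the combination \<open>gx\<close> is a null vector of
    \<open>a\<close>, so it pairs to zero with \<open>ux\<close>. This pairing is the form of
    \<open>M\<close> at \<open>x\<close>, which \<open>pd\<close> bounds below by the squared length
    of \<open>x\<close>.\<close>
  have "x = 0" if x: "Km *v x = 0" for x
  proof -
    define gx where "gx = (\<lambda>y. \<Sum>i\<in>UNIV. x $ i * g i y)"
    define ux where "ux = (\<lambda>y. \<Sum>i\<in>UNIV. x $ i * u i y)"
    have gx: "gx \<in> S" and ux: "ux \<in> S" unfolding gx_def ux_def by (auto intro!: a.sum_mem u g)
    have "(\<Sum>j\<in>UNIV. K i j * x $ j) = 0" for i
      using x by (simp add: Km_def matrix_vector_mult_def vec_eq_iff)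
    then have "a gx gx = 0"
      unfolding gx_def by (simp add: a.sum_form g mult.assoc flip: K_a sum_distrib_left)
    then have "a gx ux = 0"
      using a.Cauchy_Schwarz[OF gx ux] by (simp add: a.nrm_def)
    also have "a gx ux = (\<Sum>i\<in>UNIV. \<Sum>j\<in>UNIV. x $ i * l (u i) (u j) * x $ j)"
      unfolding gx_def ux_def by (simp add: a.sum_form g u M_a)
    finally have "(\<Sum>i\<in>UNIV. (x $ i)\<^sup>2) \<le> 0" using pd[of "($) x"] by simp
    then have "(\<Sum>i\<in>UNIV. (x $ i)\<^sup>2) = 0" using sum_nonneg[of UNIV "\<lambda>i. (x $ i)\<^sup>2"] by simp
    then show "x = 0" by (simp add: sum_nonneg_eq_0_iff vec_eq_iff)
  qed
  then obtain L where L: "L ** Km = mat 1" using matrix_left_invertible_ker[of Km] by auto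
  then have L': "Km ** L = mat 1" by (simp add: matrix_left_right_inverse)
  \<comment> \<open>\<open>w m\<close> is the image of \<open>v m\<close> under the inverse of
    \<open>K\<close>.\<close>
  define w where "w m i = (\<Sum>k\<in>UNIV. L $ i $ k * v m k)" for m i
  have Kw: "(\<Sum>j\<in>UNIV. K i j * w m j) = v m i" for i m
  proof -
    have "(\<Sum>j\<in>UNIV. K i j * w m j) = (\<Sum>k\<in>UNIV. (Km ** L) $ i $ k * v m k)"
      unfolding w_def matrix_matrix_mult_def Km_def
      by (simp add: sum_distrib_left sum_distrib_right mult.assoc) (rule sum.swap)
    then show ?thesis unfolding L' mat_def by (simp add: sum_delta_mult)
  qed
  \<comment> \<open>The sum of the outer products of \<open>w m\<close> and \<open>v m\<close> is
    the inverse of \<open>K\<close> times \<open>K\<close>; this identity turns the cross terms into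
    \<open>tr M\<close> and the last terms into \<open>N\<close>.\<close>
  have wv: "(\<Sum>m\<in>UNIV. w m i * v m j) = (if i = j then 1 else 0)" for i j
  proof -
    have "(\<Sum>m\<in>UNIV. w m i * v m j) = (\<Sum>k\<in>UNIV. L $ i $ k * K k j)"
      unfolding w_def v sum_distrib_left sum_distrib_right by (subst sum.swap) (simp add: mult.assoc)
    also have "\<dots> = (L ** Km) $ i $ j" by (simp add: Km_def matrix_matrix_mult_def)
    finally show ?thesis by (simp add: L mat_def)
  qed
  define d where "d m = (\<lambda>y. (\<Sum>i\<in>UNIV. v m i * u i y) - (\<Sum>i\<in>UNIV. w m i * g i y))" for m
  have d_form: "a (d m) (d m) = (\<Sum>i\<in>UNIV. \<Sum>j\<in>UNIV. v m i * a (u i) (u j) * v m j)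
      - 2 * (\<Sum>i\<in>UNIV. \<Sum>j\<in>UNIV. w m i * l (u i) (u j) * v m j) + (\<Sum>i\<in>UNIV. w m i * v m i)" for m
  proof -
    define p where "p = (\<lambda>y. \<Sum>i\<in>UNIV. v m i * u i y)"
    define q where "q = (\<lambda>y. \<Sum>i\<in>UNIV. w m i * g i y)"
    have p: "p \<in> S" and q: "q \<in> S" unfolding p_def q_def by (auto intro!: a.sum_mem u g)
    have d_eq: "d m = (\<lambda>y. p y - q y)" by (simp add: d_def p_def q_def)
    have "a (d m) (d m) = a p p - 2 * a q p + a q q"
      unfolding d_eq
      using p q by (simp add: a.diff_left a.diff_right a.diff_mem a.sym[OF p q])
    also have "a q q = (\<Sum>i\<in>UNIV. w m i * v m i)"
      unfolding q_def by (simp add: a.sum_form g mult.assoc Kw flip: K_a sum_distrib_left)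
    finally show ?thesis unfolding p_def q_def by (simp add: a.sum_form g u M_a)
  qed
  have "0 \<le> (\<Sum>m\<in>UNIV. a (d m) (d m))"
    unfolding d_def by (intro sum_nonneg a.nonneg a.diff_mem a.sum_mem u g finite_class.finite_UNIV)
  also have "\<dots> = (\<Sum>m\<in>UNIV. \<Sum>i\<in>UNIV. \<Sum>j\<in>UNIV. v m i * a (u i) (u j) * v m j)
      - 2 * (\<Sum>m\<in>UNIV. \<Sum>i\<in>UNIV. \<Sum>j\<in>UNIV. w m i * l (u i) (u j) * v m j)
      + (\<Sum>m\<in>UNIV. \<Sum>i\<in>UNIV. w m i * v m i)"
    by (simp only: d_form sum.distrib sum_subtractf flip: sum_distrib_left)
  also have "(\<Sum>m\<in>UNIV. \<Sum>i\<in>UNIV. w m i * v m i) = real CARD('n)"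
    by (subst sum.swap) (simp add: wv)
  also have "(\<Sum>m\<in>UNIV. \<Sum>i\<in>UNIV. \<Sum>j\<in>UNIV. v m i * a (u i) (u j) * v m j)
      = (\<Sum>i\<in>UNIV. \<Sum>j\<in>UNIV. K i j * a (u i) (u j))"
  proof -
    have "(\<Sum>m\<in>UNIV. \<Sum>i\<in>UNIV. \<Sum>j\<in>UNIV. v m i * a (u i) (u j) * v m j)
      = (\<Sum>i\<in>UNIV. \<Sum>j\<in>UNIV. \<Sum>m\<in>UNIV. v m i * a (u i) (u j) * v m j)"
      by (rule trans[OF sum.swap], rule sum.cong[OF refl], rule sum.swap)
    also have "\<dots> = (\<Sum>i\<in>UNIV. \<Sum>j\<in>UNIV. (\<Sum>m\<in>UNIV. v m i * v m j) * a (u i) (u j))"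
      unfolding sum_distrib_right by (simp add: mult_ac)
    finally show ?thesis unfolding v .
  qed
  also have "(\<Sum>m\<in>UNIV. \<Sum>i\<in>UNIV. \<Sum>j\<in>UNIV. w m i * l (u i) (u j) * v m j)
      = (\<Sum>i\<in>UNIV. l (u i) (u i))"
  proof -
    have "(\<Sum>m\<in>UNIV. \<Sum>i\<in>UNIV. \<Sum>j\<in>UNIV. w m i * l (u i) (u j) * v m j)
      = (\<Sum>i\<in>UNIV. \<Sum>j\<in>UNIV. \<Sum>m\<in>UNIV. w m i * l (u i) (u j) * v m j)"
      by (rule trans[OF sum.swap], rule sum.cong[OF refl], rule sum.swap)
    also have "\<dots> = (\<Sum>i\<in>UNIV. \<Sum>j\<in>UNIV. (\<Sum>m\<in>UNIV. w m i * v m j) * l (u i) (u j))"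
      unfolding sum_distrib_right by (simp add: mult_ac)
    finally show ?thesis unfolding wv by (simp add: sum_delta_mult)
  qed
  finally have "2 * (\<Sum>i\<in>UNIV. l (u i) (u i)) \<le> (\<Sum>i\<in>UNIV. \<Sum>j\<in>UNIV. K i j * a (u i) (u j)) + real CARD('n)"
    by simp
  moreover have "real CARD('n) \<le> (\<Sum>i\<in>UNIV. l (u i) (u i))"
  proof -
    \<comment> \<open>The matrix inequality tested on a unit vector: each diagonal entry of
      \<open>M\<close> is at least 1, hence \<open>N \<le> tr M\<close>.\<close>
    have "1 \<le> l (u k) (u k)" for k
    proof -
      define e where "e i = (if i = k then 1 else 0::real)" for i
      have "(\<Sum>i\<in>UNIV. (e i)\<^sup>2) = 1"
        unfolding power2_eq_square e_def by (simp only: sum_delta_mult) simp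
      moreover have "(\<Sum>i\<in>UNIV. \<Sum>j\<in>UNIV. e i * l (u i) (u j) * e j) = l (u k) (u k)"
        unfolding e_def by (simp only: sum_delta_mult)
      ultimately show ?thesis using pd[of e] by simp
    qed
    then have "(\<Sum>i\<in>(UNIV::'n set). 1) \<le> (\<Sum>i\<in>UNIV. l (u i) (u i))" by (intro sum_mono) auto
    then show ?thesis by simp
  qed
  ultimately show ?thesis unfolding K_def g_def by simp
qed

text \<open>All of the analysis is hidden in \<open>S\<close>, \<open>l\<close>, \<open>a\<close>
  and \<open>G\<close>. The flow is differentiable in two seminorms: that of \<open>l\<close> drives
  the Gram matrix, that of \<open>a\<close> the energy. Derivatives are relative to
  \<open>{0..<T}\<close>, hence one-sided at 0.\<close>

lemma energy_derivative_nonpos: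
  fixes U :: "real \<Rightarrow> 'n::finite \<Rightarrow> 'x \<Rightarrow> real"
  assumes l: "semi_inner S l" and a: "semi_inner S a"
    and G: "\<And>f. f \<in> S \<Longrightarrow> G f \<in> S" and Ga: "\<And>f v. f \<in> S \<Longrightarrow> v \<in> S \<Longrightarrow> a (G f) v = l f v"
    and U: "\<And>t i. t \<in> {0..<T} \<Longrightarrow> U t i \<in> S"
    and F: "\<And>t i x. F t i x = G (U t i) x - (\<Sum>k\<in>UNIV. U t k x * l (G (U t k)) (U t i))"
    and dl: "\<And>t i. t \<in> {0..<T} \<Longrightarrow>
        ((\<lambda>s. semi_inner.nrm l (\<lambda>x. (U s i x - U t i x) / (s - t) - F t i x)) \<longlongrightarrow> 0) (at t within {0..<T})"
    and da: "\<And>t i. t \<in> {0..<T} \<Longrightarrow>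
        ((\<lambda>s. semi_inner.nrm a (\<lambda>x. (U s i x - U t i x) / (s - t) - F t i x)) \<longlongrightarrow> 0) (at t within {0..<T})"
    and init: "\<And>x. (\<Sum>i\<in>UNIV. (x i)\<^sup>2) \<le> (\<Sum>i\<in>UNIV. \<Sum>j\<in>UNIV. x i * l (U 0 i) (U 0 j) * x j)"
    and t: "t \<in> {0..<T}"
  shows "\<exists>D\<le>0. ((\<lambda>s. 1/2 * (\<Sum>i\<in>UNIV. a (U s i) (U s i))) has_real_derivative D) (at t within {0..<T})"
proof -
  interpret l: semi_inner S l by fact
  interpret a: semi_inner S a by fact
  define K where "K t i j = l (G (U t i)) (U t j)" for t i j
  have K_a: "K s i j = a (G (U s i)) (G (U s j))" if "s \<in> {0..<T}" for s i j
    using Ga[OF U[OF that] G[OF U[OF that]], of j i] that by (simp add: K_def a.sym l.sym G U)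
  have K_sym: "K s i j = K s j i" if "s \<in> {0..<T}" for s i j
    using that by (simp add: K_a a.sym G U)
  have F_eq: "F t i = (\<lambda>x. G (U t i) x - (\<Sum>k\<in>UNIV. K t k i * U t k x))" for t i
    by (rule ext) (simp add: F K_def mult.commute)
  have F_mem: "F s i \<in> S" if "s \<in> {0..<T}" for s i
    unfolding F_eq using that by (intro a.diff_mem a.sum_mem G U) auto
  have lF: "l (F s i) w = l (G (U s i)) w - (\<Sum>k\<in>UNIV. K s k i * l (U s k) w)"
    if "s \<in> {0..<T}" "w \<in> S" for s i w
    unfolding F_eq using that by (simp add: l.diff_left l.sum_left l.sum_mem G U)
  have aF: "a (F s i) w = l (U s i) w - (\<Sum>k\<in>UNIV. K s k i * a (U s k) w)"
    if "s \<in> {0..<T}" "w \<in> S" for s i w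
    unfolding F_eq using that by (simp add: a.diff_left a.sum_left a.sum_mem G U Ga)
  define P where "P s i j = l (U s i) (U s j) - (if i = j then 1 else 0)" for s i j
  \<comment> \<open>Extension by zero outside \<open>[0, T)\<close>: the propagation lemma asks for
    symmetry at every real time, while symmetry of \<open>l\<close> is available only for members of
    \<open>S\<close>.\<close>
  define P' where "P' s i j = (if s \<in> {0..<T} then P s i j else 0)" for s i j
  have form_P: "(\<Sum>i\<in>UNIV. \<Sum>j\<in>UNIV. x i * P s i j * x j)
      = (\<Sum>i\<in>UNIV. \<Sum>j\<in>UNIV. x i * l (U s i) (U s j) * x j) - (\<Sum>i\<in>UNIV. (x i)\<^sup>2)" for x s
    by (simp add: P_def ring_distribs sum_subtractf mult.assoc sum_delta_mult power2_eq_square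
        flip: sum_distrib_left)
  have dP: "((\<lambda>s. P s i j) has_real_derivative
      - (\<Sum>k\<in>UNIV. K s i k * P s k j + P s i k * K s k j)) (at s within {0..<T})" if s: "s \<in> {0..<T}" for s i j
  proof -
    have "((\<lambda>s. P s i j) has_real_derivative l (F s i) (U s j) + l (U s i) (F s j) - 0) (at s within {0..<T})"
      unfolding P_def using s
      by (intro DERIV_diff DERIV_const l.has_derivative_form U F_mem dl)
    \<comment> \<open>The two summands are entries of \<open>K - K M = - K P\<close> and
      \<open>K - M K = - P K\<close>.\<close>
    moreover have "l (F s i) (U s j) + l (U s i) (F s j) = - (\<Sum>k\<in>UNIV. K s i k * P s k j + P s i k * K s k j)"
    proof -
      have "l (U s i) (F s j) = K s j i - (\<Sum>k\<in>UNIV. K s k j * l (U s k) (U s i))"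
        using s by (simp add: l.sym[of "U s i"] lF F_mem U K_def)
      moreover have "l (F s i) (U s j) = K s i j - (\<Sum>k\<in>UNIV. K s k i * l (U s k) (U s j))"
        using s by (simp add: lF U K_def)
      moreover have "(\<Sum>k\<in>UNIV. K s i k * P s k j) = (\<Sum>k\<in>UNIV. K s k i * l (U s k) (U s j)) - K s i j"
      proof -
        have "(\<Sum>k\<in>UNIV. K s i k * P s k j) = (\<Sum>k\<in>UNIV. K s i k * l (U s k) (U s j)) - K s i j"
          by (simp add: P_def right_diff_distrib sum_subtractf sum_delta_mult)
        then show ?thesis using K_sym[OF s, of i] by simp
      qed
      moreover have "(\<Sum>k\<in>UNIV. P s i k * K s k j) = (\<Sum>k\<in>UNIV. K s k j * l (U s k) (U s i)) - K s i j"
      proof -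
        have "(\<Sum>k\<in>UNIV. P s i k * K s k j) = (\<Sum>k\<in>UNIV. l (U s i) (U s k) * K s k j) - K s i j"
          by (simp add: P_def left_diff_distrib sum_subtractf sum_delta_mult)
        also have "(\<Sum>k\<in>UNIV. l (U s i) (U s k) * K s k j) = (\<Sum>k\<in>UNIV. K s k j * l (U s k) (U s i))"
          using l.sym[OF U[OF s] U[OF s]] by (intro sum.cong) auto
        finally show ?thesis .
      qed
      ultimately show ?thesis using K_sym[OF s, of i j] by (simp add: sum.distrib)
    qed
    ultimately show ?thesis by simp
  qed
  have psd: "0 \<le> (\<Sum>i\<in>UNIV. \<Sum>j\<in>UNIV. x i * P' t i j * x j)" for x
  proof (rule psd_preserved[where K=K])
    show "0 \<le> t" using t by simp
    show "P' s i j = P' s j i" for s i j by (simp add: P'_def P_def l.sym U)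
    have sub: "{0..t} \<subseteq> {0..<T}" using t by auto
    show "K s i j = K s j i" if "s \<in> {0..t}" for s i j using that sub by (blast intro: K_sym)
    show "0 \<le> (\<Sum>i\<in>UNIV. \<Sum>j\<in>UNIV. y i * K s i j * y j)" if "s \<in> {0..t}" for s y
    proof -
      have "s \<in> {0..<T}" using that sub by blast
      then show ?thesis unfolding K_a[OF \<open>s \<in> {0..<T}\<close>] by (intro a.gram_psd G U)
    qed
    show "0 \<le> (\<Sum>i\<in>UNIV. \<Sum>j\<in>UNIV. y i * P' 0 i j * y j)" for y
      using init[of y] t by (simp add: P'_def form_P)
    show "((\<lambda>s. P' s i j) has_real_derivative - (\<Sum>k\<in>UNIV. K s i k * P' s k j + P' s i k * K s k j)) (at s within {0..t})"
      if s: "s \<in> {0..t}" for s i j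
    proof -
      have sT: "s \<in> {0..<T}" using s sub by blast
      have "((\<lambda>s. P s i j) has_real_derivative - (\<Sum>k\<in>UNIV. K s i k * P s k j + P s i k * K s k j)) (at s within {0..t})"
        using DERIV_subset[OF dP[OF sT] sub] .
      then have "((\<lambda>s. P' s i j) has_real_derivative - (\<Sum>k\<in>UNIV. K s i k * P s k j + P s i k * K s k j)) (at s within {0..t})"
        by (rule has_field_derivative_transform_within[where d=1]) (use s sub in \<open>auto simp: P'_def\<close>)
      then show ?thesis using sT by (simp add: P'_def)
    qed
  qed
  have pd: "(\<Sum>i\<in>UNIV. (x i)\<^sup>2) \<le> (\<Sum>i\<in>UNIV. \<Sum>j\<in>UNIV. x i * l (U t i) (U t j) * x j)" for x
    using psd[of x] t form_P[of x t] by (simp add: P'_def)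
  define D where "D = 1/2 * (\<Sum>i\<in>UNIV. a (F t i) (U t i) + a (U t i) (F t i))"
  have dE: "((\<lambda>s. 1/2 * (\<Sum>i\<in>UNIV. a (U s i) (U s i))) has_real_derivative D) (at t within {0..<T})"
    unfolding D_def using t by (intro DERIV_cmult DERIV_sum a.has_derivative_form U F_mem da)
  have "D = (\<Sum>i\<in>UNIV. l (U t i) (U t i)) - (\<Sum>i\<in>UNIV. \<Sum>k\<in>UNIV. K t k i * a (U t k) (U t i))"
  proof -
    have "a (F t i) (U t i) + a (U t i) (F t i) = 2 * (l (U t i) (U t i) - (\<Sum>k\<in>UNIV. K t k i * a (U t k) (U t i)))" for i
      using a.sym[OF U[OF t] F_mem[OF t], of i i] aF[OF t U[OF t], of i i] by simp
    then have "D = 1/2 * (\<Sum>i\<in>UNIV. 2 * (l (U t i) (U t i) - (\<Sum>k\<in>UNIV. K t k i * a (U t k) (U t i))))"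
      unfolding D_def by (simp only:)
    also have "\<dots> = (\<Sum>i\<in>UNIV. l (U t i) (U t i) - (\<Sum>k\<in>UNIV. K t k i * a (U t k) (U t i)))"
      by (simp only: sum_distrib_left[symmetric])
    finally show ?thesis by (simp only: sum_subtractf)
  qed
  moreover have "(\<Sum>i\<in>UNIV. l (U t i) (U t i)) \<le> (\<Sum>i\<in>UNIV. \<Sum>j\<in>UNIV. K t i j * a (U t i) (U t j))"
    unfolding K_def by (rule trace_gram_inequality[OF l a]) (use G Ga U[OF t] pd in auto)
  moreover have "(\<Sum>i\<in>UNIV. \<Sum>j\<in>UNIV. K t i j * a (U t i) (U t j)) = (\<Sum>i\<in>UNIV. \<Sum>k\<in>UNIV. K t k i * a (U t k) (U t i))"
    by (rule sum.swap)
  ultimately have "D \<le> 0" by linarith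
  then show ?thesis using dE by blast
qed

section \<open>Test functions\<close>

lemma smooth_fun_differentiable: "smooth_fun f \<Longrightarrow> f differentiable (at x)"
  by (cases rule: smooth_fun.cases) auto

lemma smooth_fun_partial: "smooth_fun f \<Longrightarrow> b \<in> Basis \<Longrightarrow> smooth_fun (\<lambda>x. frechet_derivative f (at x) b)"
  by (cases rule: smooth_fun.cases) auto

lemma smooth_fun_continuous_on: "smooth_fun f \<Longrightarrow> continuous_on A f"
  by (simp add: continuous_at_imp_continuous_on differentiable_imp_continuous_within smooth_fun_differentiable)

lemma smooth_fun_const: "smooth_fun (\<lambda>x. c)"
proof (coinduction arbitrary: c)
  case smooth_fun
  have "frechet_derivative (\<lambda>x::'a. c) (at x) = (\<lambda>h. 0)" for x
    by (rule frechet_derivative_at[symmetric]) auto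
  then show ?case by auto
qed

text \<open>Smoothness of products is coinduction up to ring operations.\<close>
inductive smooth_ring :: "('a::euclidean_space \<Rightarrow> real) \<Rightarrow> bool" where
  base: "smooth_fun f \<Longrightarrow> smooth_ring f"
| add: "smooth_ring f \<Longrightarrow> smooth_ring g \<Longrightarrow> smooth_ring (\<lambda>x. f x + g x)"
| mult: "smooth_ring f \<Longrightarrow> smooth_ring g \<Longrightarrow> smooth_ring (\<lambda>x. f x * g x)"

lemma smooth_ring_step:
  assumes "smooth_ring f"
  shows "(\<forall>x. f differentiable (at x)) \<and> (\<forall>b\<in>Basis. smooth_ring (\<lambda>x. frechet_derivative f (at x) b))"
  using assms
proof induction
  case (base f)
  then show ?case by (auto intro: smooth_ring.base smooth_fun_differentiable smooth_fun_partial)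
next
  case (add f g)
  have "frechet_derivative (\<lambda>x. f x + g x) (at x) =
      (\<lambda>h. frechet_derivative f (at x) h + frechet_derivative g (at x) h)" for x
    using add.IH by (intro frechet_derivative_at[symmetric] has_derivative_add)
      (auto simp: frechet_derivative_works)
  then show ?case using add.IH by (simp add: smooth_ring.add)
next
  case (mult f g)
  have "frechet_derivative (\<lambda>x. f x * g x) (at x) =
      (\<lambda>h. f x * frechet_derivative g (at x) h + frechet_derivative f (at x) h * g x)" for x
    using mult.IH by (intro frechet_derivative_at[symmetric] has_derivative_mult)
      (auto simp: frechet_derivative_works)
  then show ?case using mult by (simp add: smooth_ring.add smooth_ring.mult)
qed

lemma smooth_ring_imp_smooth_fun: "smooth_ring f \<Longrightarrow> smooth_fun f"
  by (erule smooth_fun.coinduct[of smooth_ring]) (metis smooth_ring_step)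

lemma smooth_fun_mult: "smooth_fun f \<Longrightarrow> smooth_fun g \<Longrightarrow> smooth_fun (\<lambda>x. f x * g x)"
  by (simp add: smooth_ring_imp_smooth_fun smooth_ring.mult smooth_ring.base)

lemma smooth_fun_prod:
  "finite I \<Longrightarrow> (\<And>i. i \<in> I \<Longrightarrow> smooth_fun (f i)) \<Longrightarrow> smooth_fun (\<lambda>x. \<Prod>i\<in>I. f i x)"
  by (induction I rule: finite_induct) (simp_all add: smooth_fun_const smooth_fun_mult)

section \<open>Flat functions and smooth bumps on boxes\<close>

text \<open>The polynomial parameter makes the family closed under differentiation, so smoothness
  becomes a coinduction over \<open>p\<close>; \<open>flat 1\<close> is the classical function
  \<open>exp (- 1/x)\<close> continued by 0.\<close>

definition flat :: "real poly \<Rightarrow> real \<Rightarrow> real" where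
  "flat p x = (if x \<le> 0 then 0 else poly p (1 / x) * exp (- (1 / x)))"

lemma poly_mult_exp_minus_tendsto_0: "((\<lambda>y. poly p y * exp (- y)) \<longlongrightarrow> (0::real)) at_top"
proof -
  have "((\<lambda>y. \<Sum>i\<le>degree p. coeff p i * (y ^ i / exp y)) \<longlongrightarrow> (\<Sum>i\<le>degree p. coeff p i * 0)) at_top"
    by (intro tendsto_intros tendsto_power_div_exp_0)
  moreover have "(\<Sum>i\<le>degree p. coeff p i * (y ^ i / exp y)) = poly p y * exp (- y)" for y
    unfolding poly_altdef sum_distrib_right by (intro sum.cong) (auto simp: exp_minus field_simps)
  ultimately show ?thesis by simp
qed

lemma flat_tendsto_0: "(flat p \<longlongrightarrow> 0) (at 0)"
proof (rule filterlim_split_at)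
  have "((\<lambda>x. poly p (inverse x) * exp (- inverse x)) \<longlongrightarrow> 0) (at_right 0)"
    using filterlim_compose[OF poly_mult_exp_minus_tendsto_0 filterlim_inverse_at_top_right] .
  then show "(flat p \<longlongrightarrow> 0) (at_right 0)"
    by (rule Lim_transform_eventually)
       (auto simp: flat_def eventually_at_right_less inverse_eq_divide eventually_at intro!: exI[of _ 1])
  show "(flat p \<longlongrightarrow> 0) (at_left 0)"
    by (rule Lim_transform_eventually[OF tendsto_const])
       (auto simp: flat_def eventually_at intro!: exI[of _ 1])
qed

lemma flat_has_derivative:
  "(flat p has_real_derivative flat (monom 1 2 * (p - pderiv p)) x) (at x)"
proof (cases x "0::real" rule: linorder_cases)
  case less
  have "(flat p has_real_derivative 0) (at x)"
    by (rule has_field_derivative_transform_within_open[of "\<lambda>x. 0" _ _ "{..<0}"])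
       (use less in \<open>auto simp: flat_def\<close>)
  then show ?thesis using less by (simp add: flat_def)
next
  case equal
  \<comment> \<open>Dividing by \<open>h\<close> multiplies the polynomial in \<open>1/h\<close> by
    its variable, so the difference quotient at 0 stays in the family and tends to 0.\<close>
  have "(flat p h - flat p 0) / (h - 0) = flat (pCons 0 p) h" for h by (simp add: flat_def)
  moreover have "flat (monom 1 2 * (p - pderiv p)) 0 = 0" by (simp add: flat_def)
  ultimately show ?thesis using flat_tendsto_0[of "pCons 0 p"] equal
    by (simp only: has_field_derivative_iff)
next
  case greater
  have "((\<lambda>x. poly p (1 / x) * exp (- (1 / x))) has_real_derivative
      flat (monom 1 2 * (p - pderiv p)) x) (at x)"
    using greater
  proof -
    have "((\<lambda>x. 1 / x) has_real_derivative - 1 / x\<^sup>2) (at x)"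
      using greater by (auto intro!: derivative_eq_intros simp: power2_eq_square)
    note d = DERIV_mult[OF DERIV_chain2[OF poly_DERIV this] DERIV_chain2[OF DERIV_exp DERIV_minus[OF this]]]
    show ?thesis
      by (rule DERIV_cong[OF d[of p]]) (use greater in \<open>simp add: flat_def poly_monom algebra_simps power_divide\<close>)
  qed
  then show ?thesis
    by (rule has_field_derivative_transform_within_open[of _ _ _ "{0<..}"])
       (use greater in \<open>auto simp: flat_def\<close>)
qed

text \<open>Coinduction over \<open>p\<close>. A partial derivative carries the constant factor
  \<open>b \<bullet> w\<close>, which is absorbed into the polynomial by \<open>smult\<close>, so
  the claim reproduces itself.\<close>

lemma smooth_fun_flat:
  fixes w :: "'a::euclidean_space"
  shows "smooth_fun (\<lambda>x. flat p (x \<bullet> w + c))"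
proof (coinduction arbitrary: p)
  case smooth_fun
  define q where "q = monom 1 2 * (p - pderiv p)"
  have d: "((\<lambda>x. flat p (x \<bullet> w + c)) has_derivative (\<lambda>h. flat q (x \<bullet> w + c) * (h \<bullet> w))) (at x)" for x
  proof -
    have 1: "(flat p has_derivative (*) (flat q (x \<bullet> w + c))) (at (x \<bullet> w + c))"
      using flat_has_derivative[of p] by (simp add: has_field_derivative_def q_def)
    have 2: "((\<lambda>x. x \<bullet> w + c) has_derivative (\<lambda>h. h \<bullet> w)) (at x)"
      by (auto intro!: derivative_eq_intros)
    show ?thesis using has_derivative_compose[OF 2 1] by simp
  qed
  have "frechet_derivative (\<lambda>x. flat p (x \<bullet> w + c)) (at x) b = flat (smult (b \<bullet> w) q) (x \<bullet> w + c)" for x b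
    using frechet_derivative_at[OF d[of x], symmetric] by (simp add: flat_def)
  then show ?case using d by (auto simp: differentiable_def)
qed

text \<open>Two flat factors per coordinate vanish at and beyond the two faces, and stretching by
  \<open>Suc n\<close> pushes the product to the indicator of the open box. The arguments are
  written as \<open>x \<bullet> w + c\<close>, the shape for which smoothness of \<open>flat\<close>
  is known.\<close>

definition box_bump :: "'a::euclidean_space \<Rightarrow> 'a \<Rightarrow> nat \<Rightarrow> 'a \<Rightarrow> real" where
  "box_bump l u n x = (\<Prod>b\<in>Basis. flat 1 (x \<bullet> (Suc n *\<^sub>R b) + (- (Suc n * (l \<bullet> b)))) *
     flat 1 (x \<bullet> (- Suc n *\<^sub>R b) + Suc n * (u \<bullet> b)))"

lemma box_bump_eq: "box_bump l u n x = (\<Prod>b\<in>Basis. flat 1 (Suc n * (x \<bullet> b - l \<bullet> b)) * flat 1 (Suc n * (u \<bullet> b - x \<bullet> b)))"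
  unfolding box_bump_def by (intro prod.cong) (simp_all add: algebra_simps)

lemma smooth_fun_box_bump: "smooth_fun (box_bump l u n)"
  unfolding box_bump_def[abs_def] by (intro smooth_fun_prod smooth_fun_mult smooth_fun_flat finite_Basis)

lemma flat_1_bounds: "0 \<le> flat 1 x" "flat 1 x \<le> 1"
  by (auto simp: flat_def)

lemma flat_1_eq_0_iff: "flat 1 x = 0 \<longleftrightarrow> x \<le> 0"
  by (auto simp: flat_def)

lemma box_bump_bounds: "0 \<le> box_bump l u n x" "box_bump l u n x \<le> 1"
  unfolding box_bump_eq by (auto intro!: prod_nonneg prod_le_1 mult_nonneg_nonneg mult_le_one flat_1_bounds)

lemma box_bump_outside:
  assumes "x \<notin> box l u"
  shows "box_bump l u n x = 0"
proof -
  obtain b where b: "b \<in> Basis" "x \<bullet> b - l \<bullet> b \<le> 0 \<or> u \<bullet> b - x \<bullet> b \<le> 0"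
    using assms by (force simp: mem_box)
  then have "real (Suc n) * (x \<bullet> b - l \<bullet> b) \<le> 0 \<or> real (Suc n) * (u \<bullet> b - x \<bullet> b) \<le> 0"
    by (metis mult_nonneg_nonpos of_nat_0_le_iff)
  then have "flat 1 (real (Suc n) * (x \<bullet> b - l \<bullet> b)) * flat 1 (real (Suc n) * (u \<bullet> b - x \<bullet> b)) = 0"
    by (auto simp only: flat_1_eq_0_iff mult_eq_0_iff)
  then show ?thesis unfolding box_bump_eq using b(1) by (intro prod_zero) auto
qed

lemma flat_1_scaled_tendsto:
  fixes x :: real
  assumes x: "0 < x"
  shows "(\<lambda>n. flat 1 (real (Suc n) * x)) \<longlonglongrightarrow> 1"
proof -
  have "(\<lambda>n. exp (- (1 / x * inverse (real (Suc n))))) \<longlonglongrightarrow> exp (- (1 / x * 0))"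
    by (intro tendsto_intros LIMSEQ_inverse_real_of_nat)
  moreover have "exp (- (1 / x * inverse (real (Suc n)))) = flat 1 (real (Suc n) * x)" for n
  proof -
    have "0 < real (Suc n) * x" using x by simp
    then show ?thesis unfolding flat_def by (simp add: divide_inverse mult.commute)
  qed
  ultimately show ?thesis by simp
qed

lemma box_bump_tendsto: "(\<lambda>n. box_bump l u n x) \<longlonglongrightarrow> indicator (box l u) x"
proof (cases "x \<in> box l u")
  case True
  have "(\<lambda>n. box_bump l u n x) \<longlonglongrightarrow> (\<Prod>b\<in>(Basis::'a set). 1 * 1)"
    unfolding box_bump_eq
  proof (intro tendsto_prod tendsto_mult)
    fix b :: 'a assume "b \<in> Basis"
    then have "0 < x \<bullet> b - l \<bullet> b" "0 < u \<bullet> b - x \<bullet> b" using True by (auto simp: mem_box)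
    then show "(\<lambda>n. flat 1 (real (Suc n) * (x \<bullet> b - l \<bullet> b))) \<longlonglongrightarrow> 1"
      "(\<lambda>n. flat 1 (real (Suc n) * (u \<bullet> b - x \<bullet> b))) \<longlonglongrightarrow> 1"
      using flat_1_scaled_tendsto by blast+
  qed
  then show ?thesis using True by simp
qed (simp add: box_bump_outside)

lemma test_fun_box_bump:
  assumes "cbox l u \<subseteq> \<Omega>"
  shows "test_fun \<Omega> (box_bump l u n)"
proof -
  have "{x. box_bump l u n x \<noteq> 0} \<subseteq> cbox l u"
    using box_bump_outside box_subset_cbox by blast
  then have "closure {x. box_bump l u n x \<noteq> 0} \<subseteq> cbox l u"
    by (rule closure_minimal) (rule closed_cbox)
  moreover have "compact (closure {x. box_bump l u n x \<noteq> 0})"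
    using calculation bounded_subset[OF bounded_cbox] by (simp add: compact_eq_bounded_closed)
  ultimately show ?thesis unfolding test_fun_def using assms smooth_fun_box_bump by blast
qed

section \<open>Integrals of directional derivatives\<close>

text \<open>Links the completed measure on \<open>\<Omega>\<close>, in which the Sobolev notions are
  phrased, with the translation-invariant Borel measure on the whole space.\<close>

lemma lebesgue_on_eq_lborel:
  fixes f :: "'a::euclidean_space \<Rightarrow> real"
  assumes \<Omega>: "open \<Omega>" and f: "f \<in> borel_measurable borel" and 0: "\<And>x. x \<notin> \<Omega> \<Longrightarrow> f x = 0"
  shows "integrable (lebesgue_on \<Omega>) f \<longleftrightarrow> integrable lborel f"
    and "integral\<^sup>L (lebesgue_on \<Omega>) f = integral\<^sup>L lborel f"
proof -
  have ind: "(\<lambda>x. indicator \<Omega> x *\<^sub>R f x) = f" using 0 by (force simp: indicator_def)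
  have \<Omega>': "\<Omega> \<inter> space lebesgue \<in> sets lebesgue" using \<Omega> by simp
  have f': "f \<in> borel_measurable lborel" using f by simp
  show "integrable (lebesgue_on \<Omega>) f \<longleftrightarrow> integrable lborel f"
    unfolding integrable_restrict_space[OF \<Omega>'] ind using integrable_completion[OF f'] .
  show "integral\<^sup>L (lebesgue_on \<Omega>) f = integral\<^sup>L lborel f"
    unfolding integral_restrict_space[OF \<Omega>'] ind using integral_completion[OF f'] .
qed

lemma integrable_continuous_compact_support:
  fixes f :: "'a::euclidean_space \<Rightarrow> real"
  assumes "continuous_on UNIV f" "compact K" "\<And>x. x \<notin> K \<Longrightarrow> f x = 0"
  shows "integrable lborel f"
proof -
  have "(\<lambda>x. indicator K x *\<^sub>R f x) = f" using assms(3) by (force simp: indicator_def)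
  then show ?thesis
    using borel_integrable_compact[OF assms(2) continuous_on_subset[OF assms(1)]] by simp
qed

lemma bounded_continuous_compact_support:
  fixes f :: "'a::euclidean_space \<Rightarrow> real"
  assumes "continuous_on UNIV f" "compact K" "\<And>x. x \<notin> K \<Longrightarrow> f x = 0"
  obtains C where "\<And>x. \<bar>f x\<bar> \<le> C" "0 \<le> C"
proof -
  have "bounded (f ` K)"
    using assms compact_continuous_image continuous_on_subset compact_imp_bounded by (metis subset_UNIV)
  then obtain C where C: "\<And>x. x \<in> K \<Longrightarrow> \<bar>f x\<bar> \<le> C" by (auto simp: bounded_iff)
  have "\<bar>f x\<bar> \<le> max C 0" for x using C[of x] assms(3)[of x] by (cases "x \<in> K") auto
  then show thesis using that[of "max C 0"] by auto
qed

lemma integral_translation: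
  fixes f :: "'a::euclidean_space \<Rightarrow> real"
  assumes "f \<in> borel_measurable borel"
  shows "(\<integral>x. f (x + c) \<partial>lborel) = (\<integral>x. f x \<partial>lborel)"
    and "integrable lborel f \<Longrightarrow> integrable lborel (\<lambda>x. f (x + c))"
proof -
  have "(\<integral>x. f x \<partial>distr lborel borel ((+) c)) = (\<integral>x. f (c + x) \<partial>lborel)"
    using assms by (intro integral_distr) auto
  then show "(\<integral>x. f (x + c) \<partial>lborel) = (\<integral>x. f x \<partial>lborel)"
    by (simp add: lborel_distr_plus add.commute)
  have "integrable (distr lborel borel ((+) c)) f \<longleftrightarrow> integrable lborel (\<lambda>x. f (c + x))"
    using assms by (intro integrable_distr_eq) auto
  then show "integrable lborel f \<Longrightarrow> integrable lborel (\<lambda>x. f (x + c))"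
    by (simp add: lborel_distr_plus add.commute)
qed

text \<open>Difference quotients have integral zero by translation invariance.\<close>
lemma integral_directional_derivative_0:
  fixes f f' :: "'a::euclidean_space \<Rightarrow> real"
  assumes d: "\<And>x. ((\<lambda>t. f (x + t *\<^sub>R b)) has_real_derivative f' x) (at 0)"
    and f: "continuous_on UNIV f" and f': "continuous_on UNIV f'"
    and K: "compact K" and fK: "\<And>x. x \<notin> K \<Longrightarrow> f x = 0" and f'K: "\<And>x. x \<notin> K \<Longrightarrow> f' x = 0"
    and b: "norm b = 1"
  shows "(\<integral>x. f' x \<partial>lborel) = 0"
proof -
  define h where "h n = inverse (real (Suc n))" for n
  have h: "0 < h n" "h n \<le> 1" for n
  proof -
    have "inverse (real (Suc n)) \<le> inverse 1" by (rule le_imp_inverse_le) auto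
    then show "0 < h n" "h n \<le> 1" by (auto simp: h_def)
  qed
  define s where "s n x = (f (x + h n *\<^sub>R b) - f x) / h n" for n x
  obtain C where C: "\<And>x. \<bar>f' x\<bar> \<le> C" "0 \<le> C"
    using bounded_continuous_compact_support[OF f' K f'K] by blast
  obtain R where R: "\<And>x. x \<in> K \<Longrightarrow> norm x \<le> R" using compact_imp_bounded[OF K] by (auto simp: bounded_iff)
  \<comment> \<open>The hypothesis differentiates at parameter 0 only; moving the base point along
    the line gives every parameter, as the mean value theorem requires.\<close>
  have d': "((\<lambda>t. f (x + t *\<^sub>R b)) has_real_derivative f' (x + t *\<^sub>R b)) (at t)" for x t
  proof -
    have "((\<lambda>u. f ((x + t *\<^sub>R b) + u *\<^sub>R b)) has_real_derivative f' (x + t *\<^sub>R b)) (at 0)" by (rule d)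
    then have "((\<lambda>u. f (x + (u + t) *\<^sub>R b)) has_real_derivative f' (x + t *\<^sub>R b)) (at 0)"
      by (simp add: algebra_simps)
    then show ?thesis using DERIV_shift[of "\<lambda>t. f (x + t *\<^sub>R b)" _ 0 t] by simp
  qed
  have s_bound: "\<bar>s n x\<bar> \<le> C" for n x
  proof -
    obtain z where "f (x + h n *\<^sub>R b) - f (x + 0 *\<^sub>R b) = (h n - 0) * f' (x + z *\<^sub>R b)"
      using MVT2[OF h(1)[of n], of "\<lambda>t. f (x + t *\<^sub>R b)" "\<lambda>t. f' (x + t *\<^sub>R b)"] d' by blast
    then have "s n x = f' (x + z *\<^sub>R b)" using h(1)[of n] by (simp add: s_def)
    then show ?thesis using C by simp
  qed
  \<comment> \<open>A shift has length at most 1, so all quotients vanish outside one ball of radius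
    \<open>R + 1\<close>; with the bound \<open>C\<close> this gives an integrable majorant.\<close>
  have s_supp: "s n x = 0" if "x \<notin> cball 0 (R + 1)" for n x
  proof -
    have "norm x > R + 1" using that by simp
    moreover have "norm (h n *\<^sub>R b) \<le> 1" using h[of n] b by simp
    ultimately have "norm (x + h n *\<^sub>R b) > R" using norm_diff_ineq[of x "h n *\<^sub>R b"] by linarith
    then have "x + h n *\<^sub>R b \<notin> K" "x \<notin> K" using R[of x] R[of "x + h n *\<^sub>R b"] \<open>norm x > R + 1\<close> by force+
    then show ?thesis using fK by (simp add: s_def)
  qed
  have fm [measurable]: "f \<in> borel_measurable borel" and f'm [measurable]: "f' \<in> borel_measurable borel"
    using f f' by (auto intro: borel_measurable_continuous_onI)
  have h0: "h \<longlonglongrightarrow> 0" unfolding h_def by (rule LIMSEQ_inverse_real_of_nat)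
  have "(\<lambda>n. \<integral>x. s n x \<partial>lborel) \<longlonglongrightarrow> (\<integral>x. f' x \<partial>lborel)"
  proof (rule integral_dominated_convergence[where w="\<lambda>x. C * indicator (cball 0 (R + 1)) x"])
    show "integrable lborel (\<lambda>x. C * indicator (cball (0::'a) (R + 1)) x :: real)"
      using emeasure_bounded_finite[of "cball (0::'a) (R + 1)"]
      by (intro integrable_mult_right integrable_real_indicator) auto
    have "(\<lambda>n. s n x) \<longlonglongrightarrow> f' x" for x
    proof -
      have "((\<lambda>t. (f (x + t *\<^sub>R b) - f (x + 0 *\<^sub>R b)) / (t - 0)) \<longlongrightarrow> f' x) (at 0)"
        using d[of x] by (simp only: has_field_derivative_iff)
      moreover have "filterlim h (at 0) sequentially"
        using h0 h(1) by (auto simp: filterlim_at intro!: always_eventually) (metis less_irrefl)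
      ultimately show ?thesis unfolding s_def using filterlim_compose by fastforce
    qed
    then show "AE x in lborel. (\<lambda>n. s n x) \<longlonglongrightarrow> f' x" by simp
    show "AE x in lborel. norm (s n x) \<le> C * indicator (cball 0 (R + 1)) x" for n
      using s_bound s_supp C(2) by (auto simp: indicator_def)
    show "s n \<in> borel_measurable lborel" for n unfolding s_def by measurable
  qed simp
  moreover have "(\<integral>x. s n x \<partial>lborel) = 0" for n
  proof -
    have fi: "integrable lborel f" by (rule integrable_continuous_compact_support[OF f K fK])
    show ?thesis unfolding s_def
      using fi integral_translation[OF fm, of "h n *\<^sub>R b"] by simp
  qed
  ultimately show ?thesis by (simp add: LIMSEQ_const_iff)
qed

lemma frechet_derivative_support:
  assumes "x \<notin> closure {x. f x \<noteq> 0}"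
  shows "frechet_derivative f (at x) = (\<lambda>h. 0::real)"
proof -
  have "(f has_derivative (\<lambda>h. 0)) (at x)"
    using assms closure_subset[of "{x. f x \<noteq> 0}"]
    by (intro has_derivative_transform_within_open[OF has_derivative_const[of 0], of "- closure {x. f x \<noteq> 0}"])
       (auto simp: open_Compl)
  then show ?thesis by (rule frechet_derivative_at[symmetric])
qed

lemma smooth_fun_has_line_derivative:
  assumes "smooth_fun f"
  shows "((\<lambda>t. f (x + t *\<^sub>R b)) has_real_derivative frechet_derivative f (at x) b) (at 0)"
proof -
  have "(f has_derivative frechet_derivative f (at x)) (at (x + 0 *\<^sub>R b))"
    using smooth_fun_differentiable[OF assms, of x] by (simp add: frechet_derivative_works)
  moreover have "((\<lambda>t. x + t *\<^sub>R b) has_derivative (\<lambda>t. t *\<^sub>R b)) (at 0)"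
    by (auto intro!: derivative_eq_intros)
  ultimately have "((\<lambda>t. f (x + t *\<^sub>R b)) has_derivative (\<lambda>t. frechet_derivative f (at x) (t *\<^sub>R b))) (at 0)"
    using has_derivative_compose by blast
  moreover have "linear (frechet_derivative f (at x))"
    using smooth_fun_differentiable[OF assms, of x] linear_frechet_derivative by blast
  then have "(\<lambda>t. frechet_derivative f (at x) (t *\<^sub>R b)) = (*) (frechet_derivative f (at x) b)"
    by (auto simp: linear_scale)
  ultimately show ?thesis by (simp add: has_field_derivative_def)
qed

lemma test_funD:
  assumes "test_fun \<Omega> \<phi>"
  shows "smooth_fun \<phi>" "continuous_on UNIV \<phi>" "b \<in> Basis \<Longrightarrow> continuous_on UNIV (\<lambda>x. frechet_derivative \<phi> (at x) b)"
    "\<exists>K. compact K \<and> K \<subseteq> \<Omega> \<and> (\<forall>x. x \<notin> K \<longrightarrow> \<phi> x = 0 \<and> frechet_derivative \<phi> (at x) = (\<lambda>h. 0))"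
proof -
  show s: "smooth_fun \<phi>" using assms by (simp add: test_fun_def)
  show "continuous_on UNIV \<phi>" using s smooth_fun_continuous_on by blast
  show "b \<in> Basis \<Longrightarrow> continuous_on UNIV (\<lambda>x. frechet_derivative \<phi> (at x) b)"
    using s smooth_fun_partial smooth_fun_continuous_on by blast
  show "\<exists>K. compact K \<and> K \<subseteq> \<Omega> \<and> (\<forall>x. x \<notin> K \<longrightarrow> \<phi> x = 0 \<and> frechet_derivative \<phi> (at x) = (\<lambda>h. 0))"
    using assms frechet_derivative_support[of _ \<phi>] closure_subset[of "{x. \<phi> x \<noteq> 0}"] unfolding test_fun_def
    by (intro exI[of _ "closure {x. \<phi> x \<noteq> 0}"]) blast
qed

section \<open>The fundamental lemma of the calculus of variations\<close>

text \<open>The bumps converge to the indicator of the box and are bounded by 1, so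
  \<open>norm (g x)\<close> dominates. The closed box must lie in \<open>\<Omega>\<close> because it
  contains the supports.\<close>

lemma integral_box_eq_0:
  fixes g :: "'a::euclidean_space \<Rightarrow> real"
  assumes g: "integrable (lebesgue_on \<Omega>) g"
    and orth: "\<And>\<phi>. test_fun \<Omega> \<phi> \<Longrightarrow> (\<integral>x. g x * \<phi> x \<partial>lebesgue_on \<Omega>) = 0"
    and sub: "cbox l u \<subseteq> \<Omega>"
  shows "(\<integral>x. g x * indicator (box l u) x \<partial>lebesgue_on \<Omega>) = 0"
proof -
  have gm [measurable]: "g \<in> borel_measurable (lebesgue_on \<Omega>)" using g by auto
  have bm: "box_bump l u n \<in> borel_measurable (lebesgue_on \<Omega>)" for n
  proof -
    have "box_bump l u n \<in> borel_measurable borel"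
      by (intro borel_measurable_continuous_onI smooth_fun_continuous_on smooth_fun_box_bump)
    then show ?thesis by (intro measurable_restrict_space1) (simp add: measurable_completion)
  qed
  have im: "indicat_real (box l u) \<in> borel_measurable (lebesgue_on \<Omega>)"
    by (intro measurable_restrict_space1 borel_measurable_indicator) auto
  have "(\<lambda>n. \<integral>x. g x * box_bump l u n x \<partial>lebesgue_on \<Omega>) \<longlonglongrightarrow> (\<integral>x. g x * indicator (box l u) x \<partial>lebesgue_on \<Omega>)"
  proof (rule integral_dominated_convergence[where w="\<lambda>x. norm (g x)"])
    show "AE x in lebesgue_on \<Omega>. norm (g x * box_bump l u n x) \<le> norm (g x)" for n
      using box_bump_bounds[of l u n] by (auto simp: abs_mult intro!: mult_left_le)
    show "AE x in lebesgue_on \<Omega>. (\<lambda>n. g x * box_bump l u n x) \<longlonglongrightarrow> g x * indicator (box l u) x"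
      by (auto intro!: tendsto_mult box_bump_tendsto)
  qed (use g gm bm im in auto)
  then show ?thesis by (simp add: orth test_fun_box_bump sub LIMSEQ_const_iff)
qed

text \<open>Localised to a box with closure in \<open>\<Omega>\<close>, the function has integral
  zero over every box of the whole space. Boxes form an intersection-stable generator, so its
  integral vanishes over every Borel set and the function is zero almost everywhere; countably many
  closed boxes then exhaust \<open>\<Omega>\<close>.\<close>

lemma orthogonal_test_fun_imp_AE_0:
  fixes g :: "'a::euclidean_space \<Rightarrow> real"
  assumes \<Omega>: "open \<Omega>" and g: "integrable (lebesgue_on \<Omega>) g"
    and orth: "\<And>\<phi>. test_fun \<Omega> \<phi> \<Longrightarrow> (\<integral>x. g x * \<phi> x \<partial>lebesgue_on \<Omega>) = 0"
  shows "AE x in lebesgue_on \<Omega>. g x = 0"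
proof -
  have \<Omega>': "\<Omega> \<inter> space lebesgue \<in> sets lebesgue" using \<Omega> by simp
  have box0: "AE x in lebesgue. x \<in> box l u \<longrightarrow> g x = 0" if sub: "cbox l u \<subseteq> \<Omega>" for l u
  proof -
    define h where "h x = indicator (box l u) x * g x" for x
    have sub': "box l u \<subseteq> \<Omega>" using sub box_subset_cbox by blast
    have hi: "integrable lebesgue h"
    proof -
      have "integrable (lebesgue_on \<Omega>) (\<lambda>x. indicator (box l u) x *\<^sub>R g x)"
      proof (rule integrable_mult_indicator[OF _ g])
        have "\<Omega> \<inter> box l u \<in> sets (lebesgue_on \<Omega>)"
          unfolding sets_restrict_space by (rule imageI) simp
        then show "box l u \<in> sets (lebesgue_on \<Omega>)" unfolding Int_absorb1[OF sub'] .
      qed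
      then have "integrable lebesgue (\<lambda>x. indicator \<Omega> x *\<^sub>R (indicator (box l u) x *\<^sub>R g x))"
        by (simp only: integrable_restrict_space[OF \<Omega>'])
      moreover have "(\<lambda>x. indicator \<Omega> x *\<^sub>R (indicator (box l u) x *\<^sub>R g x)) = h"
        using sub' by (intro ext) (auto simp: h_def indicator_def)
      ultimately show ?thesis by simp
    qed
    have hbox: "(\<integral>x. h x * indicator (box a b) x \<partial>lebesgue) = 0" for a b
    proof -
      \<comment> \<open>The intersection of the two boxes is a box whose closure still lies in
        \<open>cbox l u\<close>, so the bumps on it are admissible test functions.\<close>
      obtain a' b' where ab: "box a b \<inter> box l u = box a' b'" using box_Int_box by blast
      have "(\<integral>x. h x * indicator (box a b) x \<partial>lebesgue) = (\<integral>x. g x * indicator (box a' b') x \<partial>lebesgue_on \<Omega>)"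
        unfolding integral_restrict_space[OF \<Omega>'] using sub' ab
        by (intro Bochner_Integration.integral_cong) (auto simp: h_def indicator_def set_eq_iff)
      also have "\<dots> = 0"
      proof (cases "box a' b' = {}")
        case False
        have "box a' b' \<subseteq> cbox l u" using ab box_subset_cbox[of l u] by blast
        then have "closure (box a' b') \<subseteq> cbox l u" by (rule closure_minimal) (rule closed_cbox)
        then have "cbox a' b' \<subseteq> \<Omega>" using sub False by (simp add: closure_box)
        then show ?thesis using integral_box_eq_0[OF g orth] by blast
      qed simp
      finally show ?thesis .
    qed
    \<comment> \<open>A Borel representative, since the induction below runs over Borel sets whereas
      \<open>h\<close> is only Lebesgue measurable.\<close>
    obtain h' where h'm: "h' \<in> borel_measurable lborel" and h': "AE x in lborel. h x = h' x"
      using completion_ex_borel_measurable_real[of h lborel] hi by (auto simp: borel_measurable_integrable)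
    have h'l: "AE x in lebesgue. h x = h' x" using h' by (rule AE_completion)
    have "integrable lebesgue h'"
      using hi h'm h'l by (subst integrable_cong_AE[symmetric, of h]) (auto simp: measurable_completion)
    then have h'i: "integrable lborel h'" using integrable_completion[OF h'm] by blast
    have h'box: "(\<integral>x. indicator (box a b) x *\<^sub>R h' x \<partial>lborel) = 0" for a b
    proof -
      have "(\<integral>x. indicator (box a b) x *\<^sub>R h' x \<partial>lborel) = (\<integral>x. indicator (box a b) x *\<^sub>R h' x \<partial>lebesgue)"
        using h'm by (intro integral_completion[symmetric]) auto
      also have "\<dots> = (\<integral>x. h x * indicator (box a b) x \<partial>lebesgue)"
      proof (rule integral_cong_AE)
        have "indicat_real (box a b) \<in> borel_measurable lebesgue" by (intro borel_measurable_indicator) simp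
        then show "(\<lambda>x. h x * indicat_real (box a b) x) \<in> borel_measurable lebesgue"
          using borel_measurable_integrable[OF hi] by (intro borel_measurable_times)
        show "(\<lambda>x. indicat_real (box a b) x *\<^sub>R h' x) \<in> borel_measurable lebesgue"
          using h'm by (intro measurable_completion) auto
        show "AE x in lebesgue. indicat_real (box a b) x *\<^sub>R h' x = h x * indicat_real (box a b) x"
          using h'l by eventually_elim simp
      qed
      finally show ?thesis using hbox by simp
    qed
    have set0: "set_lebesgue_integral lborel A h' = 0" if A: "A \<in> sets lborel" for A
    proof -
      let ?G = "range (\<lambda>(a, b). box a b :: 'a set)"
      have hA: "integrable lborel (\<lambda>x. indicator A x *\<^sub>R h' x)" if "A \<in> sigma_sets UNIV ?G" for A
        using that h'i by (intro integrable_mult_indicator) (simp_all add: borel_eq_box)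
      \<comment> \<open>The complement step of the induction subtracts from the integral over the
        whole space, which must therefore vanish; growing boxes exhaust the space.\<close>
      have "(\<integral>x. h' x \<partial>lborel) = 0"
      proof -
        have "(\<lambda>n. \<integral>x. indicator (box (- (real n *\<^sub>R One)) (real n *\<^sub>R One)) x *\<^sub>R h' x \<partial>lborel) \<longlonglongrightarrow> (\<integral>x. h' x \<partial>lborel)"
        proof (rule integral_dominated_convergence[where w="\<lambda>x. norm (h' x)"])
          have "(\<lambda>n. indicator (box (- (real n *\<^sub>R One)) (real n *\<^sub>R One)) x *\<^sub>R h' x) \<longlonglongrightarrow> h' x" for x :: 'a
          proof (rule tendsto_eventually)
            obtain N where "x \<in> box (- (real N *\<^sub>R One)) (real N *\<^sub>R One)"
              using UN_box_eq_UNIV by blast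
            moreover have "box (- (real N *\<^sub>R One)) (real N *\<^sub>R One) \<subseteq> box (- (real n *\<^sub>R One)) (real n *\<^sub>R One :: 'a)" if "n \<ge> N" for n
              using that by (auto simp: mem_box) (smt (verit) of_nat_mono)+
            ultimately show "\<forall>\<^sub>F n in sequentially. indicator (box (- (real n *\<^sub>R One)) (real n *\<^sub>R One)) x *\<^sub>R h' x = h' x"
              by (intro eventually_sequentiallyI[of N]) (simp add: subset_iff)
          qed
          then show "AE x in lborel. (\<lambda>n. indicator (box (- (real n *\<^sub>R One)) (real n *\<^sub>R One)) x *\<^sub>R h' x) \<longlonglongrightarrow> h' x" by simp
        qed (use h'm h'i in \<open>auto simp: indicator_def\<close>)
        then have "0 = (\<integral>x. h' x \<partial>lborel)" by (simp only: h'box LIMSEQ_const_iff)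
        then show ?thesis by simp
      qed
      note total = this
      have "A \<in> sigma_sets UNIV ?G" using A by (simp add: borel_eq_box)
      have "Int_stable ?G" by (auto simp: Int_stable_def box_Int_box)
      moreover have "?G \<subseteq> Pow UNIV" by simp
      ultimately have "(\<integral>x. indicator A x *\<^sub>R h' x \<partial>lborel) = 0"
        using \<open>A \<in> sigma_sets UNIV ?G\<close>
      proof (induction A rule: sigma_sets_induct_disjoint)
        case (basic A)
        then show ?case using h'box by auto
      next
        case empty
        then show ?case by simp
      next
        case (compl A)
        have "(\<integral>x. indicator (UNIV - A) x *\<^sub>R h' x \<partial>lborel) = (\<integral>x. h' x - indicator A x *\<^sub>R h' x \<partial>lborel)"
          by (intro Bochner_Integration.integral_cong) (auto simp: indicator_def)
        also have "\<dots> = 0" using compl hA h'i total by simp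
        finally show ?case .
      next
        case (union A)
        have "(\<integral>x\<in>(\<Union>i. A i). h' x \<partial>lborel) = (\<Sum>i. \<integral>x\<in>A i. h' x \<partial>lborel)"
        proof (rule lebesgue_integral_countable_add)
          show "A i \<in> sets lborel" for i using union(2) by (auto simp: borel_eq_box)
          show "A i \<inter> A j = {}" if "i \<noteq> j" for i j using union(1) that by (auto simp: disjoint_family_on_def)
          have "(\<Union>i. A i) \<in> sigma_sets UNIV ?G" using union(2) by (auto intro: sigma_sets.Union)
          then show "set_integrable lborel (\<Union>i. A i) h'" unfolding set_integrable_def by (rule hA)
        qed
        then show ?case using union(3) by (simp add: set_lebesgue_integral_def)
      qed
      then show ?thesis by (simp add: set_lebesgue_integral_def)
    qed
    have "AE x in lborel. h' x = 0" by (rule density_unique_real[OF h'i, of "\<lambda>x. 0", simplified, OF set0]) simp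
    then have "AE x in lborel. h x = 0" using h' by eventually_elim simp
    then have "AE x in lebesgue. h x = 0" by (rule AE_completion)
    then show ?thesis by eventually_elim (auto simp: h_def indicator_def)
  qed
  \<comment> \<open>The countable cover consists of closed boxes, and the boundary of a box is a
    null set.\<close>
  have cbox0: "AE x in lebesgue. x \<in> cbox l u \<longrightarrow> g x = 0" if "cbox l u \<subseteq> \<Omega>" for l u
  proof -
    have "negligible (cbox l u - box l u)" by (rule negligible_frontier_interval)
    then have "cbox l u - box l u \<in> null_sets lebesgue" by (simp add: negligible_iff_null_sets)
    then have "AE x in lebesgue. x \<notin> cbox l u - box l u" by (rule AE_not_in)
    then show ?thesis using box0[OF that] by eventually_elim auto
  qed
  obtain \<D> where D: "countable \<D>" "\<D> \<subseteq> Pow \<Omega>" "\<And>X. X \<in> \<D> \<Longrightarrow> \<exists>a b. X = cbox a b" "\<Union>\<D> = \<Omega>"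
    using open_countable_Union_open_cbox[OF \<Omega>] by metis
  have "AE x in lebesgue. \<forall>X\<in>\<D>. x \<in> X \<longrightarrow> g x = 0"
    unfolding AE_ball_countable[OF D(1)]
  proof
    fix X assume "X \<in> \<D>"
    then obtain a b where "X = cbox a b" "cbox a b \<subseteq> \<Omega>" using D(2,3) by blast
    then show "AE x in lebesgue. x \<in> X \<longrightarrow> g x = 0" using cbox0 by blast
  qed
  then have "AE x in lebesgue. x \<in> \<Omega> \<longrightarrow> g x = 0" by eventually_elim (use D(4) in blast)
  then show ?thesis by (subst AE_restrict_space_iff[OF \<Omega>'])
qed

section \<open>Sobolev spaces\<close>

lemma L2D: "u \<in> L2 \<Omega> \<Longrightarrow> u \<in> borel_measurable (lebesgue_on \<Omega>)" "u \<in> L2 \<Omega> \<Longrightarrow> integrable (lebesgue_on \<Omega>) (\<lambda>x. (u x)\<^sup>2)"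
  by (auto simp: L2_def)

lemma L2_mult_integrable:
  assumes "u \<in> L2 \<Omega>" "v \<in> L2 \<Omega>"
  shows "integrable (lebesgue_on \<Omega>) (\<lambda>x. u x * v x)"
proof (rule Bochner_Integration.integrable_bound)
  show "integrable (lebesgue_on \<Omega>) (\<lambda>x. (u x)\<^sup>2 + (v x)\<^sup>2)" using assms by (auto simp: L2_def)
  show "(\<lambda>x. u x * v x) \<in> borel_measurable (lebesgue_on \<Omega>)" using assms by (auto simp: L2_def)
  have "\<bar>a * b\<bar> \<le> a\<^sup>2 + b\<^sup>2" for a b :: real
  proof -
    have "0 \<le> (\<bar>a\<bar> - \<bar>b\<bar>)\<^sup>2" by simp
    then have "2 * (\<bar>a\<bar> * \<bar>b\<bar>) \<le> a\<^sup>2 + b\<^sup>2" by (simp add: power2_diff)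
    moreover have "0 \<le> \<bar>a\<bar> * \<bar>b\<bar>" by simp
    ultimately show ?thesis unfolding abs_mult by linarith
  qed
  then show "AE x in lebesgue_on \<Omega>. norm (u x * v x) \<le> norm ((u x)\<^sup>2 + (v x)\<^sup>2)" by simp
qed

lemma L2_lincomb:
  assumes "u \<in> L2 \<Omega>" "v \<in> L2 \<Omega>"
  shows "(\<lambda>x. c * u x + d * v x) \<in> L2 \<Omega>"
proof -
  have "integrable (lebesgue_on \<Omega>) (\<lambda>x. c\<^sup>2 * (u x)\<^sup>2 + 2 * c * d * (u x * v x) + d\<^sup>2 * (v x)\<^sup>2)"
    using assms L2_mult_integrable[OF assms] by (auto simp: L2_def)
  moreover have "(c * u x + d * v x)\<^sup>2 = c\<^sup>2 * (u x)\<^sup>2 + 2 * c * d * (u x * v x) + d\<^sup>2 * (v x)\<^sup>2" for x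
    by (simp add: power2_eq_square algebra_simps)
  ultimately show ?thesis using assms by (auto simp: L2_def)
qed

lemma semi_inner_L2: "semi_inner (L2 \<Omega>) (l2_inner \<Omega>)"
proof
  show "(\<lambda>x. 0) \<in> L2 \<Omega>" by (simp add: L2_def)
  fix u v w :: "'a \<Rightarrow> real" and c d :: real
  assume u: "u \<in> L2 \<Omega>" and v: "v \<in> L2 \<Omega>"
  show "(\<lambda>x. c * u x + d * v x) \<in> L2 \<Omega>" by (rule L2_lincomb[OF u v])
  show "l2_inner \<Omega> u v = l2_inner \<Omega> v u" by (simp add: l2_inner_def mult.commute)
  assume w: "w \<in> L2 \<Omega>"
  have "l2_inner \<Omega> (\<lambda>x. c * u x + d * v x) w = (\<integral>x. c * (u x * w x) + d * (v x * w x) \<partial>lebesgue_on \<Omega>)"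
    unfolding l2_inner_def by (simp add: algebra_simps)
  also have "\<dots> = c * l2_inner \<Omega> u w + d * l2_inner \<Omega> v w"
    using L2_mult_integrable[OF u w] L2_mult_integrable[OF v w] by (simp add: l2_inner_def)
  finally show "l2_inner \<Omega> (\<lambda>x. c * u x + d * v x) w = c * l2_inner \<Omega> u w + d * l2_inner \<Omega> v w" .
next
  show "0 \<le> l2_inner \<Omega> u u" for u by (simp add: l2_inner_def)
qed

definition L2vec :: "'a::euclidean_space set \<Rightarrow> ('a \<Rightarrow> 'a) set" where
  "L2vec \<Omega> = {g. g \<in> borel_measurable (lebesgue_on \<Omega>) \<and> integrable (lebesgue_on \<Omega>) (\<lambda>x. (norm (g x))\<^sup>2)}"

lemma L2vec_component:
  assumes "g \<in> L2vec \<Omega>" "b \<in> Basis"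
  shows "(\<lambda>x. g x \<bullet> b) \<in> L2 \<Omega>"
proof -
  have "integrable (lebesgue_on \<Omega>) (\<lambda>x. (g x \<bullet> b)\<^sup>2)"
  proof (rule Bochner_Integration.integrable_bound)
    show "integrable (lebesgue_on \<Omega>) (\<lambda>x. (norm (g x))\<^sup>2)" using assms by (simp add: L2vec_def)
    show "(\<lambda>x. (g x \<bullet> b)\<^sup>2) \<in> borel_measurable (lebesgue_on \<Omega>)" using assms by (auto simp: L2vec_def)
    have "(g x \<bullet> b)\<^sup>2 \<le> (norm (g x))\<^sup>2" for x
      using Basis_le_norm[OF assms(2), of "g x"] by (simp add: power2_le_iff_abs_le)
    then show "AE x in lebesgue_on \<Omega>. norm ((g x \<bullet> b)\<^sup>2) \<le> norm ((norm (g x))\<^sup>2)" by simp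
  qed
  then show ?thesis using assms by (auto simp: L2vec_def L2_def)
qed

lemma L2vec_inner_integrable:
  assumes "g \<in> L2vec \<Omega>" "h \<in> L2vec \<Omega>"
  shows "integrable (lebesgue_on \<Omega>) (\<lambda>x. g x \<bullet> h x)"
  unfolding euclidean_inner[of "g _" "h _"]
  by (intro Bochner_Integration.integrable_sum L2_mult_integrable L2vec_component assms)

lemma L2vec_lincomb:
  assumes "g \<in> L2vec \<Omega>" "h \<in> L2vec \<Omega>"
  shows "(\<lambda>x. c *\<^sub>R g x + d *\<^sub>R h x) \<in> L2vec \<Omega>"
proof -
  have "integrable (lebesgue_on \<Omega>) (\<lambda>x. c\<^sup>2 * (norm (g x))\<^sup>2 + 2 * c * d * (g x \<bullet> h x) + d\<^sup>2 * (norm (h x))\<^sup>2)"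
    using assms L2vec_inner_integrable[OF assms] by (auto simp: L2vec_def)
  moreover have "(norm (c *\<^sub>R g x + d *\<^sub>R h x))\<^sup>2 = c\<^sup>2 * (norm (g x))\<^sup>2 + 2 * c * d * (g x \<bullet> h x) + d\<^sup>2 * (norm (h x))\<^sup>2" for x
    unfolding power2_norm_eq_inner by (simp add: inner_add_left inner_add_right inner_commute power2_eq_square algebra_simps)
  ultimately show ?thesis using assms by (auto simp: L2vec_def)
qed

lemma is_weak_grad_alt:
  "is_weak_grad \<Omega> u g \<longleftrightarrow> g \<in> L2vec \<Omega> \<and> (\<forall>\<phi>. test_fun \<Omega> \<phi> \<longrightarrow> (\<forall>b\<in>Basis.
      l2_inner \<Omega> u (\<lambda>x. frechet_derivative \<phi> (at x) b) = - l2_inner \<Omega> (\<lambda>x. g x \<bullet> b) \<phi>))"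
  by (auto simp: is_weak_grad_def L2vec_def l2_inner_def)

section \<open>Weak gradients and the Dirichlet form on a bounded open set\<close>

locale bounded_open =
  fixes \<Omega> :: "'a::euclidean_space set"
  assumes open_\<Omega>: "open \<Omega>" and bounded_\<Omega>: "bounded \<Omega>"
begin

lemma lmeasurable_\<Omega>: "\<Omega> \<in> lmeasurable"
  using open_\<Omega> bounded_\<Omega> lmeasurable_open by blast

lemma finite_measure_\<Omega>: "finite_measure (lebesgue_on \<Omega>)"
  by (rule finite_measure_lebesgue_on[OF lmeasurable_\<Omega>])

lemma const_L2: "(\<lambda>x. c) \<in> L2 \<Omega>"
  using finite_measure_\<Omega> by (simp add: L2_def finite_measure.integrable_const)

lemma L2_integrable: "u \<in> L2 \<Omega> \<Longrightarrow> integrable (lebesgue_on \<Omega>) u"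
  using L2_mult_integrable[of u \<Omega> "\<lambda>x. 1"] const_L2 by simp

sublocale l2: semi_inner "L2 \<Omega>" "l2_inner \<Omega>"
  by (rule semi_inner_L2)

lemma continuous_compact_support_L2:
  assumes "continuous_on UNIV f" "compact K" "\<And>x. x \<notin> K \<Longrightarrow> f x = 0" "K \<subseteq> \<Omega>"
  shows "f \<in> L2 \<Omega>" "integral\<^sup>L (lebesgue_on \<Omega>) f = integral\<^sup>L lborel f"
proof -
  have m: "f \<in> borel_measurable borel" by (rule borel_measurable_continuous_onI[OF assms(1)])
  have "continuous_on UNIV (\<lambda>x. (f x)\<^sup>2)" by (intro continuous_intros assms)
  then have "integrable lborel (\<lambda>x. (f x)\<^sup>2)"
    using assms by (intro integrable_continuous_compact_support[of _ K]) auto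
  then have "integrable (lebesgue_on \<Omega>) (\<lambda>x. (f x)\<^sup>2)"
    using m assms by (subst lebesgue_on_eq_lborel(1)[OF open_\<Omega>]) auto
  moreover have "f \<in> borel_measurable (lebesgue_on \<Omega>)"
    using m by (intro measurable_restrict_space1) (simp add: measurable_completion)
  ultimately show "f \<in> L2 \<Omega>" by (simp add: L2_def)
  show "integral\<^sup>L (lebesgue_on \<Omega>) f = integral\<^sup>L lborel f"
    using m assms by (intro lebesgue_on_eq_lborel(2)[OF open_\<Omega>]) auto
qed

lemma test_fun_L2:
  assumes "test_fun \<Omega> \<phi>"
  shows "\<phi> \<in> L2 \<Omega>" "b \<in> Basis \<Longrightarrow> (\<lambda>x. frechet_derivative \<phi> (at x) b) \<in> L2 \<Omega>"
proof -
  obtain K where "compact K" "K \<subseteq> \<Omega>" "\<And>x. x \<notin> K \<Longrightarrow> \<phi> x = 0 \<and> frechet_derivative \<phi> (at x) = (\<lambda>h. 0)"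
    using test_funD(4)[OF assms] by blast
  then show "\<phi> \<in> L2 \<Omega>" "b \<in> Basis \<Longrightarrow> (\<lambda>x. frechet_derivative \<phi> (at x) b) \<in> L2 \<Omega>"
    using test_funD(2,3)[OF assms] continuous_compact_support_L2(1)[of _ K] by auto
qed

lemma weak_grad_lincomb:
  assumes u: "u \<in> L2 \<Omega>" "is_weak_grad \<Omega> u g" and v: "v \<in> L2 \<Omega>" "is_weak_grad \<Omega> v h"
  shows "is_weak_grad \<Omega> (\<lambda>x. c * u x + d * v x) (\<lambda>x. c *\<^sub>R g x + d *\<^sub>R h x)"
  unfolding is_weak_grad_alt
proof (intro conjI allI impI ballI)
  have g: "g \<in> L2vec \<Omega>" and h: "h \<in> L2vec \<Omega>" using u v by (auto simp: is_weak_grad_alt)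
  show "(\<lambda>x. c *\<^sub>R g x + d *\<^sub>R h x) \<in> L2vec \<Omega>" by (rule L2vec_lincomb[OF g h])
  fix \<phi> and b :: 'a assume \<phi>: "test_fun \<Omega> \<phi>" and b: "b \<in> Basis"
  have "l2_inner \<Omega> (\<lambda>x. (c *\<^sub>R g x + d *\<^sub>R h x) \<bullet> b) \<phi> = c * l2_inner \<Omega> (\<lambda>x. g x \<bullet> b) \<phi> + d * l2_inner \<Omega> (\<lambda>x. h x \<bullet> b) \<phi>"
    using l2.lincomb_left[OF L2vec_component[OF g b] L2vec_component[OF h b] test_fun_L2(1)[OF \<phi>], of c d]
    by (simp add: inner_add_left)
  moreover have "l2_inner \<Omega> (\<lambda>x. c * u x + d * v x) (\<lambda>x. frechet_derivative \<phi> (at x) b) =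
      c * l2_inner \<Omega> u (\<lambda>x. frechet_derivative \<phi> (at x) b) + d * l2_inner \<Omega> v (\<lambda>x. frechet_derivative \<phi> (at x) b)"
    by (rule l2.lincomb_left[OF u(1) v(1) test_fun_L2(2)[OF \<phi> b]])
  ultimately show "l2_inner \<Omega> (\<lambda>x. c * u x + d * v x) (\<lambda>x. frechet_derivative \<phi> (at x) b) =
      - l2_inner \<Omega> (\<lambda>x. (c *\<^sub>R g x + d *\<^sub>R h x) \<bullet> b) \<phi>"
    using u(2) v(2) \<phi> b by (simp add: is_weak_grad_alt)
qed

text \<open>In each coordinate the difference is orthogonal to all test functions. Boundedness of
  \<open>\<Omega>\<close> puts it in L1, where the fundamental lemma applies.\<close>

lemma weak_grad_unique:
  assumes "is_weak_grad \<Omega> u g" "is_weak_grad \<Omega> u h"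
  shows "AE x in lebesgue_on \<Omega>. g x = h x"
proof -
  have g: "g \<in> L2vec \<Omega>" and h: "h \<in> L2vec \<Omega>" using assms by (auto simp: is_weak_grad_alt)
  have "AE x in lebesgue_on \<Omega>. g x \<bullet> b - h x \<bullet> b = 0" if b: "b \<in> Basis" for b
  proof (rule orthogonal_test_fun_imp_AE_0[OF open_\<Omega>])
    note gb = L2vec_component[OF g b] and hb = L2vec_component[OF h b]
    show "integrable (lebesgue_on \<Omega>) (\<lambda>x. g x \<bullet> b - h x \<bullet> b)"
      by (rule L2_integrable[OF l2.diff_mem[OF gb hb]])
    fix \<phi> assume \<phi>: "test_fun \<Omega> \<phi>"
    have "l2_inner \<Omega> (\<lambda>x. g x \<bullet> b - h x \<bullet> b) \<phi> = 0"
      using l2.diff_left[OF gb hb test_fun_L2(1)[OF \<phi>]] assms \<phi> b by (auto simp: is_weak_grad_alt)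
    then show "(\<integral>x. (g x \<bullet> b - h x \<bullet> b) * \<phi> x \<partial>lebesgue_on \<Omega>) = 0" by (simp add: l2_inner_def)
  qed
  then have "AE x in lebesgue_on \<Omega>. \<forall>b\<in>Basis. g x \<bullet> b - h x \<bullet> b = 0"
    by (intro AE_finite_allI) auto
  then show ?thesis by eventually_elim (auto intro: euclidean_eqI)
qed

lemma H1D: "u \<in> H1 \<Omega> \<Longrightarrow> u \<in> L2 \<Omega>" "u \<in> H1 \<Omega> \<Longrightarrow> is_weak_grad \<Omega> u (wgrad \<Omega> u)"
  "u \<in> H1 \<Omega> \<Longrightarrow> wgrad \<Omega> u \<in> L2vec \<Omega>"
proof -
  show "u \<in> H1 \<Omega> \<Longrightarrow> u \<in> L2 \<Omega>" by (simp add: H1_def)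
  show *: "u \<in> H1 \<Omega> \<Longrightarrow> is_weak_grad \<Omega> u (wgrad \<Omega> u)"
    unfolding wgrad_def H1_def using someI_ex[of "is_weak_grad \<Omega> u"] by simp
  then show "u \<in> H1 \<Omega> \<Longrightarrow> wgrad \<Omega> u \<in> L2vec \<Omega>" by (simp add: is_weak_grad_alt)
qed

text \<open>\<open>wgrad\<close> picks an arbitrary representative for each function separately, so
  its linearity is a consequence of uniqueness and holds only almost everywhere; integrals do not
  see the difference.\<close>

lemma H1_lincomb:
  assumes "u \<in> H1 \<Omega>" "v \<in> H1 \<Omega>"
  shows "(\<lambda>x. c * u x + d * v x) \<in> H1 \<Omega>"
    "AE x in lebesgue_on \<Omega>. wgrad \<Omega> (\<lambda>x. c * u x + d * v x) x = c *\<^sub>R wgrad \<Omega> u x + d *\<^sub>R wgrad \<Omega> v x"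
proof -
  note w = weak_grad_lincomb[OF H1D(1,2)[OF assms(1)] H1D(1,2)[OF assms(2)], of c d]
  show m: "(\<lambda>x. c * u x + d * v x) \<in> H1 \<Omega>"
    using w L2_lincomb[OF H1D(1)[OF assms(1)] H1D(1)[OF assms(2)]] by (auto simp: H1_def)
  show "AE x in lebesgue_on \<Omega>. wgrad \<Omega> (\<lambda>x. c * u x + d * v x) x = c *\<^sub>R wgrad \<Omega> u x + d *\<^sub>R wgrad \<Omega> v x"
    by (rule weak_grad_unique[OF H1D(2)[OF m] w])
qed

text \<open>The Dirichlet form, polarising \<open>grad_sq\<close>.\<close>

definition dir :: "('a \<Rightarrow> real) \<Rightarrow> ('a \<Rightarrow> real) \<Rightarrow> real" where
  "dir u v = (\<integral>x. wgrad \<Omega> u x \<bullet> wgrad \<Omega> v x \<partial>lebesgue_on \<Omega>)"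

lemma grad_sq_eq_dir: "grad_sq \<Omega> u = dir u u"
  by (simp add: grad_sq_def dir_def power2_norm_eq_inner)

lemma dir_integrable: "u \<in> H1 \<Omega> \<Longrightarrow> v \<in> H1 \<Omega> \<Longrightarrow> integrable (lebesgue_on \<Omega>) (\<lambda>x. wgrad \<Omega> u x \<bullet> wgrad \<Omega> v x)"
  by (intro L2vec_inner_integrable H1D)

lemma zero_H1: "(\<lambda>x. 0) \<in> H1 \<Omega>"
proof -
  have "is_weak_grad \<Omega> (\<lambda>x. 0) (\<lambda>x. 0)" by (simp add: is_weak_grad_def)
  then show ?thesis using l2.zero_mem by (auto simp: H1_def)
qed

lemma dir_lincomb:
  assumes u: "u \<in> H1 \<Omega>" and v: "v \<in> H1 \<Omega>" and w: "w \<in> H1 \<Omega>"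
  shows "dir (\<lambda>x. c * u x + d * v x) w = c * dir u w + d * dir v w"
proof -
  have "dir (\<lambda>x. c * u x + d * v x) w = (\<integral>x. c * (wgrad \<Omega> u x \<bullet> wgrad \<Omega> w x) + d * (wgrad \<Omega> v x \<bullet> wgrad \<Omega> w x) \<partial>lebesgue_on \<Omega>)"
    unfolding dir_def
  proof (rule integral_cong_AE)
    show "(\<lambda>x. wgrad \<Omega> (\<lambda>x. c * u x + d * v x) x \<bullet> wgrad \<Omega> w x) \<in> borel_measurable (lebesgue_on \<Omega>)"
      by (rule borel_measurable_integrable[OF dir_integrable[OF H1_lincomb(1)[OF u v] w]])
    show "(\<lambda>x. c * (wgrad \<Omega> u x \<bullet> wgrad \<Omega> w x) + d * (wgrad \<Omega> v x \<bullet> wgrad \<Omega> w x)) \<in> borel_measurable (lebesgue_on \<Omega>)"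
      using borel_measurable_integrable[OF dir_integrable[OF u w]] borel_measurable_integrable[OF dir_integrable[OF v w]] by simp
    show "AE x in lebesgue_on \<Omega>. wgrad \<Omega> (\<lambda>x. c * u x + d * v x) x \<bullet> wgrad \<Omega> w x =
        c * (wgrad \<Omega> u x \<bullet> wgrad \<Omega> w x) + d * (wgrad \<Omega> v x \<bullet> wgrad \<Omega> w x)"
      using H1_lincomb(2)[OF u v, of c d] by eventually_elim (simp add: inner_add_left)
  qed
  then show ?thesis using dir_integrable[OF u w] dir_integrable[OF v w] by (simp add: dir_def)
qed

lemma semi_inner_dir: "semi_inner (H1 \<Omega>) dir"
proof
  show "dir u v = dir v u" for u v by (simp add: dir_def inner_commute)
  show "0 \<le> dir u u" for u by (simp add: dir_def)
qed (simp_all add: zero_H1 H1_lincomb(1) dir_lincomb)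

definition h1 :: "('a \<Rightarrow> real) \<Rightarrow> ('a \<Rightarrow> real) \<Rightarrow> real" where
  "h1 u v = l2_inner \<Omega> u v + dir u v"

sublocale d: semi_inner "H1 \<Omega>" dir
  by (rule semi_inner_dir)

sublocale h: semi_inner "H1 \<Omega>" h1
proof
  fix u v w :: "'a \<Rightarrow> real" and c d
  assume u: "u \<in> H1 \<Omega>" and v: "v \<in> H1 \<Omega>"
  show "(\<lambda>x. c * u x + d * v x) \<in> H1 \<Omega>" by (rule H1_lincomb(1)[OF u v])
  show "h1 u v = h1 v u" using l2.sym d.sym u v H1D(1) by (simp add: h1_def)
  assume w: "w \<in> H1 \<Omega>"
  show "h1 (\<lambda>x. c * u x + d * v x) w = c * h1 u w + d * h1 v w"
    using l2.lincomb_left[OF u[THEN H1D(1)] v[THEN H1D(1)] w[THEN H1D(1)], of c d] dir_lincomb[OF u v w, of c d]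
    by (simp add: h1_def algebra_simps)
next
  show "0 \<le> h1 u u" if "u \<in> H1 \<Omega>" for u
    using l2.nonneg[OF H1D(1)[OF that]] d.nonneg[OF that] by (simp add: h1_def)
qed (rule zero_H1)

lemma h1_norm_eq: "h1_norm \<Omega> u = h.nrm u"
  unfolding h1_norm_def h.nrm_def h1_def l2_inner_def dir_def power2_norm_eq_inner
  by (simp add: power2_eq_square)

lemma l2_nrm_le: "u \<in> H1 \<Omega> \<Longrightarrow> l2.nrm u \<le> h.nrm u"
  using d.nonneg by (simp add: l2.nrm_def h.nrm_def h1_def)

lemma d_nrm_le: "u \<in> H1 \<Omega> \<Longrightarrow> d.nrm u \<le> h.nrm u"
  using l2.nonneg[OF H1D(1)] by (simp add: d.nrm_def h.nrm_def h1_def)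

end

section \<open>Completeness of L2 for vector-valued functions\<close>

text \<open>On a finite measure space an L2-Cauchy sequence is L1-Cauchy, so a subsequence converges
  almost everywhere. Fatou's lemma along that subsequence turns the Cauchy bound into a bound on the
  distance to the limit.\<close>

lemma (in finite_measure) L2_complete:
  fixes s :: "nat \<Rightarrow> 'a \<Rightarrow> 'b::euclidean_space"
  assumes meas [measurable]: "\<And>n. s n \<in> borel_measurable M"
    and int: "\<And>n. integrable M (\<lambda>x. (norm (s n x))\<^sup>2)"
    and cauchy: "\<And>e. e > 0 \<Longrightarrow> \<exists>N. \<forall>i\<ge>N. \<forall>j\<ge>N. (\<integral>x. (norm (s i x - s j x))\<^sup>2 \<partial>M) < e"
  obtains g where "g \<in> borel_measurable M" "integrable M (\<lambda>x. (norm (g x))\<^sup>2)"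
    "\<And>n. integrable M (\<lambda>x. (norm (s n x - g x))\<^sup>2)"
    "(\<lambda>n. \<integral>x. (norm (s n x - g x))\<^sup>2 \<partial>M) \<longlonglongrightarrow> 0"
proof -
  have sq_diff: "(norm (a - b))\<^sup>2 \<le> 2 * (norm a)\<^sup>2 + 2 * (norm b)\<^sup>2" for a b :: 'b
  proof -
    have "(norm (a - b))\<^sup>2 \<le> (norm a + norm b)\<^sup>2" by (intro power_mono norm_triangle_ineq4) simp
    also have "\<dots> \<le> 2 * (norm a)\<^sup>2 + 2 * (norm b)\<^sup>2"
      using zero_le_power2[of "norm a - norm b"] by (simp add: power2_sum power2_diff)
    finally show ?thesis .
  qed
  have int_diff: "integrable M (\<lambda>x. (norm (p x - q x))\<^sup>2)"
    if [measurable]: "p \<in> borel_measurable M" "q \<in> borel_measurable M"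
      and "integrable M (\<lambda>x. (norm (p x))\<^sup>2)" "integrable M (\<lambda>x. (norm (q x))\<^sup>2)" for p q :: "'a \<Rightarrow> 'b"
  proof (rule Bochner_Integration.integrable_bound)
    show "integrable M (\<lambda>x. 2 * (norm (p x))\<^sup>2 + 2 * (norm (q x))\<^sup>2)" using that by simp
    show "AE x in M. norm ((norm (p x - q x))\<^sup>2) \<le> norm (2 * (norm (p x))\<^sup>2 + 2 * (norm (q x))\<^sup>2)"
      using sq_diff by simp
  qed measurable
  \<comment> \<open>Values up to \<open>d\<close> are absorbed by the constant, larger ones by the
    square. Integrated with a free \<open>d\<close>, this replaces Cauchy-Schwarz in passing from L2
    to L1.\<close>
  have ptw: "norm a \<le> d + (norm a)\<^sup>2 / d" if "d > 0" for a :: 'b and d :: real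
  proof (cases "norm a \<le> d")
    case True
    have "0 \<le> (norm a)\<^sup>2 / d" using that by simp
    then show ?thesis using True by linarith
  next
    case False
    then have "d * norm a \<le> (norm a)\<^sup>2" by (simp add: power2_eq_square mult_right_mono)
    then have "norm a \<le> (norm a)\<^sup>2 / d" using that by (simp add: field_simps)
    then show ?thesis using that by linarith
  qed
  have int1: "integrable M (s n)" for n
  proof (rule Bochner_Integration.integrable_bound)
    show "integrable M (\<lambda>x. 1 + (norm (s n x))\<^sup>2)" using int by simp
    show "AE x in M. norm (s n x) \<le> norm (1 + (norm (s n x))\<^sup>2)" using ptw[of 1 "s n _"] by simp
  qed measurable
  have cauchy1: "\<exists>N. \<forall>i\<ge>N. \<forall>j\<ge>N. (\<integral>x. norm (s i x - s j x) \<partial>M) < e" if e: "e > 0" for e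
  proof -
    define \<mu> where "\<mu> = measure M (space M)"
    have \<mu>: "\<mu> \<ge> 0" by (simp add: \<mu>_def)
    \<comment> \<open>Makes the constant part \<open>\<mu> * d\<close> at most \<open>e / 2\<close>;
      the added 1 keeps the denominator positive for measure zero. The threshold
      \<open>d * (e / 2)\<close> below then handles the square part.\<close>
    define d where "d = e / (2 * (\<mu> + 1))"
    have d: "d > 0" using e \<mu> by (simp add: d_def)
    obtain N where N: "\<And>i j. i \<ge> N \<Longrightarrow> j \<ge> N \<Longrightarrow> (\<integral>x. (norm (s i x - s j x))\<^sup>2 \<partial>M) < d * (e / 2)"
      using cauchy[of "d * (e / 2)"] d e by auto
    have "(\<integral>x. norm (s i x - s j x) \<partial>M) < e" if "i \<ge> N" "j \<ge> N" for i j
    proof -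
      have ij: "integrable M (\<lambda>x. (norm (s i x - s j x))\<^sup>2)" by (rule int_diff[OF meas meas int int])
      have "(\<integral>x. norm (s i x - s j x) \<partial>M) \<le> (\<integral>x. d + (norm (s i x - s j x))\<^sup>2 / d \<partial>M)"
        using int1 ij ptw[OF d] by (intro integral_mono) auto
      also have "\<dots> = \<mu> * d + (\<integral>x. (norm (s i x - s j x))\<^sup>2 \<partial>M) / d"
        using ij by (simp add: \<mu>_def)
      also have "\<dots> < e / 2 + e / 2"
      proof (rule add_le_less_mono)
        show "\<mu> * d \<le> e / 2" using e \<mu> by (simp add: d_def field_simps)
        show "(\<integral>x. (norm (s i x - s j x))\<^sup>2 \<partial>M) / d < e / 2" using N[OF that] d by (simp add: field_simps)
      qed
      finally show ?thesis by simp
    qed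
    then show ?thesis by blast
  qed
  obtain r where r: "strict_mono r" and rC: "AE x in M. Cauchy (\<lambda>i. s (r i) x)"
    using cauchy_L1_AE_cauchy_subseq[of M s, OF int1 cauchy1] by blast
  define g where "g x = lim (\<lambda>i. s (r i) x)" for x
  have gm [measurable]: "g \<in> borel_measurable M" unfolding g_def by (rule borel_measurable_lim_metric) (rule meas)
  have glim: "AE x in M. (\<lambda>i. s (r i) x) \<longlonglongrightarrow> g x"
    using rC by eventually_elim (simp add: g_def Cauchy_convergent_iff convergent_LIMSEQ_iff)
  have fatou: "(\<integral>\<^sup>+x. ennreal ((norm (s n x - g x))\<^sup>2) \<partial>M) \<le> ennreal e"
    if N: "\<And>i j. i \<ge> N \<Longrightarrow> j \<ge> N \<Longrightarrow> (\<integral>x. (norm (s i x - s j x))\<^sup>2 \<partial>M) < e" and n: "n \<ge> N" for e N n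
  proof -
    have "(\<integral>\<^sup>+x. ennreal ((norm (s n x - g x))\<^sup>2) \<partial>M) = (\<integral>\<^sup>+x. liminf (\<lambda>k. ennreal ((norm (s n x - s (r k) x))\<^sup>2)) \<partial>M)"
    proof (rule nn_integral_cong_AE)
      show "AE x in M. ennreal ((norm (s n x - g x))\<^sup>2) = liminf (\<lambda>k. ennreal ((norm (s n x - s (r k) x))\<^sup>2))"
        using glim
      proof eventually_elim
        case (elim x)
        have "(\<lambda>k. ennreal ((norm (s n x - s (r k) x))\<^sup>2)) \<longlonglongrightarrow> ennreal ((norm (s n x - g x))\<^sup>2)"
          by (intro tendsto_ennrealI tendsto_intros elim)
        then show ?case using lim_imp_Liminf[OF sequentially_bot] by metis
      qed
    qed
    also have "\<dots> \<le> liminf (\<lambda>k. \<integral>\<^sup>+x. ennreal ((norm (s n x - s (r k) x))\<^sup>2) \<partial>M)"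
      by (rule nn_integral_liminf) measurable
    also have "\<dots> \<le> limsup (\<lambda>k. \<integral>\<^sup>+x. ennreal ((norm (s n x - s (r k) x))\<^sup>2) \<partial>M)"
      by (rule Liminf_le_Limsup) simp
    also have "\<dots> \<le> ennreal e"
    proof (rule Limsup_bounded)
      show "\<forall>\<^sub>F k in sequentially. (\<integral>\<^sup>+x. ennreal ((norm (s n x - s (r k) x))\<^sup>2) \<partial>M) \<le> ennreal e"
      proof (rule eventually_sequentiallyI[of N])
        fix k assume "N \<le> k"
        then have k: "N \<le> r k" using seq_suble[OF r, of k] by linarith
        have "(\<integral>\<^sup>+x. ennreal ((norm (s n x - s (r k) x))\<^sup>2) \<partial>M) = ennreal (\<integral>x. (norm (s n x - s (r k) x))\<^sup>2 \<partial>M)"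
          by (intro nn_integral_eq_integral int_diff meas int) simp
        also have "\<dots> \<le> ennreal e" using N[OF n k] by (intro ennreal_leI) simp
        finally show "(\<integral>\<^sup>+x. ennreal ((norm (s n x - s (r k) x))\<^sup>2) \<partial>M) \<le> ennreal e" .
      qed
    qed
    finally show ?thesis .
  qed
  have int_g: "integrable M (\<lambda>x. (norm (g x))\<^sup>2)"
  proof -
    obtain N where N: "\<And>i j. i \<ge> N \<Longrightarrow> j \<ge> N \<Longrightarrow> (\<integral>x. (norm (s i x - s j x))\<^sup>2 \<partial>M) < 1"
      using cauchy[of 1] by auto
    have i1: "integrable M (\<lambda>x. (norm (s N x - g x))\<^sup>2)"
    proof (rule integrableI_bounded)
      show "(\<integral>\<^sup>+x. ennreal (norm ((norm (s N x - g x))\<^sup>2)) \<partial>M) < \<infinity>"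
        using fatou[of N 1 N, OF N] by (simp add: order_le_less_trans)
    qed measurable
    have "integrable M (\<lambda>x. 2 * (norm (s N x))\<^sup>2 + 2 * (norm (s N x - g x))\<^sup>2)" using i1 int by simp
    then show ?thesis
    proof (rule Bochner_Integration.integrable_bound)
      show "AE x in M. norm ((norm (g x))\<^sup>2) \<le> norm (2 * (norm (s N x))\<^sup>2 + 2 * (norm (s N x - g x))\<^sup>2)"
      proof (rule AE_I2)
        show "norm ((norm (g x))\<^sup>2) \<le> norm (2 * (norm (s N x))\<^sup>2 + 2 * (norm (s N x - g x))\<^sup>2)" for x
          using sq_diff[of "s N x" "s N x - g x"] by simp
      qed
    qed measurable
  qed
  have int_sg: "integrable M (\<lambda>x. (norm (s n x - g x))\<^sup>2)" for n
    by (rule int_diff[OF meas gm int int_g])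
  have lim: "(\<lambda>n. \<integral>x. (norm (s n x - g x))\<^sup>2 \<partial>M) \<longlonglongrightarrow> 0"
  proof (rule LIMSEQ_I)
    fix e :: real assume e: "0 < e"
    obtain N where N: "\<And>i j. i \<ge> N \<Longrightarrow> j \<ge> N \<Longrightarrow> (\<integral>x. (norm (s i x - s j x))\<^sup>2 \<partial>M) < e / 2"
      using cauchy[of "e / 2"] e by auto
    have "norm ((\<integral>x. (norm (s n x - g x))\<^sup>2 \<partial>M) - 0) < e" if "n \<ge> N" for n
    proof -
      have "ennreal (\<integral>x. (norm (s n x - g x))\<^sup>2 \<partial>M) \<le> ennreal (e / 2)"
        using fatou[of N "e / 2" n, OF N that] nn_integral_eq_integral[OF int_sg[of n]] by simp
      then have "(\<integral>x. (norm (s n x - g x))\<^sup>2 \<partial>M) \<le> e / 2" using e by simp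
      moreover have "0 \<le> (\<integral>x. (norm (s n x - g x))\<^sup>2 \<partial>M)" by simp
      ultimately show ?thesis using e by simp
    qed
    then show "\<exists>N. \<forall>n\<ge>N. norm ((\<integral>x. (norm (s n x - g x))\<^sup>2 \<partial>M) - 0) < e" by blast
  qed
  show thesis by (rule that[OF gm int_g int_sg lim])
qed

section \<open>Test functions: integration by parts and the Poincare inequality\<close>

lemma smooth_fun_lincomb: "smooth_fun f \<Longrightarrow> smooth_fun g \<Longrightarrow> smooth_fun (\<lambda>x. c * f x + d * g x)"
  by (intro smooth_ring_imp_smooth_fun smooth_ring.add smooth_ring.mult)
     (simp_all add: smooth_ring.base smooth_fun_const)

lemma test_fun_zero: "test_fun \<Omega> (\<lambda>x. 0)"
  by (simp add: test_fun_def smooth_fun_const)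

lemma test_fun_lincomb:
  assumes "test_fun \<Omega> f" "test_fun \<Omega> g"
  shows "test_fun \<Omega> (\<lambda>x. c * f x + d * g x)"
proof -
  let ?K = "closure {x. f x \<noteq> 0} \<union> closure {x. g x \<noteq> 0}"
  have K: "compact ?K" "?K \<subseteq> \<Omega>" using assms by (auto simp: test_fun_def)
  have "{x. c * f x + d * g x \<noteq> 0} \<subseteq> ?K"
  proof
    fix x assume "x \<in> {x. c * f x + d * g x \<noteq> 0}"
    then have "f x \<noteq> 0 \<or> g x \<noteq> 0" by auto
    then show "x \<in> ?K"
      using closure_subset[of "{x. f x \<noteq> 0}"] closure_subset[of "{x. g x \<noteq> 0}"] by blast
  qed
  then have sub: "closure {x. c * f x + d * g x \<noteq> 0} \<subseteq> ?K"
    by (rule closure_minimal) (intro closed_Un closed_closure)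
  moreover have "compact (closure {x. c * f x + d * g x \<noteq> 0})"
    using bounded_subset[OF compact_imp_bounded[OF K(1)] sub] by (simp add: compact_eq_bounded_closed)
  ultimately show ?thesis using assms K(2) by (auto simp: test_fun_def intro: smooth_fun_lincomb)
qed

context bounded_open
begin

text \<open>The derivative of the product of the two functions has compact support in
  \<open>\<Omega>\<close>, so its integral over the whole space is zero.\<close>

lemma test_fun_by_parts:
  assumes \<phi>: "test_fun \<Omega> \<phi>" and \<psi>: "test_fun \<Omega> \<psi>" and b: "b \<in> Basis"
  shows "l2_inner \<Omega> \<phi> (\<lambda>x. frechet_derivative \<psi> (at x) b) = - l2_inner \<Omega> (\<lambda>x. frechet_derivative \<phi> (at x) b) \<psi>"
proof -
  define f' where "f' x = \<phi> x * frechet_derivative \<psi> (at x) b + frechet_derivative \<phi> (at x) b * \<psi> x" for x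
  obtain K where K: "compact K" "K \<subseteq> \<Omega>" "\<And>x. x \<notin> K \<Longrightarrow> \<phi> x = 0 \<and> frechet_derivative \<phi> (at x) = (\<lambda>h. 0)"
    using test_funD(4)[OF \<phi>] by blast
  have f'_cont: "continuous_on UNIV f'" unfolding f'_def
    by (intro continuous_intros test_funD(2,3)[OF \<phi>] test_funD(2,3)[OF \<psi>] b)
  have "(\<integral>x. f' x \<partial>lborel) = 0"
  proof (rule integral_directional_derivative_0[where f="\<lambda>x. \<phi> x * \<psi> x" and b=b and K=K])
    show "((\<lambda>t. \<phi> (x + t *\<^sub>R b) * \<psi> (x + t *\<^sub>R b)) has_real_derivative f' x) (at 0)" for x
      using DERIV_mult[OF smooth_fun_has_line_derivative[OF test_funD(1)[OF \<phi>]] smooth_fun_has_line_derivative[OF test_funD(1)[OF \<psi>]], of x b x b]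
      by (simp add: f'_def algebra_simps)
    show "continuous_on UNIV (\<lambda>x. \<phi> x * \<psi> x)" by (intro continuous_intros test_funD(2)[OF \<phi>] test_funD(2)[OF \<psi>])
  qed (use K b f'_cont in \<open>auto simp: f'_def\<close>)
  moreover have "f' x = 0" if "x \<notin> K" for x using K(3)[OF that] by (simp add: f'_def)
  ultimately have "(\<integral>x. f' x \<partial>lebesgue_on \<Omega>) = 0"
    using continuous_compact_support_L2(2)[OF f'_cont K(1) _ K(2)] by simp
  moreover have "(\<integral>x. f' x \<partial>lebesgue_on \<Omega>) = l2_inner \<Omega> \<phi> (\<lambda>x. frechet_derivative \<psi> (at x) b)
      + l2_inner \<Omega> (\<lambda>x. frechet_derivative \<phi> (at x) b) \<psi>"
    unfolding f'_def l2_inner_def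
    by (intro Bochner_Integration.integral_add L2_mult_integrable test_fun_L2 \<phi> \<psi> b)
  ultimately show ?thesis by simp
qed

text \<open>The classical gradient. It gives test functions a gradient with known values, while
  \<open>wgrad\<close> is a choice without a pointwise description.\<close>

definition cgrad :: "('a \<Rightarrow> real) \<Rightarrow> 'a \<Rightarrow> 'a" where
  "cgrad \<phi> x = (\<Sum>b\<in>Basis. frechet_derivative \<phi> (at x) b *\<^sub>R b)"

lemma cgrad_component: "b \<in> Basis \<Longrightarrow> cgrad \<phi> x \<bullet> b = frechet_derivative \<phi> (at x) b"
  by (simp add: cgrad_def)

lemma test_fun_weak_grad:
  assumes \<phi>: "test_fun \<Omega> \<phi>"
  shows "is_weak_grad \<Omega> \<phi> (cgrad \<phi>)"
  unfolding is_weak_grad_alt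
proof (intro conjI allI impI ballI)
  have "cgrad \<phi> \<in> borel_measurable (lebesgue_on \<Omega>)"
    unfolding cgrad_def[abs_def] using L2D(1)[OF test_fun_L2(2)[OF \<phi>]]
    by (intro borel_measurable_sum borel_measurable_scaleR borel_measurable_const) blast
  moreover have "integrable (lebesgue_on \<Omega>) (\<lambda>x. (norm (cgrad \<phi> x))\<^sup>2)"
  proof -
    have "(norm (cgrad \<phi> x))\<^sup>2 = (\<Sum>b\<in>Basis. (frechet_derivative \<phi> (at x) b)\<^sup>2)" for x
      unfolding power2_norm_eq_inner
      by (subst euclidean_inner) (simp add: cgrad_component power2_eq_square)
    then show ?thesis using L2D(2)[OF test_fun_L2(2)[OF \<phi>]] by (simp add: Bochner_Integration.integrable_sum)
  qed
  ultimately show "cgrad \<phi> \<in> L2vec \<Omega>" by (simp add: L2vec_def)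
  fix \<psi> and b :: 'a assume "test_fun \<Omega> \<psi>" "b \<in> Basis"
  then show "l2_inner \<Omega> \<phi> (\<lambda>x. frechet_derivative \<psi> (at x) b) = - l2_inner \<Omega> (\<lambda>x. cgrad \<phi> x \<bullet> b) \<psi>"
    using test_fun_by_parts[OF \<phi>] by (simp add: cgrad_component)
qed

lemma test_fun_H1: "test_fun \<Omega> \<phi> \<Longrightarrow> \<phi> \<in> H1 \<Omega>"
  using test_fun_weak_grad test_fun_L2(1) by (auto simp: H1_def)

text \<open>By uniqueness the chosen gradient agrees almost everywhere with the classical one, whose
  components are the partial derivatives.\<close>

lemma l2_nrm_partial_le:
  assumes \<phi>: "test_fun \<Omega> \<phi>" and b: "b \<in> Basis"
  shows "l2.nrm (\<lambda>x. frechet_derivative \<phi> (at x) b) \<le> d.nrm \<phi>"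
proof -
  have "l2_inner \<Omega> (\<lambda>x. frechet_derivative \<phi> (at x) b) (\<lambda>x. frechet_derivative \<phi> (at x) b) \<le> dir \<phi> \<phi>"
    unfolding l2_inner_def dir_def
  proof (rule integral_mono_AE)
    show "integrable (lebesgue_on \<Omega>) (\<lambda>x. frechet_derivative \<phi> (at x) b * frechet_derivative \<phi> (at x) b)"
      by (intro L2_mult_integrable test_fun_L2(2)[OF \<phi> b])
    show "integrable (lebesgue_on \<Omega>) (\<lambda>x. wgrad \<Omega> \<phi> x \<bullet> wgrad \<Omega> \<phi> x)"
      by (intro dir_integrable test_fun_H1[OF \<phi>])
    show "AE x in lebesgue_on \<Omega>. frechet_derivative \<phi> (at x) b * frechet_derivative \<phi> (at x) b \<le> wgrad \<Omega> \<phi> x \<bullet> wgrad \<Omega> \<phi> x"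
      using weak_grad_unique[OF H1D(2)[OF test_fun_H1[OF \<phi>]] test_fun_weak_grad[OF \<phi>]]
    proof eventually_elim
      case (elim x)
      have "\<bar>frechet_derivative \<phi> (at x) b\<bar> \<le> norm (cgrad \<phi> x)"
        using Basis_le_norm[OF b, of "cgrad \<phi> x"] by (simp add: cgrad_component b)
      then have "(frechet_derivative \<phi> (at x) b)\<^sup>2 \<le> (norm (cgrad \<phi> x))\<^sup>2"
        by (simp add: power2_le_iff_abs_le)
      then show ?case using elim unfolding power2_norm_eq_inner by (simp add: power2_eq_square)
    qed
  qed
  then show ?thesis by (simp add: l2.nrm_def d.nrm_def)
qed

text \<open>Integrating \<open>\<partial>\<^sub>b ((x \<bullet> b) \<phi>\<^sup>2) = \<phi>\<^sup>2 + 2 (x \<bullet> b) \<phi> \<partial>\<^sub>b \<phi>\<close> over \<open>\<Omega>\<close>.\<close>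
lemma Poincare_test_fun:
  assumes \<phi>: "test_fun \<Omega> \<phi>" and R: "\<And>x. x \<in> \<Omega> \<Longrightarrow> norm x \<le> R" "R \<ge> 0"
  shows "l2.nrm \<phi> \<le> 2 * R * d.nrm \<phi>"
proof -
  obtain b :: 'a where b: "b \<in> Basis" using nonempty_Basis by blast
  define D where "D x = frechet_derivative \<phi> (at x) b" for x
  define f' where "f' x = \<phi> x * \<phi> x + 2 * ((x \<bullet> b) * \<phi> x * D x)" for x
  obtain K where K: "compact K" "K \<subseteq> \<Omega>" "\<And>x. x \<notin> K \<Longrightarrow> \<phi> x = 0 \<and> frechet_derivative \<phi> (at x) = (\<lambda>h. 0)"
    using test_funD(4)[OF \<phi>] by blast
  have D_cont: "continuous_on UNIV D" unfolding D_def by (rule test_funD(3)[OF \<phi> b])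
  have f'_cont: "continuous_on UNIV f'" unfolding f'_def
    by (intro continuous_intros test_funD(2)[OF \<phi>] D_cont)
  have "(\<integral>x. f' x \<partial>lborel) = 0"
  proof (rule integral_directional_derivative_0[where f="\<lambda>x. (x \<bullet> b) * (\<phi> x * \<phi> x)" and b=b and K=K])
    show "((\<lambda>t. ((x + t *\<^sub>R b) \<bullet> b) * (\<phi> (x + t *\<^sub>R b) * \<phi> (x + t *\<^sub>R b))) has_real_derivative f' x) (at 0)" for x
    proof -
      have 1: "((\<lambda>t. (x + t *\<^sub>R b) \<bullet> b) has_real_derivative 1) (at 0)"
        using b by (auto intro!: derivative_eq_intros simp: inner_add_left)
      have 2: "((\<lambda>t. \<phi> (x + t *\<^sub>R b)) has_real_derivative D x) (at 0)"
        unfolding D_def by (rule smooth_fun_has_line_derivative[OF test_funD(1)[OF \<phi>]])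
      show ?thesis using DERIV_mult[OF 1 DERIV_mult[OF 2 2]] by (simp add: f'_def algebra_simps)
    qed
    show "continuous_on UNIV (\<lambda>x. (x \<bullet> b) * (\<phi> x * \<phi> x))" by (intro continuous_intros test_funD(2)[OF \<phi>])
  qed (use K b f'_cont in \<open>auto simp: f'_def D_def\<close>)
  moreover have "f' x = 0" if "x \<notin> K" for x using K(3)[OF that] by (simp add: f'_def)
  ultimately have int0: "(\<integral>x. f' x \<partial>lebesgue_on \<Omega>) = 0"
    using continuous_compact_support_L2(2)[OF f'_cont K(1) _ K(2)] by simp
  \<comment> \<open>The weight \<open>x \<bullet> b\<close> is at most \<open>R\<close> in modulus
    on \<open>\<Omega>\<close>. With the factor 2 from differentiating the square of
    \<open>\<phi>\<close> this produces the constant \<open>2 * R\<close>.\<close>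
  define p where "p x = (x \<bullet> b) * \<phi> x" for x
  have p: "p \<in> L2 \<Omega>"
    unfolding p_def by (rule continuous_compact_support_L2(1)[OF _ K(1) _ K(2)])
      (use K(3) in \<open>auto intro!: continuous_intros test_funD(2)[OF \<phi>]\<close>)
  have D: "D \<in> L2 \<Omega>" unfolding D_def by (rule test_fun_L2(2)[OF \<phi> b])
  note \<phi>L = test_fun_L2(1)[OF \<phi>]
  have "(\<integral>x. f' x \<partial>lebesgue_on \<Omega>) = l2_inner \<Omega> \<phi> \<phi> + 2 * l2_inner \<Omega> p D"
    unfolding f'_def l2_inner_def p_def[symmetric]
    using L2_mult_integrable[OF p D] L2_mult_integrable[OF \<phi>L \<phi>L] by simp
  then have "(l2.nrm \<phi>)\<^sup>2 \<le> 2 * \<bar>l2_inner \<Omega> p D\<bar>" using int0 by (simp add: l2.nrm_sq[OF \<phi>L])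
  also have "\<dots> \<le> 2 * (l2.nrm p * l2.nrm D)" using l2.Cauchy_Schwarz[OF p D] by simp
  also have "\<dots> \<le> 2 * ((R * l2.nrm \<phi>) * d.nrm \<phi>)"
  proof -
    have "l2_inner \<Omega> p p \<le> (\<integral>x. R\<^sup>2 * (\<phi> x * \<phi> x) \<partial>lebesgue_on \<Omega>)"
      unfolding l2_inner_def
    proof (rule integral_mono)
      fix x assume "x \<in> space (lebesgue_on \<Omega>)"
      then have "\<bar>x \<bullet> b\<bar> \<le> R" using R(1)[of x] Basis_le_norm[OF b, of x] by simp
      then have "(x \<bullet> b)\<^sup>2 \<le> R\<^sup>2" using R(2) by (simp add: power2_le_iff_abs_le)
      then have "(x \<bullet> b)\<^sup>2 * (\<phi> x * \<phi> x) \<le> R\<^sup>2 * (\<phi> x * \<phi> x)" by (intro mult_right_mono) auto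
      then show "p x * p x \<le> R\<^sup>2 * (\<phi> x * \<phi> x)" by (simp add: p_def power2_eq_square mult_ac)
    qed (use L2_mult_integrable[OF p p] L2_mult_integrable[OF \<phi>L \<phi>L] in auto)
    also have "\<dots> = R\<^sup>2 * l2_inner \<Omega> \<phi> \<phi>" by (simp add: l2_inner_def)
    finally have "l2.nrm p \<le> R * l2.nrm \<phi>"
      using R(2) unfolding l2.nrm_def by (metis real_sqrt_le_mono real_sqrt_mult real_sqrt_abs abs_of_nonneg)
    moreover have "l2.nrm D \<le> d.nrm \<phi>" unfolding D_def by (rule l2_nrm_partial_le[OF \<phi> b])
    ultimately show ?thesis
      using l2.nrm_nonneg[OF D] l2.nrm_nonneg[OF \<phi>L] R(2) by (intro mult_left_mono mult_mono) auto
  qed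
  finally have "l2.nrm \<phi> * l2.nrm \<phi> \<le> (2 * R * d.nrm \<phi>) * l2.nrm \<phi>" by (simp add: power2_eq_square mult_ac)
  then show ?thesis
    using l2.nrm_nonneg[OF \<phi>L] d.nrm_nonneg[OF test_fun_H1[OF \<phi>]] R(2)
    by (cases "l2.nrm \<phi> = 0") auto
qed

section \<open>The space H01: linearity, Poincare inequality, completeness\<close>

lemma H01_D: "u \<in> H01 \<Omega> \<Longrightarrow> u \<in> H1 \<Omega>"
  by (simp add: H01_def)

lemma H01_approx:
  assumes "u \<in> H01 \<Omega>"
  obtains \<phi> where "\<And>n. test_fun \<Omega> (\<phi> n)" "(\<lambda>n. h.nrm (\<lambda>x. \<phi> n x - u x)) \<longlonglongrightarrow> 0"
  using assms by (auto simp: H01_def h1_norm_eq)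

lemma zero_H01: "(\<lambda>x. 0) \<in> H01 \<Omega>"
proof -
  have "h.nrm (\<lambda>x. 0) = 0" by (simp add: h.nrm_def h.zero_left zero_H1)
  then show ?thesis unfolding H01_def using zero_H1 test_fun_zero
    by (auto simp: h1_norm_eq intro!: exI[of _ "\<lambda>n x. 0"])
qed

lemma H01_lincomb:
  assumes u: "u \<in> H01 \<Omega>" and v: "v \<in> H01 \<Omega>"
  shows "(\<lambda>x. c * u x + d * v x) \<in> H01 \<Omega>"
proof -
  obtain \<phi> where \<phi>: "\<And>n. test_fun \<Omega> (\<phi> n)" "(\<lambda>n. h.nrm (\<lambda>x. \<phi> n x - u x)) \<longlonglongrightarrow> 0"
    using H01_approx[OF u] by blast
  obtain \<psi> where \<psi>: "\<And>n. test_fun \<Omega> (\<psi> n)" "(\<lambda>n. h.nrm (\<lambda>x. \<psi> n x - v x)) \<longlonglongrightarrow> 0"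
    using H01_approx[OF v] by blast
  note mem = h.diff_mem[OF test_fun_H1[OF \<phi>(1)] H01_D[OF u]] h.diff_mem[OF test_fun_H1[OF \<psi>(1)] H01_D[OF v]]
  have mem': "(\<lambda>x. (c * \<phi> n x + d * \<psi> n x) - (c * u x + d * v x)) \<in> H1 \<Omega>" for n
    by (intro h.diff_mem test_fun_H1 test_fun_lincomb \<phi> \<psi> H1_lincomb(1) H01_D u v)
  have "(\<lambda>n. h.nrm (\<lambda>x. (c * \<phi> n x + d * \<psi> n x) - (c * u x + d * v x))) \<longlonglongrightarrow> 0"
  proof (rule Lim_null_comparison)
    show "\<forall>\<^sub>F n in sequentially. norm (h.nrm (\<lambda>x. (c * \<phi> n x + d * \<psi> n x) - (c * u x + d * v x)))
        \<le> \<bar>c\<bar> * h.nrm (\<lambda>x. \<phi> n x - u x) + \<bar>d\<bar> * h.nrm (\<lambda>x. \<psi> n x - v x)"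
    proof (rule always_eventually, rule allI)
      fix n
      have "(\<lambda>x. (c * \<phi> n x + d * \<psi> n x) - (c * u x + d * v x)) = (\<lambda>x. c * (\<phi> n x - u x) + d * (\<psi> n x - v x))"
        by (simp add: algebra_simps)
      then show "norm (h.nrm (\<lambda>x. (c * \<phi> n x + d * \<psi> n x) - (c * u x + d * v x)))
        \<le> \<bar>c\<bar> * h.nrm (\<lambda>x. \<phi> n x - u x) + \<bar>d\<bar> * h.nrm (\<lambda>x. \<psi> n x - v x)"
        using h.nrm_triangle[OF h.scale_mem[OF mem(1), of c n] h.scale_mem[OF mem(2), of d n]]
          h.nrm_scale[OF mem(1), of c n] h.nrm_scale[OF mem(2), of d n] h.nrm_nonneg[OF mem'[of n]] by simp
    qed
    show "(\<lambda>n. \<bar>c\<bar> * h.nrm (\<lambda>x. \<phi> n x - u x) + \<bar>d\<bar> * h.nrm (\<lambda>x. \<psi> n x - v x)) \<longlonglongrightarrow> 0"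
      using tendsto_add[OF tendsto_mult_left[OF \<phi>(2), of "\<bar>c\<bar>"] tendsto_mult_left[OF \<psi>(2), of "\<bar>d\<bar>"]] by simp
  qed
  then show ?thesis unfolding H01_def h1_norm_eq
    using H1_lincomb(1)[OF H01_D[OF u] H01_D[OF v]] test_fun_lincomb[OF \<phi>(1) \<psi>(1)]
    by (auto intro!: exI[of _ "\<lambda>n x. c * \<phi> n x + d * \<psi> n x"])
qed

text \<open>The inequality for test functions passes to limits because both of its sides are
  controlled by the H1 seminorm of the approximation error.\<close>

lemma Poincare:
  obtains C where "C \<ge> 0" "\<And>u. u \<in> H01 \<Omega> \<Longrightarrow> l2.nrm u \<le> C * d.nrm u"
proof -
  obtain R where R: "\<And>x. x \<in> \<Omega> \<Longrightarrow> norm x \<le> R" "R > 0"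
    using bounded_\<Omega> by (auto simp: bounded_pos)
  have "l2.nrm u \<le> (2 * R) * d.nrm u" if u: "u \<in> H01 \<Omega>" for u
  proof -
    obtain \<phi> where \<phi>: "\<And>n. test_fun \<Omega> (\<phi> n)" "(\<lambda>n. h.nrm (\<lambda>x. \<phi> n x - u x)) \<longlonglongrightarrow> 0"
      using H01_approx[OF u] by blast
    note uH = H01_D[OF u]
    note \<phi>H = test_fun_H1[OF \<phi>(1)]
    have "l2.nrm u \<le> (1 + 2 * R) * h.nrm (\<lambda>x. \<phi> n x - u x) + (2 * R) * d.nrm u" for n
    proof -
      have dm: "(\<lambda>x. \<phi> n x - u x) \<in> H1 \<Omega>" by (rule h.diff_mem[OF \<phi>H uH])
      have "l2.nrm u \<le> l2.nrm (\<lambda>x. u x - \<phi> n x) + l2.nrm (\<phi> n)"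
        using l2.nrm_triangle[OF l2.diff_mem[OF H1D(1)[OF uH] H1D(1)[OF \<phi>H]] H1D(1)[OF \<phi>H], of n n] by simp
      also have "l2.nrm (\<lambda>x. u x - \<phi> n x) = l2.nrm (\<lambda>x. \<phi> n x - u x)"
        by (rule l2.nrm_minus_commute[OF H1D(1)[OF uH] H1D(1)[OF \<phi>H]])
      also have "l2.nrm (\<lambda>x. \<phi> n x - u x) \<le> h.nrm (\<lambda>x. \<phi> n x - u x)" by (rule l2_nrm_le[OF dm])
      also have "l2.nrm (\<phi> n) \<le> 2 * R * d.nrm (\<phi> n)" using R by (intro Poincare_test_fun[OF \<phi>(1)]) auto
      also have "d.nrm (\<phi> n) \<le> d.nrm (\<lambda>x. \<phi> n x - u x) + d.nrm u"
        using d.nrm_triangle[OF dm uH] by simp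
      also have "d.nrm (\<lambda>x. \<phi> n x - u x) \<le> h.nrm (\<lambda>x. \<phi> n x - u x)" by (rule d_nrm_le[OF dm])
      finally show ?thesis using R(2) by (simp add: algebra_simps)
    qed
    moreover have "(\<lambda>n. (1 + 2 * R) * h.nrm (\<lambda>x. \<phi> n x - u x) + (2 * R) * d.nrm u) \<longlonglongrightarrow> (1 + 2 * R) * 0 + (2 * R) * d.nrm u"
      by (intro tendsto_intros \<phi>(2))
    ultimately show ?thesis using LIMSEQ_le_const[of _ "(1 + 2 * R) * 0 + (2 * R) * d.nrm u" "l2.nrm u"] by auto
  qed
  then show thesis using that[of "2 * R"] R(2) by auto
qed

text \<open>Functions and chosen gradients converge separately in L2. The weak gradient identity
  survives since it pairs them with fixed L2 functions, and a diagonal choice of test functions puts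
  the limit back into H01.\<close>

lemma H01_complete:
  assumes u: "\<And>n::nat. u n \<in> H01 \<Omega>"
    and cauchy: "\<And>e. e > 0 \<Longrightarrow> \<exists>N. \<forall>m\<ge>N. \<forall>n\<ge>N. h.nrm (\<lambda>x. u m x - u n x) < e"
  shows "\<exists>v\<in>H01 \<Omega>. (\<lambda>n. h.nrm (\<lambda>x. u n x - v x)) \<longlonglongrightarrow> 0"
proof -
  interpret finite_measure "lebesgue_on \<Omega>" by (rule finite_measure_\<Omega>)
  note uH = H01_D[OF u]
  note uL = H1D(1)[OF uH]
  \<comment> \<open>Arbitrary weak gradients may stand in for the chosen ones. This matters for the
    limit, whose gradient comes from completeness and not from \<open>wgrad\<close>.\<close>
  have h1_eq: "h1 (\<lambda>x. p x - q x) (\<lambda>x. p x - q x) =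
     (\<integral>x. (norm (p x - q x))\<^sup>2 \<partial>lebesgue_on \<Omega>) + (\<integral>x. (norm (g x - k x))\<^sup>2 \<partial>lebesgue_on \<Omega>)"
    if p: "p \<in> H1 \<Omega>" "is_weak_grad \<Omega> p g" and q: "q \<in> H1 \<Omega>" "is_weak_grad \<Omega> q k" for p q g k
  proof -
    have m: "(\<lambda>x. p x - q x) \<in> H1 \<Omega>" by (rule h.diff_mem[OF p(1) q(1)])
    have gv: "g \<in> L2vec \<Omega>" "k \<in> L2vec \<Omega>" using p q by (auto simp: is_weak_grad_alt)
    have "is_weak_grad \<Omega> (\<lambda>x. p x - q x) (\<lambda>x. g x - k x)"
      using weak_grad_lincomb[OF H1D(1)[OF p(1)] p(2) H1D(1)[OF q(1)] q(2), of 1 "-1"] by simp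
    then have AE: "AE x in lebesgue_on \<Omega>. wgrad \<Omega> (\<lambda>x. p x - q x) x = g x - k x"
      by (rule weak_grad_unique[OF H1D(2)[OF m]])
    have "dir (\<lambda>x. p x - q x) (\<lambda>x. p x - q x) = (\<integral>x. (norm (g x - k x))\<^sup>2 \<partial>lebesgue_on \<Omega>)"
      unfolding dir_def
    proof (rule integral_cong_AE)
      show "(\<lambda>x. wgrad \<Omega> (\<lambda>x. p x - q x) x \<bullet> wgrad \<Omega> (\<lambda>x. p x - q x) x) \<in> borel_measurable (lebesgue_on \<Omega>)"
        by (rule borel_measurable_integrable[OF dir_integrable[OF m m]])
      show "(\<lambda>x. (norm (g x - k x))\<^sup>2) \<in> borel_measurable (lebesgue_on \<Omega>)"
        using gv by (auto simp: L2vec_def)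
      show "AE x in lebesgue_on \<Omega>. wgrad \<Omega> (\<lambda>x. p x - q x) x \<bullet> wgrad \<Omega> (\<lambda>x. p x - q x) x = (norm (g x - k x))\<^sup>2"
        using AE by eventually_elim (simp add: power2_norm_eq_inner)
    qed
    then show ?thesis by (simp add: h1_def l2_inner_def power2_eq_square)
  qed
  have cauchy_sq: "\<exists>N. \<forall>i\<ge>N. \<forall>j\<ge>N. h1 (\<lambda>x. u i x - u j x) (\<lambda>x. u i x - u j x) < e" if e: "e > 0" for e
  proof -
    obtain N where N: "\<And>m n. m \<ge> N \<Longrightarrow> n \<ge> N \<Longrightarrow> h.nrm (\<lambda>x. u m x - u n x) < sqrt e"
      using cauchy[of "sqrt e"] e by auto
    have "h1 (\<lambda>x. u i x - u j x) (\<lambda>x. u i x - u j x) < e" if "i \<ge> N" "j \<ge> N" for i j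
      using N[OF that] by (simp add: h.nrm_def)
    then show ?thesis by blast
  qed
  have le: "(\<integral>x. (norm (u i x - u j x))\<^sup>2 \<partial>lebesgue_on \<Omega>) \<le> h1 (\<lambda>x. u i x - u j x) (\<lambda>x. u i x - u j x)"
    "(\<integral>x. (norm (wgrad \<Omega> (u i) x - wgrad \<Omega> (u j) x))\<^sup>2 \<partial>lebesgue_on \<Omega>) \<le> h1 (\<lambda>x. u i x - u j x) (\<lambda>x. u i x - u j x)" for i j
    unfolding h1_eq[OF uH[of i] H1D(2)[OF uH[of i]] uH[of j] H1D(2)[OF uH[of j]]] by simp_all
  obtain v where v: "v \<in> borel_measurable (lebesgue_on \<Omega>)" "integrable (lebesgue_on \<Omega>) (\<lambda>x. (norm (v x))\<^sup>2)"
    and vi: "\<And>n. integrable (lebesgue_on \<Omega>) (\<lambda>x. (norm (u n x - v x))\<^sup>2)"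
    and vlim: "(\<lambda>n. \<integral>x. (norm (u n x - v x))\<^sup>2 \<partial>lebesgue_on \<Omega>) \<longlonglongrightarrow> 0"
  proof (rule L2_complete[of u])
    show "u n \<in> borel_measurable (lebesgue_on \<Omega>)" "integrable (lebesgue_on \<Omega>) (\<lambda>x. (norm (u n x))\<^sup>2)" for n
      using uL[of n] by (auto simp: L2_def)
    show "\<exists>N. \<forall>i\<ge>N. \<forall>j\<ge>N. (\<integral>x. (norm (u i x - u j x))\<^sup>2 \<partial>lebesgue_on \<Omega>) < e" if "e > 0" for e
      using cauchy_sq[OF that] le_less_trans[OF le(1)] by blast
  qed blast
  have vL: "v \<in> L2 \<Omega>" using v by (simp add: L2_def)
  obtain g where g: "g \<in> borel_measurable (lebesgue_on \<Omega>)" "integrable (lebesgue_on \<Omega>) (\<lambda>x. (norm (g x))\<^sup>2)"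
    and gi: "\<And>n. integrable (lebesgue_on \<Omega>) (\<lambda>x. (norm (wgrad \<Omega> (u n) x - g x))\<^sup>2)"
    and glim: "(\<lambda>n. \<integral>x. (norm (wgrad \<Omega> (u n) x - g x))\<^sup>2 \<partial>lebesgue_on \<Omega>) \<longlonglongrightarrow> 0"
  proof (rule L2_complete[of "\<lambda>n. wgrad \<Omega> (u n)"])
    show "wgrad \<Omega> (u n) \<in> borel_measurable (lebesgue_on \<Omega>)"
      "integrable (lebesgue_on \<Omega>) (\<lambda>x. (norm (wgrad \<Omega> (u n) x))\<^sup>2)" for n
      using H1D(3)[OF uH, of n] by (auto simp: L2vec_def)
    show "\<exists>N. \<forall>i\<ge>N. \<forall>j\<ge>N. (\<integral>x. (norm (wgrad \<Omega> (u i) x - wgrad \<Omega> (u j) x))\<^sup>2 \<partial>lebesgue_on \<Omega>) < e" if "e > 0" for e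
      using cauchy_sq[OF that] le_less_trans[OF le(2)] by blast
  qed blast
  have gL: "g \<in> L2vec \<Omega>" using g by (simp add: L2vec_def)
  have l2_lim: "(\<lambda>n. l2_inner \<Omega> (p n) w) \<longlonglongrightarrow> l2_inner \<Omega> q w"
    if p: "\<And>n. p n \<in> L2 \<Omega>" and q: "q \<in> L2 \<Omega>" and w: "w \<in> L2 \<Omega>"
      and lim: "(\<lambda>n. l2_inner \<Omega> (\<lambda>x. p n x - q x) (\<lambda>x. p n x - q x)) \<longlonglongrightarrow> 0" for p q w
  proof (rule LIM_zero_cancel, rule Lim_null_comparison)
    show "\<forall>\<^sub>F n in sequentially. norm (l2_inner \<Omega> (p n) w - l2_inner \<Omega> q w) \<le> l2.nrm (\<lambda>x. p n x - q x) * l2.nrm w"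
      using l2.Cauchy_Schwarz[OF l2.diff_mem[OF p q] w] by (simp add: l2.diff_left p q w)
    have "(\<lambda>n. l2.nrm (\<lambda>x. p n x - q x)) \<longlonglongrightarrow> sqrt 0"
      unfolding l2.nrm_def by (rule tendsto_real_sqrt[OF lim])
    then show "(\<lambda>n. l2.nrm (\<lambda>x. p n x - q x) * l2.nrm w) \<longlonglongrightarrow> 0"
      using tendsto_mult_right[of _ 0 sequentially "l2.nrm w"] by auto
  qed
  have wg: "is_weak_grad \<Omega> v g"
    unfolding is_weak_grad_alt
  proof (intro conjI allI impI ballI gL)
    fix \<phi> and b :: 'a assume \<phi>: "test_fun \<Omega> \<phi>" and b: "b \<in> Basis"
    have 1: "(\<lambda>n. l2_inner \<Omega> (u n) (\<lambda>x. frechet_derivative \<phi> (at x) b)) \<longlonglongrightarrow> l2_inner \<Omega> v (\<lambda>x. frechet_derivative \<phi> (at x) b)"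
      using vlim by (intro l2_lim uL vL test_fun_L2(2)[OF \<phi> b]) (simp add: l2_inner_def power2_eq_square)
    have 2: "(\<lambda>n. l2_inner \<Omega> (\<lambda>x. wgrad \<Omega> (u n) x \<bullet> b) \<phi>) \<longlonglongrightarrow> l2_inner \<Omega> (\<lambda>x. g x \<bullet> b) \<phi>"
    proof (intro l2_lim L2vec_component H1D(3) uH gL b test_fun_L2(1)[OF \<phi>])
      show "(\<lambda>n. l2_inner \<Omega> (\<lambda>x. wgrad \<Omega> (u n) x \<bullet> b - g x \<bullet> b) (\<lambda>x. wgrad \<Omega> (u n) x \<bullet> b - g x \<bullet> b)) \<longlonglongrightarrow> 0"
      proof (rule Lim_null_comparison[OF _ glim], rule always_eventually, rule allI)
        fix n
        have m: "(\<lambda>x. wgrad \<Omega> (u n) x \<bullet> b - g x \<bullet> b) \<in> L2 \<Omega>"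
          by (intro l2.diff_mem L2vec_component H1D(3) uH gL b)
        have "l2_inner \<Omega> (\<lambda>x. wgrad \<Omega> (u n) x \<bullet> b - g x \<bullet> b) (\<lambda>x. wgrad \<Omega> (u n) x \<bullet> b - g x \<bullet> b)
            \<le> (\<integral>x. (norm (wgrad \<Omega> (u n) x - g x))\<^sup>2 \<partial>lebesgue_on \<Omega>)"
          unfolding l2_inner_def
        proof (rule integral_mono[OF L2_mult_integrable[OF m m] gi])
          fix x
          have "\<bar>(wgrad \<Omega> (u n) x - g x) \<bullet> b\<bar> \<le> norm (wgrad \<Omega> (u n) x - g x)" by (rule Basis_le_norm[OF b])
          then have "((wgrad \<Omega> (u n) x - g x) \<bullet> b)\<^sup>2 \<le> (norm (wgrad \<Omega> (u n) x - g x))\<^sup>2"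
            by (simp add: power2_le_iff_abs_le)
          then show "(wgrad \<Omega> (u n) x \<bullet> b - g x \<bullet> b) * (wgrad \<Omega> (u n) x \<bullet> b - g x \<bullet> b) \<le> (norm (wgrad \<Omega> (u n) x - g x))\<^sup>2"
            by (simp add: inner_diff_left power2_eq_square)
        qed
        then show "norm (l2_inner \<Omega> (\<lambda>x. wgrad \<Omega> (u n) x \<bullet> b - g x \<bullet> b) (\<lambda>x. wgrad \<Omega> (u n) x \<bullet> b - g x \<bullet> b))
            \<le> (\<integral>x. (norm (wgrad \<Omega> (u n) x - g x))\<^sup>2 \<partial>lebesgue_on \<Omega>)"
          using l2.nonneg[OF m] by simp
      qed
    qed
    have "l2_inner \<Omega> (u n) (\<lambda>x. frechet_derivative \<phi> (at x) b) = - l2_inner \<Omega> (\<lambda>x. wgrad \<Omega> (u n) x \<bullet> b) \<phi>" for n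
      using H1D(2)[OF uH, of n] \<phi> b by (simp add: is_weak_grad_alt)
    then show "l2_inner \<Omega> v (\<lambda>x. frechet_derivative \<phi> (at x) b) = - l2_inner \<Omega> (\<lambda>x. g x \<bullet> b) \<phi>"
      using LIMSEQ_unique[OF 1] tendsto_minus[OF 2] by simp
  qed
  have vH: "v \<in> H1 \<Omega>" using vL wg by (auto simp: H1_def)
  have lim: "(\<lambda>n. h.nrm (\<lambda>x. u n x - v x)) \<longlonglongrightarrow> 0"
  proof -
    have "(\<lambda>n. sqrt ((\<integral>x. (norm (u n x - v x))\<^sup>2 \<partial>lebesgue_on \<Omega>) + (\<integral>x. (norm (wgrad \<Omega> (u n) x - g x))\<^sup>2 \<partial>lebesgue_on \<Omega>)))
        \<longlonglongrightarrow> sqrt (0 + 0)"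
      by (intro tendsto_intros vlim glim)
    then show ?thesis by (simp add: h.nrm_def h1_eq[OF uH H1D(2)[OF uH] vH wg])
  qed
  define e where "e n = inverse (real (Suc n))" for n
  \<comment> \<open>Diagonal choice: one test function within \<open>e n\<close> of
    \<open>u n\<close> for each \<open>n\<close>.\<close>
  have "\<exists>\<phi>. test_fun \<Omega> \<phi> \<and> h.nrm (\<lambda>x. \<phi> x - u n x) < e n" for n
  proof -
    obtain \<phi> where \<phi>: "\<And>k. test_fun \<Omega> (\<phi> k)" "(\<lambda>k. h.nrm (\<lambda>x. \<phi> k x - u n x)) \<longlonglongrightarrow> 0"
      using H01_approx[OF u] by blast
    have "0 < e n" by (simp add: e_def)
    then obtain k where "h.nrm (\<lambda>x. \<phi> k x - u n x) < e n"
      using order_tendstoD(2)[OF \<phi>(2)] by (auto simp: eventually_sequentially)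
    then show ?thesis using \<phi>(1) by blast
  qed
  then obtain \<phi> where \<phi>: "\<And>n. test_fun \<Omega> (\<phi> n)" "\<And>n. h.nrm (\<lambda>x. \<phi> n x - u n x) < e n" by metis
  have "(\<lambda>n. h.nrm (\<lambda>x. \<phi> n x - v x)) \<longlonglongrightarrow> 0"
  proof (rule Lim_null_comparison)
    show "\<forall>\<^sub>F n in sequentially. norm (h.nrm (\<lambda>x. \<phi> n x - v x)) \<le> e n + h.nrm (\<lambda>x. u n x - v x)"
    proof (rule always_eventually, rule allI)
      fix n
      show "norm (h.nrm (\<lambda>x. \<phi> n x - v x)) \<le> e n + h.nrm (\<lambda>x. u n x - v x)"
        using h.nrm_triangle_diff[OF test_fun_H1[OF \<phi>(1)] uH vH, of n n] \<phi>(2)[of n]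
          h.nrm_nonneg[OF h.diff_mem[OF test_fun_H1[OF \<phi>(1)] vH], of n] by simp
    qed
    have "e \<longlonglongrightarrow> 0" unfolding e_def by (rule LIMSEQ_inverse_real_of_nat)
    then show "(\<lambda>n. e n + h.nrm (\<lambda>x. u n x - v x)) \<longlonglongrightarrow> 0" using tendsto_add[OF _ lim] by auto
  qed
  then have "v \<in> H01 \<Omega>" unfolding H01_def h1_norm_eq using vH \<phi>(1) by auto
  then show ?thesis using lim by blast
qed

end

section \<open>The elliptic form and its solution operator\<close>

text \<open>The matrix order quantifies over vectors, the abstract flow over functions on the index
  type; \<open>\<chi>\<close> converts one into the other.\<close>

lemma mat_le_gram_iff:
  "mat_le (mat 1) (gram \<Omega> W W) \<longleftrightarrow>
    (\<forall>x. (\<Sum>i\<in>UNIV. (x i)\<^sup>2) \<le> (\<Sum>i\<in>UNIV. \<Sum>j\<in>UNIV. x i * l2_inner \<Omega> (W i) (W j) * x j))"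
proof -
  have form: "y \<bullet> ((gram \<Omega> W W - mat 1) *v y) =
      (\<Sum>i\<in>UNIV. \<Sum>j\<in>UNIV. y $ i * l2_inner \<Omega> (W i) (W j) * y $ j) - (\<Sum>i\<in>UNIV. (y $ i)\<^sup>2)" for y
  proof -
    have "y \<bullet> (gram \<Omega> W W *v y) = (\<Sum>i\<in>UNIV. \<Sum>j\<in>UNIV. y $ i * l2_inner \<Omega> (W i) (W j) * y $ j)"
      by (simp add: inner_vec_def matrix_vector_mult_def gram_def sum_distrib_left mult.assoc)
    moreover have "y \<bullet> y = (\<Sum>i\<in>UNIV. (y $ i)\<^sup>2)"
      by (simp add: inner_vec_def power2_eq_square)
    ultimately show ?thesis by (simp add: matrix_vector_mult_diff_rdistrib inner_diff_right)
  qed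
  show ?thesis
  proof
    assume *: "mat_le (mat 1) (gram \<Omega> W W)"
    show "\<forall>x. (\<Sum>i\<in>UNIV. (x i)\<^sup>2) \<le> (\<Sum>i\<in>UNIV. \<Sum>j\<in>UNIV. x i * l2_inner \<Omega> (W i) (W j) * x j)"
    proof
      fix x
      show "(\<Sum>i\<in>UNIV. (x i)\<^sup>2) \<le> (\<Sum>i\<in>UNIV. \<Sum>j\<in>UNIV. x i * l2_inner \<Omega> (W i) (W j) * x j)"
        using *[unfolded mat_le_def, rule_format, of "\<chi> i. x i"] by (simp add: form)
    qed
  qed (simp add: mat_le_def form)
qed

locale elliptic = bounded_open \<Omega> for \<Omega> :: "'a::euclidean_space set" +
  fixes V :: "'a \<Rightarrow> real" and c1 c2 :: real
  assumes V_int: "\<And>u v. u \<in> H01 \<Omega> \<Longrightarrow> v \<in> H01 \<Omega> \<Longrightarrow> integrable (lebesgue_on \<Omega>) (\<lambda>x. V x * u x * v x)"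
    and c1_pos: "c1 > 0"
    and coercive: "\<And>u. u \<in> H01 \<Omega> \<Longrightarrow>
        c1 * grad_sq \<Omega> u \<le> aform \<Omega> V u u \<and> aform \<Omega> V u u \<le> c2 * grad_sq \<Omega> u"
begin

lemma aform_eq:
  assumes "u \<in> H01 \<Omega>" "v \<in> H01 \<Omega>"
  shows "aform \<Omega> V u v = dir u v + (\<integral>x. V x * u x * v x \<partial>lebesgue_on \<Omega>)"
  unfolding aform_def dir_def
  by (intro Bochner_Integration.integral_add dir_integrable V_int H01_D assms)

sublocale a: semi_inner "H01 \<Omega>" "aform \<Omega> V"
proof
  fix u v w :: "'a \<Rightarrow> real" and c d
  assume u: "u \<in> H01 \<Omega>" and v: "v \<in> H01 \<Omega>"
  show uv: "(\<lambda>x. c * u x + d * v x) \<in> H01 \<Omega>" by (rule H01_lincomb[OF u v])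
  show "aform \<Omega> V u v = aform \<Omega> V v u" by (simp add: aform_def inner_commute mult_ac)
  assume w: "w \<in> H01 \<Omega>"
  have "(\<integral>x. V x * (c * u x + d * v x) * w x \<partial>lebesgue_on \<Omega>) =
      (\<integral>x. c * (V x * u x * w x) + d * (V x * v x * w x) \<partial>lebesgue_on \<Omega>)"
    by (simp add: algebra_simps)
  also have "\<dots> = c * (\<integral>x. V x * u x * w x \<partial>lebesgue_on \<Omega>) + d * (\<integral>x. V x * v x * w x \<partial>lebesgue_on \<Omega>)"
    using V_int[OF u w] V_int[OF v w] by simp
  finally show "aform \<Omega> V (\<lambda>x. c * u x + d * v x) w = c * aform \<Omega> V u w + d * aform \<Omega> V v w"
    using dir_lincomb[OF u[THEN H01_D] v[THEN H01_D] w[THEN H01_D], of c d]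
    by (simp add: aform_eq u v w uv algebra_simps)
next
  show "0 \<le> aform \<Omega> V u u" if "u \<in> H01 \<Omega>" for u
  proof -
    \<comment> \<open>The potential may be negative, so nonnegativity of the form comes from the
      lower coercivity bound.\<close>
    have "0 \<le> c1 * grad_sq \<Omega> u" using c1_pos by (simp add: grad_sq_def)
    then show ?thesis using coercive[OF that] by linarith
  qed
qed (rule zero_H01)

lemma a_nrm_le_h_nrm:
  assumes "u \<in> H01 \<Omega>"
  shows "a.nrm u \<le> sqrt \<bar>c2\<bar> * h.nrm u"
proof -
  have "aform \<Omega> V u u \<le> \<bar>c2\<bar> * dir u u"
  proof -
    have "c2 * dir u u \<le> \<bar>c2\<bar> * dir u u" using d.nonneg[OF H01_D[OF assms]] by (intro mult_right_mono) auto
    then show ?thesis using coercive[OF assms] by (simp add: grad_sq_eq_dir)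
  qed
  then have "a.nrm u \<le> sqrt \<bar>c2\<bar> * d.nrm u"
    unfolding a.nrm_def d.nrm_def by (metis real_sqrt_le_mono real_sqrt_mult)
  also have "\<dots> \<le> sqrt \<bar>c2\<bar> * h.nrm u" by (intro mult_left_mono d_nrm_le H01_D assms) simp
  finally show ?thesis .
qed

text \<open>Poincare bounds the L2 part by \<open>C\<^sup>2\<close> times the Dirichlet form, and
  coercivity bounds the latter by the energy form divided by \<open>c1\<close>; hence the value of
  \<open>k\<close>.\<close>

lemma h_nrm_le_a_nrm:
  obtains k where "k > 0" "\<And>u. u \<in> H01 \<Omega> \<Longrightarrow> h.nrm u \<le> k * a.nrm u"
proof -
  obtain C where C: "C \<ge> 0" "\<And>u. u \<in> H01 \<Omega> \<Longrightarrow> l2.nrm u \<le> C * d.nrm u" using Poincare by blast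
  define k where "k = sqrt ((C\<^sup>2 + 1) / c1)"
  have "h.nrm u \<le> k * a.nrm u" if u: "u \<in> H01 \<Omega>" for u
  proof -
    note uH = H01_D[OF u]
    have "(l2.nrm u)\<^sup>2 \<le> (C * d.nrm u)\<^sup>2"
      using C(2)[OF u] l2.nrm_nonneg[OF H1D(1)[OF uH]] by (intro power_mono)
    then have "h1 u u \<le> (C\<^sup>2 + 1) * dir u u"
      by (simp add: h1_def l2.nrm_sq[OF H1D(1)[OF uH]] power_mult_distrib d.nrm_sq[OF uH] algebra_simps)
    also have "\<dots> \<le> (C\<^sup>2 + 1) * (aform \<Omega> V u u / c1)"
    proof (rule mult_left_mono)
      show "dir u u \<le> aform \<Omega> V u u / c1"
        using coercive[OF u] c1_pos by (simp add: grad_sq_eq_dir field_simps)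
    qed simp
    finally have "h1 u u \<le> (C\<^sup>2 + 1) / c1 * aform \<Omega> V u u" by simp
    then show ?thesis unfolding h.nrm_def a.nrm_def k_def by (metis real_sqrt_le_mono real_sqrt_mult)
  qed
  moreover have "k > 0" using c1_pos by (simp add: k_def add_nonneg_pos)
  ultimately show thesis using that by blast
qed

text \<open>The energy seminorm and the H1 seminorm are equivalent on H01, so completeness carries
  over to the energy form. The functional is bounded because
  \<open>l2.nrm u \<le> h.nrm u \<le> k * a.nrm u\<close>.\<close>

lemma Gop_exists:
  assumes f: "f \<in> L2 \<Omega>"
  shows "\<exists>g. g \<in> H01 \<Omega> \<and> (\<forall>v\<in>H01 \<Omega>. aform \<Omega> V g v = l2_inner \<Omega> f v)"
proof -
  obtain k where k: "k > 0" "\<And>u. u \<in> H01 \<Omega> \<Longrightarrow> h.nrm u \<le> k * a.nrm u" using h_nrm_le_a_nrm by blast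
  obtain g where "g \<in> H01 \<Omega>" "\<And>v. v \<in> H01 \<Omega> \<Longrightarrow> aform \<Omega> V g v = l2_inner \<Omega> f v"
  proof (rule a.Riesz_representation[where f="l2_inner \<Omega> f" and C="l2.nrm f * k"])
    fix u :: "nat \<Rightarrow> 'a \<Rightarrow> real"
    assume u: "\<And>n. u n \<in> H01 \<Omega>"
      and cauchy: "\<And>e. e > 0 \<Longrightarrow> \<exists>N. \<forall>m\<ge>N. \<forall>n\<ge>N. a.nrm (\<lambda>x. u m x - u n x) < e"
    have h_cauchy: "\<exists>N. \<forall>m\<ge>N. \<forall>n\<ge>N. h.nrm (\<lambda>x. u m x - u n x) < e" if e: "e > 0" for e
    proof -
      obtain N where N: "\<And>m n. m \<ge> N \<Longrightarrow> n \<ge> N \<Longrightarrow> a.nrm (\<lambda>x. u m x - u n x) < e / k"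
        using cauchy[of "e / k"] e k(1) by auto
      have "h.nrm (\<lambda>x. u m x - u n x) < e" if "m \<ge> N" "n \<ge> N" for m n
      proof -
        have "h.nrm (\<lambda>x. u m x - u n x) \<le> k * a.nrm (\<lambda>x. u m x - u n x)"
          by (rule k(2)[OF a.diff_mem[OF u u]])
        also have "\<dots> < e" using N[OF that] k(1) by (simp add: field_simps)
        finally show ?thesis .
      qed
      then show ?thesis by blast
    qed
    have "\<exists>v\<in>H01 \<Omega>. (\<lambda>n. h.nrm (\<lambda>x. u n x - v x)) \<longlonglongrightarrow> 0"
      by (rule H01_complete) (rule u, erule h_cauchy)
    then obtain v where v: "v \<in> H01 \<Omega>" "(\<lambda>n. h.nrm (\<lambda>x. u n x - v x)) \<longlonglongrightarrow> 0" ..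
    have "(\<lambda>n. a.nrm (\<lambda>x. u n x - v x)) \<longlonglongrightarrow> 0"
    proof (rule Lim_null_comparison)
      show "\<forall>\<^sub>F n in sequentially. norm (a.nrm (\<lambda>x. u n x - v x)) \<le> sqrt \<bar>c2\<bar> * h.nrm (\<lambda>x. u n x - v x)"
        using a_nrm_le_h_nrm[OF a.diff_mem[OF u v(1)]] a.nrm_nonneg[OF a.diff_mem[OF u v(1)]] by simp
      show "(\<lambda>n. sqrt \<bar>c2\<bar> * h.nrm (\<lambda>x. u n x - v x)) \<longlonglongrightarrow> 0"
        using tendsto_mult_left[OF v(2)] by simp
    qed
    then show "\<exists>v\<in>H01 \<Omega>. (\<lambda>n. a.nrm (\<lambda>x. u n x - v x)) \<longlonglongrightarrow> 0" using v(1) by blast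
  next
    show "l2_inner \<Omega> f (\<lambda>x. c * u x + d * v x) = c * l2_inner \<Omega> f u + d * l2_inner \<Omega> f v"
      if "u \<in> H01 \<Omega>" "v \<in> H01 \<Omega>" for u v c d
      by (rule l2.lincomb_right[OF H1D(1)[OF H01_D[OF that(1)]] H1D(1)[OF H01_D[OF that(2)]] f])
    show "\<bar>l2_inner \<Omega> f u\<bar> \<le> l2.nrm f * k * a.nrm u" if u: "u \<in> H01 \<Omega>" for u
    proof -
      have "\<bar>l2_inner \<Omega> f u\<bar> \<le> l2.nrm f * l2.nrm u" by (rule l2.Cauchy_Schwarz[OF f H1D(1)[OF H01_D[OF u]]])
      also have "\<dots> \<le> l2.nrm f * (k * a.nrm u)"
        using l2_nrm_le[OF H01_D[OF u]] k(2)[OF u] l2.nrm_nonneg[OF f] by (intro mult_left_mono) auto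
      finally show ?thesis by (simp add: mult.assoc)
    qed
  qed blast
  then show ?thesis by blast
qed

lemma Gop:
  assumes "f \<in> H01 \<Omega>"
  shows "Gop \<Omega> V f \<in> H01 \<Omega>" "v \<in> H01 \<Omega> \<Longrightarrow> aform \<Omega> V (Gop \<Omega> V f) v = l2_inner \<Omega> f v"
  using someI_ex[OF Gop_exists[OF H1D(1)[OF H01_D[OF assms]]]] unfolding Gop_def by blast+

lemma flow_rhs_H01:
  assumes "\<And>i. W i \<in> H01 \<Omega>"
  shows "flow_rhs \<Omega> V W i \<in> H01 \<Omega>"
proof -
  have "(\<lambda>x. Gop \<Omega> V (W i) x - (\<Sum>k\<in>UNIV. l2_inner \<Omega> (Gop \<Omega> V (W k)) (W i) * W k x)) \<in> H01 \<Omega>"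
    by (intro a.diff_mem a.sum_mem Gop assms) simp
  then show ?thesis by (simp add: flow_rhs_def Gtuple_def tuple_mult_def gram_def mult.commute)
qed

lemma semi_inner_l2_H01: "semi_inner (H01 \<Omega>) (l2_inner \<Omega>)"
  by (rule semi_inner_subset[OF semi_inner_L2]) (auto intro: H1D(1) H01_D zero_H01 H01_lincomb)

end

section \<open>Monotonicity of the energy along the flow\<close>

theorem theorem3p3:
  fixes \<Omega> :: "'a::euclidean_space set"
    and \<V> :: "'a \<Rightarrow> real"
    and U :: "real \<Rightarrow> 'n::finite \<Rightarrow> 'a \<Rightarrow> real"
    and T c1 c2 :: real
  assumes dom: "open \<Omega>" "connected \<Omega>" "bounded \<Omega>" "\<Omega> \<noteq> {}"
    and V_meas: "\<V> \<in> borel_measurable (lebesgue_on \<Omega>)"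
    and V_int: "\<And>u v. u \<in> H01 \<Omega> \<Longrightarrow> v \<in> H01 \<Omega> \<Longrightarrow>
                  integrable (lebesgue_on \<Omega>) (\<lambda>x. \<V> x * u x * v x)"
    and c_pos: "c1 > 0" "c2 > 0"
    and coercive: "\<And>u. u \<in> H01 \<Omega> \<Longrightarrow>
                  c1 * grad_sq \<Omega> u \<le> aform \<Omega> \<V> u u \<and> aform \<Omega> \<V> u u \<le> c2 * grad_sq \<Omega> u"
    and T_pos: "T > 0"
    and U_H01: "\<And>t i. t \<in> {0..<T} \<Longrightarrow> U t i \<in> H01 \<Omega>"
    and U_deriv: "\<And>t i. t \<in> {0..<T} \<Longrightarrow>
        ((\<lambda>s. h1_norm \<Omega> (\<lambda>x. (U s i x - U t i x) / (s - t) - flow_rhs \<Omega> \<V> (U t) i x))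
           \<longlongrightarrow> 0) (at t within {0..<T})"
    and U_C1: "\<And>t i. t \<in> {0..<T} \<Longrightarrow>
        ((\<lambda>s. h1_norm \<Omega> (\<lambda>x. flow_rhs \<Omega> \<V> (U s) i x - flow_rhs \<Omega> \<V> (U t) i x))
           \<longlongrightarrow> 0) (at t within {0..<T})"
    and init: "U 0 \<in> quasi_stiefel \<Omega>"
  shows "\<forall>t\<in>{0..<T}. \<exists>D. ((\<lambda>s. energy \<Omega> \<V> (U s)) has_real_derivative D) (at t within {0..<T})
                        \<and> D \<le> 0"
proof
  fix t assume t: "t \<in> {0..<T}"
  interpret elliptic \<Omega> \<V> c1 c2
    by unfold_locales (use dom V_int c_pos coercive in auto)
  \<comment> \<open>The error of the difference quotient lies in H01, so its H1 convergence controls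
    both seminorms of the abstract flow, the energy one through the upper coercivity bound.\<close>
  define r where "r t i s = (\<lambda>x. (U s i x - U t i x) / (s - t) - flow_rhs \<Omega> \<V> (U t) i x)" for t i s
  have r_mem: "r t i s \<in> H01 \<Omega>" if "t \<in> {0..<T}" "s \<in> {0..<T}" for t i s
  proof -
    have 1: "(\<lambda>x. 1 / (s - t) * (U s i x - U t i x)) \<in> H01 \<Omega>"
      by (intro a.scale_mem a.diff_mem U_H01 that)
    have 2: "flow_rhs \<Omega> \<V> (U t) i \<in> H01 \<Omega>" by (intro flow_rhs_H01 U_H01 that)
    show ?thesis using a.diff_mem[OF 1 2] by (simp add: r_def)
  qed
  have r_lim: "((\<lambda>s. h.nrm (r t i s)) \<longlongrightarrow> 0) (at t within {0..<T})" if "t \<in> {0..<T}" for t i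
    using U_deriv[OF that, of i] by (simp add: r_def h1_norm_eq)
  have "\<exists>D\<le>0. ((\<lambda>s. 1/2 * (\<Sum>i\<in>UNIV. aform \<Omega> \<V> (U s i) (U s i))) has_real_derivative D) (at t within {0..<T})"
  proof (rule energy_derivative_nonpos[where S="H01 \<Omega>" and l="l2_inner \<Omega>" and a="aform \<Omega> \<V>" and G="Gop \<Omega> \<V>"
        and F="\<lambda>t. flow_rhs \<Omega> \<V> (U t)"])
    show "semi_inner (H01 \<Omega>) (l2_inner \<Omega>)" by (rule semi_inner_l2_H01)
    show "semi_inner (H01 \<Omega>) (aform \<Omega> \<V>)" by (rule a.semi_inner_axioms)
    show "flow_rhs \<Omega> \<V> (U s) i x = Gop \<Omega> \<V> (U s i) x - (\<Sum>k\<in>UNIV. U s k x * l2_inner \<Omega> (Gop \<Omega> \<V> (U s k)) (U s i))" for s i x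
      by (simp add: flow_rhs_def Gtuple_def tuple_mult_def gram_def)
    show "(\<Sum>i\<in>UNIV. (x i)\<^sup>2) \<le> (\<Sum>i\<in>UNIV. \<Sum>j\<in>UNIV. x i * l2_inner \<Omega> (U 0 i) (U 0 j) * x j)" for x
      using init by (simp add: quasi_stiefel_def mat_le_gram_iff)
    fix s i assume s: "s \<in> {0..<T}"
    have "((\<lambda>\<tau>. l2.nrm (r s i \<tau>)) \<longlongrightarrow> 0) (at s within {0..<T})"
    proof (rule Lim_null_comparison[OF _ r_lim[OF s]])
      show "\<forall>\<^sub>F \<tau> in at s within {0..<T}. norm (l2.nrm (r s i \<tau>)) \<le> h.nrm (r s i \<tau>)"
        unfolding eventually_at_filter
        using l2_nrm_le[OF H01_D[OF r_mem[OF s]]] l2.nrm_nonneg[OF H1D(1)[OF H01_D[OF r_mem[OF s]]]]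
        by (intro always_eventually) auto
    qed
    then show "((\<lambda>\<tau>. l2.nrm (\<lambda>x. (U \<tau> i x - U s i x) / (\<tau> - s) - flow_rhs \<Omega> \<V> (U s) i x)) \<longlongrightarrow> 0) (at s within {0..<T})"
      by (simp add: r_def)
    have "((\<lambda>\<tau>. a.nrm (r s i \<tau>)) \<longlongrightarrow> 0) (at s within {0..<T})"
    proof (rule Lim_null_comparison)
      show "\<forall>\<^sub>F \<tau> in at s within {0..<T}. norm (a.nrm (r s i \<tau>)) \<le> sqrt \<bar>c2\<bar> * h.nrm (r s i \<tau>)"
        unfolding eventually_at_filter
        using a_nrm_le_h_nrm[OF r_mem[OF s]] a.nrm_nonneg[OF r_mem[OF s]]
        by (intro always_eventually) auto
      show "((\<lambda>\<tau>. sqrt \<bar>c2\<bar> * h.nrm (r s i \<tau>)) \<longlongrightarrow> 0) (at s within {0..<T})"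
        using tendsto_mult_left[OF r_lim[OF s]] by simp
    qed
    then show "((\<lambda>\<tau>. a.nrm (\<lambda>x. (U \<tau> i x - U s i x) / (\<tau> - s) - flow_rhs \<Omega> \<V> (U s) i x)) \<longlongrightarrow> 0) (at s within {0..<T})"
      by (simp add: r_def)
  qed (use Gop U_H01 t in auto)
  then show "\<exists>D. ((\<lambda>s. energy \<Omega> \<V> (U s)) has_real_derivative D) (at t within {0..<T}) \<and> D \<le> 0"
    unfolding energy_def by blast
qed

end
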